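(* Let $A$, $B$, $C$ be positive integers and $N:=A+B+C$. Let $\Delta$ be the equilateral triangle in $\mathbb{R}^2$ with vertices $(-1,0)$, $(1,0)$, and $(0,\sqrt{3})$, let $V_3$ be the edge of $\Delta$ that lies on the $x$-axis, and let $$\boldsymbol{x}:=\left(\frac{B-A}{N},\frac{\sqrt{3}\,C}{N}\right).$$ Let $\{\boldsymbol{B}(t),\,t\ge0\}$ be standard two-dimensional Brownian motion, and let $T_1$ be the exit time of $\boldsymbol{x}+\boldsymbol{B}$ from $\Delta$. Then $$\lim_{n\to\infty}\left[P_{nA,nB,nC}(321)+P_{nA,nB,nC}(312)\right]=P(\boldsymbol{x}+\boldsymbol{B}(T_1)\in V_3).$$ Furthermore, $$\lim_{n\to\infty}P_{nA,nB,nC}(321)=E\left(\frac{|\boldsymbol{x}+\boldsymbol{B}(T_1)-(1,0)|}{2};\ \boldsymbol{x}+\boldsymbol{B}(T_1)\in V_3\right).$$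
   Context: Three-player gambler's ruin: players 1, 2, 3 start with positive integer capitals $A$, $B$, $C$ (in units), respectively. At each round, independently of the past, a pair of players is chosen uniformly at random from the three pairs, and a fair coin flip decides which of the two players in the pair transfers one unit to the other. When a player's capital reaches $0$, that player is eliminated, and play continues between the remaining two players, with one unit transferred according to a fair coin flip at each round, until one of them is eliminated. For $\sigma=\sigma(1)\sigma(2)\sigma(3)\in S_3$ written in one-line notation, $P_{A,B,C}(\sigma)$ denotes the probability, starting from capitals $A,B,C$, that the elimination order is $\sigma$: player $\sigma(1)$ is eliminated first, player $\sigma(2)$ is eliminated second, and player $\sigma(3)$ ends with all $A+B+C$ units. For example, $321$ means that player 3 is eliminated first and player 2 second, leaving player 1 with all the units. Conventions: standard two-dimensional Brownian motion starts at the origin, $\boldsymbol{B}(0)=(0,0)$; $|\cdot|$ is the Euclidean norm; $E(X;\,G)$ denotes $E(X\mathbf{1}_G)$ for a random variable $X$ and an event $G$. The exit time $T_1$ is the first time that $\boldsymbol{x}+\boldsymbol{B}$ hits the boundary of $\Delta$. The point $\boldsymbol{x}$ is the point of $\Delta$ with barycentric coordinates $(A/N,B/N,C/N)$ relative to the vertices $(-1,0)$, $(1,0)$, $(0,\sqrt{3})$. *)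

theory Defs
  imports "HOL-Probability.Probability"
begin

section \<open>Three-player gambler's ruin\<close>

text \<open>Players are the numbers 1, 2, 3; a state assigns to each player the current capital.\<close>

type_synonym capitals = "nat \<Rightarrow> nat"

definition init_capitals :: "nat \<Rightarrow> nat \<Rightarrow> nat \<Rightarrow> capitals" where
  "init_capitals A B C = (\<lambda>_. 0)(1 := A, 2 := B, 3 := C)"

definition alive :: "capitals \<Rightarrow> nat set" where
  "alive c = {i \<in> {1, 2, 3}. 0 < c i}"

text \<open>The coin decides which of the two players of the pair pays one unit to the other.\<close>

definition transfer :: "nat \<times> nat \<Rightarrow> bool \<Rightarrow> capitals \<Rightarrow> capitals" where
  "transfer p b c = (case p of (i, j) \<Rightarrow>
     if b then c(i := c i - 1, j := c j + 1) else c(i := c i + 1, j := c j - 1))"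

text \<open>
  The randomness of one round is a uniformly chosen pair together with an independent fair coin.
  Once only two players are left, the drawn pair is ignored and the coin alone is used for the
  two remaining players; once a single player is left, the state is frozen.
\<close>

type_synonym round = "(nat \<times> nat) \<times> bool"

definition round_pmf :: "round pmf" where
  "round_pmf = pair_pmf (pmf_of_set {(1, 2), (1, 3), (2, 3)}) (bernoulli_pmf (1/2))"

definition play_round :: "round \<Rightarrow> capitals \<Rightarrow> capitals" where
  "play_round r c =
     (if card (alive c) = 3 then transfer (fst r) (snd r) c
      else if card (alive c) = 2 then transfer (Min (alive c), Max (alive c)) (snd r) c
      else c)"

primrec capitals_at :: "capitals \<Rightarrow> round stream \<Rightarrow> nat \<Rightarrow> capitals" where
  "capitals_at c \<omega> 0 = c"
| "capitals_at c \<omega> (Suc k) = play_round (\<omega> !! k) (capitals_at c \<omega> k)"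

text \<open>The value is \<open>\<infinity>\<close> if the player is never eliminated.\<close>

definition elim_time :: "capitals \<Rightarrow> round stream \<Rightarrow> nat \<Rightarrow> enat" where
  "elim_time c \<omega> i = Inf (enat ` {k. capitals_at c \<omega> k i = 0})"

text \<open>
  A permutation in one-line notation is the list of its values: for \<open>321\<close>, that is \<open>[3, 2, 1]\<close>,
  player 3 is eliminated first, player 2 second, and player 1 ends with all the units.
\<close>

definition elimination_order :: "capitals \<Rightarrow> round stream \<Rightarrow> nat list \<Rightarrow> bool" where
  "elimination_order c \<omega> \<sigma> \<longleftrightarrow>
     (\<exists>k. elim_time c \<omega> (\<sigma> ! 0) < enat k \<and> elim_time c \<omega> (\<sigma> ! 1) = enat k \<and>
          capitals_at c \<omega> k (\<sigma> ! 2) = (\<Sum>i\<in>{1, 2, 3}. c i))"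

definition elimination_prob :: "nat \<Rightarrow> nat \<Rightarrow> nat \<Rightarrow> nat list \<Rightarrow> real" where
  "elimination_prob A B C \<sigma> =
     measure (stream_space (measure_pmf round_pmf))
       {\<omega> \<in> space (stream_space (measure_pmf round_pmf)).
          elimination_order (init_capitals A B C) \<omega> \<sigma>}"


section \<open>Planar Brownian motion\<close>

text \<open>
  The type \<^typ>\<open>real \<times> real\<close> carries the Euclidean norm. Only times \<open>t \<ge> 0\<close> are constrained.
  Every path (rather than almost every path) starts at the origin and is continuous, so that
  exit events are measurable without completing the probability space.
\<close>

locale standard_brownian_motion_2d = prob_space M
  for M :: "'w measure" and W :: "real \<Rightarrow> 'w \<Rightarrow> real \<times> real" +
  assumes measurable_W: "\<And>t. 0 \<le> t \<Longrightarrow> W t \<in> borel_measurable M"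
    and start_W: "\<And>\<omega>. \<omega> \<in> space M \<Longrightarrow> W 0 \<omega> = (0, 0)"
    and continuous_W: "\<And>\<omega>. \<omega> \<in> space M \<Longrightarrow> continuous_on {0..} (\<lambda>t. W t \<omega>)"
    and normal_increments: "\<And>s t. 0 \<le> s \<Longrightarrow> s < t \<Longrightarrow>
      distributed M lborel (\<lambda>\<omega>. W t \<omega> - W s \<omega>)
        (\<lambda>(u, v). ennreal (normal_density 0 (sqrt (t - s)) u * normal_density 0 (sqrt (t - s)) v))"
    and independent_increments: "\<And>(\<tau> :: nat \<Rightarrow> real) n. 0 \<le> \<tau> 0 \<Longrightarrow> mono \<tau> \<Longrightarrow>
      indep_vars (\<lambda>_. borel) (\<lambda>k \<omega>. W (\<tau> (Suc k)) \<omega> - W (\<tau> k) \<omega>) {..<n}"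

text \<open>The value is \<open>\<infinity>\<close> if the path never hits the boundary of \<open>S\<close>.\<close>

definition exit_time :: "(real \<Rightarrow> 'a::topological_space) \<Rightarrow> 'a set \<Rightarrow> ereal" where
  "exit_time f S = Inf (ereal ` {t. 0 \<le> t \<and> f t \<in> frontier S})"

definition triangle :: "(real \<times> real) set" where
  "triangle = convex hull {(-1, 0), (1, 0), (0, sqrt 3)}"

definition V3 :: "(real \<times> real) set" where
  "V3 = closed_segment (-1, 0) (1, 0)"

end

theory Submission
  imports Defs "HOL-Real_Asymp.Real_Asymp"
begin

text \<open>
  For \<open>w\<close> outside the triangle, \<open>ln |z - w|\<close> is harmonic near the triangle, so its second order Taylor
  polynomial is annihilated by every centred isotropic increment. A telescoping argument therefore shows that
  the expectation of this function at the exit point is its value at \<open>x\<close>, exactly for Brownian motion and up to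
  \<open>O(1/n)\<close> for the rescaled capital process, which is a walk with six equally likely steps. A probability measure on
  the boundary of the triangle is determined by these logarithmic potentials: the identity extends to \<open>w\<close> on the
  boundary by moving along an outward normal, which bounds the logarithmic energy, and the energy of the
  difference of two solutions vanishes; writing the kernel as a superposition of Gaussians, which are positive
  definite, the two characteristic functions agree. By compactness the exit laws of the walk converge weakly to the Brownian
  one, which has no atoms and hence does not charge the end points of \<open>V3\<close>, where the limiting functionals are
  discontinuous. These functionals arise because, once player 3 is out, the probability that player 1 wins is linear in his capital.
\<close>

section \<open>Isotropic Taylor expansions and the triangle\<close>

text \<open>The two processes share only a local property: mean zero, equal variances and zero
  covariance of each increment. Testing with functions that are harmonic up to the boundary uses
  exactly this and sees only the place of exit, so the clocks of the walk and of Brownian motion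
  never have to be matched. Poles \<open>w\<close> outside the closed triangle keep the third order
  error uniform up to the boundary: the walk makes on average \<open>O(N^2)\<close> rounds before
  the first elimination, with an error \<open>O(1 / N^3)\<close> in each. The energy argument needs
  potentials at points of the support, where the logarithm is unbounded and cannot be tested
  directly. Moving the pole inwards along a normal makes the kernel increase at every point of the
  triangle, so monotone convergence yields finiteness and the exact value at once. In the energy of
  a difference of two probability measures the constants \<open>exp (- t * R^2)\<close> cancel, and
  what remains is a nonnegative Gaussian energy for every \<open>t\<close>.\<close>

text \<open>
  The quadratic part is trace-free: to second order, \<open>f\<close> is harmonic on \<open>S\<close>. The increments \<open>(u, v)\<close> are
  not restricted, so that a discretised path may overshoot \<open>S\<close>.
\<close>
definition iso_taylor :: "(real \<times> real) set \<Rightarrow> (real \<times> real \<Rightarrow> real) \<Rightarrow> bool" where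
  "iso_taylor S f \<longleftrightarrow> continuous_on UNIV f \<and> bounded (range f) \<and>
     (\<exists>p1 p2 q1 q2 L K. p1 \<in> borel_measurable borel \<and> p2 \<in> borel_measurable borel \<and>
        q1 \<in> borel_measurable borel \<and> q2 \<in> borel_measurable borel \<and>
        (\<forall>y. \<bar>p1 y\<bar> \<le> L \<and> \<bar>p2 y\<bar> \<le> L \<and> \<bar>q1 y\<bar> \<le> L \<and> \<bar>q2 y\<bar> \<le> L) \<and>
        (\<forall>y\<in>S. \<forall>u v. \<bar>f (y + (u, v)) - f y
           - (p1 y * u + p2 y * v + q1 y * (u\<^sup>2 - v\<^sup>2) + q2 y * (u * v))\<bar> \<le> K * norm (u, v) ^ 3))"

text \<open>Real part of the complex Taylor formula for \<open>Ln (1 + z)\<close> on the disc of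
  radius 1/2. There \<open>|1 + z| \<ge> 1/2\<close>, so the third derivative
  \<open>2 / (1 + z)^3\<close> is at most 16, and the remainder formula divides by
  \<open>fact 2\<close>.\<close>

lemma ln_cmod_taylor:
  assumes "cmod \<eta> \<le> 1/2"
  shows "\<bar>ln (cmod (1 + \<eta>)) - Re (\<eta> - \<eta>\<^sup>2 / 2)\<bar> \<le> 8 * cmod \<eta> ^ 3"
proof -
  define f :: "nat \<Rightarrow> complex \<Rightarrow> complex" where
    "f i z = (if i = 0 then Ln (1 + z) else if i = 1 then 1 / (1 + z)
       else if i = 2 then - 1 / (1 + z)^2 else 2 / (1 + z)^3)" for i z
  have pos: "Re (1 + z) \<ge> 1/2" if "z \<in> cball 0 (1/2)" for z :: complex
    using that abs_Re_le_cmod[of z] by auto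
  have nz: "1 + z \<noteq> 0" if "z \<in> cball 0 (1/2)" for z :: complex
    using pos[OF that] by (auto simp: complex_eq_iff)
  have nonR: "1 + z \<notin> \<real>\<^sub>\<le>\<^sub>0" if "z \<in> cball 0 (1/2)" for z :: complex
    using pos[OF that] by (auto simp: complex_nonpos_Reals_iff)
  have "cmod (f 0 \<eta> - (\<Sum>i\<le>2. f i 0 * (\<eta> - 0) ^ i / fact i)) \<le> 16 * cmod (\<eta> - 0) ^ Suc 2 / fact 2"
  proof (rule complex_Taylor[where S = "cball 0 (1/2)"])
    fix i :: nat and z :: complex assume z: "z \<in> cball 0 (1/2)" and i: "i \<le> 2"
    consider "i = 0" | "i = 1" | "i = 2" using i by force
    then show "(f i has_field_derivative f (Suc i) z) (at z within cball 0 (1/2))"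
    proof cases
      case 3
      have "((\<lambda>z. - 1 / (1 + z)\<^sup>2) has_field_derivative 2 * (1 + z) / (1 + z) ^ 4) (at z within cball 0 (1/2))"
        using nz[OF z]
        by (auto intro!: derivative_eq_intros simp: divide_simps)
      moreover have "2 * (1 + z) / (1 + z) ^ 4 = 2 / (1 + z) ^ 3"
        using nz[OF z] by (simp add: divide_simps) (simp add: eval_nat_numeral algebra_simps)
      ultimately show ?thesis using 3 by (simp add: f_def [abs_def])
    qed (use nonR[OF z] nz[OF z] in
        \<open>auto simp: f_def [abs_def] power2_eq_square divide_simps intro!: derivative_eq_intros\<close>)
  next
    fix z :: complex assume z: "z \<in> cball 0 (1/2)"
    have "cmod (1 + z) \<ge> 1/2" using pos[OF z] abs_Re_le_cmod[of "1 + z"] by linarith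
    then have "cmod (1 + z) ^ 3 \<ge> (1/2)^3" by (intro power_mono) auto
    then have "2 / cmod (1 + z) ^ 3 \<le> 2 / (1/2)^3" by (intro frac_le) auto
    then show "cmod (f (Suc 2) z) \<le> 16"
      by (simp add: f_def norm_divide norm_power power_divide)
  qed (use assms in auto)
  also have "(\<Sum>i\<le>2. f i 0 * (\<eta> - 0) ^ i / fact i) = \<eta> - \<eta>\<^sup>2 / 2"
    by (simp add: f_def numeral_2_eq_2)
  finally have *: "cmod (Ln (1 + \<eta>) - (\<eta> - \<eta>\<^sup>2 / 2)) \<le> 8 * cmod \<eta> ^ 3"
    by (simp add: f_def eval_nat_numeral)
  have "Re (Ln (1 + \<eta>)) = ln (cmod (1 + \<eta>))"
    using nz[of \<eta>] assms by (intro Re_Ln) auto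
  then show ?thesis
    using * abs_Re_le_cmod[of "Ln (1 + \<eta>) - (\<eta> - \<eta>\<^sup>2 / 2)"] by simp
qed

text \<open>With \<open>A\<close>, \<open>X\<close> the complex numbers of \<open>a\<close>,
  \<open>\<xi>\<close>, the difference of logarithms is \<open>ln |1 + X / A|\<close>. Its second
  order part is the real part of a holomorphic square, hence trace-free as \<open>iso_taylor\<close>
  demands.\<close>

lemma ln_norm_taylor:
  fixes a \<xi> :: "real \<times> real"
  assumes "d > 0" "d \<le> norm a" "norm \<xi> \<le> d / 2"
  defines "r \<equiv> (fst a)\<^sup>2 + (snd a)\<^sup>2"
  shows "\<bar>ln (norm (a + \<xi>)) - ln (norm a) - (fst a / r * fst \<xi> + snd a / r * snd \<xi>
      + (- ((fst a)\<^sup>2 - (snd a)\<^sup>2) / (2 * r\<^sup>2)) * ((fst \<xi>)\<^sup>2 - (snd \<xi>)\<^sup>2)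
      + (- 2 * fst a * snd a / r\<^sup>2) * (fst \<xi> * snd \<xi>))\<bar>
      \<le> 8 / d ^ 3 * norm \<xi> ^ 3"
proof -
  define A where "A = Complex (fst a) (snd a)"
  define X where "X = Complex (fst \<xi>) (snd \<xi>)"
  have nA: "cmod A = norm a" by (simp add: A_def cmod_def norm_prod_def)
  have nX: "cmod X = norm \<xi>" by (simp add: X_def cmod_def norm_prod_def)
  have nAX: "cmod (A + X) = norm (a + \<xi>)" by (simp add: A_def X_def cmod_def norm_prod_def)
  have A0: "A \<noteq> 0" using assms nA by auto
  have r0: "r > 0" using A0 by (auto simp: r_def A_def complex_eq_iff sum_power2_gt_zero_iff)
  have na: "norm a > 0" using assms by linarith
  have le: "cmod (X / A) \<le> norm \<xi> / d"
    using assms by (simp add: norm_divide nA nX frac_le)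
  also have "\<dots> \<le> 1/2" using assms by (simp add: field_simps)
  finally have half: "cmod (X / A) \<le> 1/2" .
  have 1: "1 + X / A = (A + X) / A" using A0 by (simp add: field_simps)
  have "norm (a + \<xi>) > 0"
    using assms norm_diff_ineq[of a \<xi>] by auto
  then have lneq: "ln (cmod (1 + X / A)) = ln (norm (a + \<xi>)) - ln (norm a)"
    unfolding 1 norm_divide nA nAX using na by (simp add: ln_div)
  have "X / A = Complex ((fst \<xi> * fst a + snd \<xi> * snd a) / r) ((snd \<xi> * fst a - fst \<xi> * snd a) / r)"
    by (simp add: complex_eq_iff Re_divide Im_divide A_def X_def r_def)
  then have "Re (X / A - (X / A)\<^sup>2 / 2) = (fst \<xi> * fst a + snd \<xi> * snd a) / r
     - (((fst \<xi> * fst a + snd \<xi> * snd a) / r)\<^sup>2 - ((snd \<xi> * fst a - fst \<xi> * snd a) / r)\<^sup>2) / 2"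
    by (simp add: power2_eq_square)
  also have "\<dots> = fst a / r * fst \<xi> + snd a / r * snd \<xi>
      + (- ((fst a)\<^sup>2 - (snd a)\<^sup>2) / (2 * r\<^sup>2)) * ((fst \<xi>)\<^sup>2 - (snd \<xi>)\<^sup>2)
      + (- 2 * fst a * snd a / r\<^sup>2) * (fst \<xi> * snd \<xi>)"
    using r0 by (simp add: field_simps) (simp add: power2_eq_square algebra_simps)
  finally have Re: "fst a / r * fst \<xi> + snd a / r * snd \<xi>
      + (- ((fst a)\<^sup>2 - (snd a)\<^sup>2) / (2 * r\<^sup>2)) * ((fst \<xi>)\<^sup>2 - (snd \<xi>)\<^sup>2)
      + (- 2 * fst a * snd a / r\<^sup>2) * (fst \<xi> * snd \<xi>) = Re (X / A - (X / A)\<^sup>2 / 2)" by (rule sym)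
  have "8 * cmod (X / A) ^ 3 \<le> 8 * (norm \<xi> / d) ^ 3"
    by (intro mult_left_mono power_mono le) auto
  then show ?thesis
    unfolding Re using ln_cmod_taylor[OF half] lneq by (simp add: power_divide)
qed

text \<open>The distance is clipped to the range from \<open>d/2\<close> to \<open>D0 + d/2\<close>,
  which makes the function bounded and leaves it unchanged within distance \<open>d/2\<close> of
  \<open>S\<close>. Shorter increments are covered by \<open>ln_norm_taylor\<close>; for longer ones
  boundedness alone gives a cubic estimate.\<close>

lemma iso_taylor_ln_dist:
  assumes "compact S" "S \<noteq> {}" "w \<notin> S"
  obtains f where "iso_taylor S f" "\<And>z. z \<in> S \<Longrightarrow> f z = ln (dist z w)"
proof -
  define d where "d = infdist w S"
  have d: "d > 0"
    unfolding d_def using assms by (simp add: infdist_pos_not_in_closed compact_imp_closed)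
  have dS: "d \<le> dist z w" if "z \<in> S" for z
    using infdist_le[OF that, of w] by (simp add: d_def dist_commute)
  obtain D0 where D0: "\<And>z. z \<in> S \<Longrightarrow> dist w z \<le> D0"
    using bounded_any_center[of S w] compact_imp_bounded[OF assms(1)] by auto
  define D where "D = D0 + d / 2"
  obtain z0 where "z0 \<in> S" using assms by auto
  then have dD: "d \<le> D" using D0[of z0] dS[of z0] d by (simp add: D_def dist_commute)
  define f where "f z = ln (max (d/2) (min (dist z w) D))" for z
  have rng: "d / 2 \<le> max (d/2) (min (dist z w) D)" "max (d/2) (min (dist z w) D) \<le> D" for z
    using d dD by auto
  define B where "B = max \<bar>ln (d/2)\<bar> \<bar>ln D\<bar>"
  have B: "\<bar>f z\<bar> \<le> B" for z
  proof -
    have "ln (d/2) \<le> f z" "f z \<le> ln D" using rng[of z] d unfolding f_def by (auto simp: ln_mono)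
    then show ?thesis by (auto simp: B_def)
  qed
  have feq: "f z = ln (dist z w)" if "d/2 \<le> dist z w" "dist z w \<le> D" for z
    using that by (simp add: f_def)
  define r where "r y = (fst (y - w))\<^sup>2 + (snd (y - w))\<^sup>2" for y :: "real \<times> real"
  \<comment> \<open>Cutting the coefficients off outside \<open>S\<close> keeps them bounded, since
    they blow up at \<open>w\<close>.\<close>
  define I where "I y = indicat_real S y" for y
  define p1 where "p1 y = I y * (fst (y - w) / r y)" for y
  define p2 where "p2 y = I y * (snd (y - w) / r y)" for y
  define q1 where "q1 y = I y * (- ((fst (y - w))\<^sup>2 - (snd (y - w))\<^sup>2) / (2 * (r y)\<^sup>2))" for y
  define q2 where "q2 y = I y * (- 2 * fst (y - w) * snd (y - w) / (r y)\<^sup>2)" for y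
  have [measurable]: "S \<in> sets borel" using assms(1) by (simp add: borel_compact)
  have [measurable]: "(\<lambda>y. fst (y - w)) \<in> borel_measurable borel" "(\<lambda>y. snd (y - w)) \<in> borel_measurable borel"
    by (intro borel_measurable_continuous_onI continuous_intros)+
  have [measurable]: "r \<in> borel_measurable borel" "I \<in> borel_measurable borel"
    unfolding r_def I_def by measurable
  have m: "p1 \<in> borel_measurable borel" "p2 \<in> borel_measurable borel"
    "q1 \<in> borel_measurable borel" "q2 \<in> borel_measurable borel"
    unfolding p1_def p2_def q1_def q2_def by measurable
  define L where "L = max (1 / d) (1 / d\<^sup>2)"
  have L0: "L \<ge> 0" unfolding L_def using d by (intro max.coboundedI1) simp
  have bnd: "\<bar>p1 y\<bar> \<le> L \<and> \<bar>p2 y\<bar> \<le> L \<and> \<bar>q1 y\<bar> \<le> L \<and> \<bar>q2 y\<bar> \<le> L" for y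
  proof (cases "y \<in> S")
    case True
    define a b where "a = fst (y - w)" and "b = snd (y - w)"
    have r: "r y = (dist y w)\<^sup>2" by (simp add: r_def dist_norm norm_prod_def)
    have rd: "d\<^sup>2 \<le> r y" unfolding r using dS[OF True] d by (intro power_mono) auto
    have r0: "r y > 0" using rd d by (meson less_le_trans zero_less_power)
    have ab: "\<bar>a\<bar> \<le> dist y w" "\<bar>b\<bar> \<le> dist y w"
      using norm_fst_le[of "fst (y - w)" "snd (y - w)"] norm_snd_le[of "snd (y - w)" "fst (y - w)"]
      unfolding a_def b_def dist_norm prod.collapse by auto
    have 1: "\<bar>c / r y\<bar> \<le> L" if "\<bar>c\<bar> \<le> dist y w" for c
    proof -
      have "\<bar>c / r y\<bar> \<le> dist y w / (dist y w)\<^sup>2"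
        unfolding r using that by (simp add: abs_divide divide_right_mono)
      also have "\<dots> = 1 / dist y w" by (simp add: power2_eq_square)
      also have "\<dots> \<le> 1 / d" using dS[OF True] d by (simp add: frac_le)
      finally show ?thesis by (simp add: L_def)
    qed
    have 2: "\<bar>c / (r y)\<^sup>2\<bar> \<le> L" if "\<bar>c\<bar> \<le> r y" for c
    proof -
      have "\<bar>c / (r y)\<^sup>2\<bar> \<le> r y / (r y)\<^sup>2"
        using that by (simp add: abs_divide divide_right_mono)
      also have "\<dots> = 1 / r y" by (simp add: power2_eq_square)
      also have "\<dots> \<le> 1 / d\<^sup>2" using rd d by (simp add: frac_le)
      finally show ?thesis by (simp add: L_def)
    qed
    have rr: "r y = a\<^sup>2 + b\<^sup>2" by (simp add: r_def a_def b_def)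
    have "2 * \<bar>a * b\<bar> \<le> a\<^sup>2 + b\<^sup>2"
      using sum_squares_bound[of "\<bar>a\<bar>" "\<bar>b\<bar>"] by (simp add: abs_mult)
    then have ab2: "\<bar>- 2 * a * b\<bar> \<le> r y" by (simp add: rr abs_mult)
    have "\<bar>a\<^sup>2 - b\<^sup>2\<bar> \<le> r y" "0 \<le> r y"
      unfolding rr by (auto simp: abs_le_iff)
    then have "\<bar>- (a\<^sup>2 - b\<^sup>2) / 2\<bar> \<le> r y" by simp
    moreover have "p1 y = a / r y" "p2 y = b / r y" "q1 y = (- (a\<^sup>2 - b\<^sup>2) / 2) / (r y)\<^sup>2"
      "q2 y = (- 2 * a * b) / (r y)\<^sup>2"
      using True by (simp_all add: p1_def p2_def q1_def q2_def I_def a_def b_def)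
    ultimately show ?thesis
      using 2[OF ab2] 1[OF ab(1)] 1[OF ab(2)] 2[of "- (a\<^sup>2 - b\<^sup>2) / 2"] by simp
  qed (use L0 in \<open>auto simp: p1_def p2_def q1_def q2_def I_def\<close>)
  define e where "e = d / 2"
  have e: "e > 0" using d by (simp add: e_def)
  have B0: "B \<ge> 0" by (simp add: B_def)
  \<comment> \<open>The first summand serves increments of length at most \<open>e\<close>, the
    bracket the longer ones.\<close>
  define K where "K = 8 / d ^ 3 + (2 * B / e ^ 3 + 2 * L / e\<^sup>2 + 2 * L / e)"
  have main: "\<bar>f (y + (u, v)) - f y - (p1 y * u + p2 y * v + q1 y * (u\<^sup>2 - v\<^sup>2) + q2 y * (u * v))\<bar>
      \<le> K * norm (u, v) ^ 3" if y: "y \<in> S" for y u v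
  proof (cases "norm (u, v) \<le> d / 2")
    case True
    have le: "dist (y + (u, v)) w \<le> dist y w + norm (u, v)" "dist y w - norm (u,v) \<le> dist (y + (u, v)) w"
      using norm_triangle_ineq[of "y - w" "(u, v)"] norm_diff_ineq[of "y - w" "(u,v)"]
      by (auto simp: dist_norm algebra_simps)
    have f1: "f (y + (u, v)) = ln (norm (y - w + (u, v)))"
    proof -
      have "dist (y + (u, v)) w = norm (y - w + (u, v))" by (simp add: dist_norm algebra_simps)
      moreover have "d/2 \<le> dist (y + (u, v)) w" "dist (y + (u, v)) w \<le> D"
        using le dS[OF y] D0[OF y] True by (auto simp: D_def dist_commute)
      ultimately show ?thesis using feq by metis
    qed
    have f2: "f y = ln (norm (y - w))"
      using dS[OF y] D0[OF y] d by (subst feq) (auto simp: D_def dist_norm norm_minus_commute)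
    have "\<bar>f (y + (u, v)) - f y - (p1 y * u + p2 y * v + q1 y * (u\<^sup>2 - v\<^sup>2) + q2 y * (u * v))\<bar>
      \<le> 8 / d ^ 3 * norm (u, v) ^ 3"
      using ln_norm_taylor[of d "y - w" "(u, v)"] d dS[OF y] True y
      unfolding f1 f2 p1_def p2_def q1_def q2_def r_def I_def by (simp add: dist_norm)
    also have "\<dots> \<le> K * norm (u, v) ^ 3"
      unfolding K_def using B0 L0 e by (intro mult_right_mono) auto
    finally show ?thesis .
  next
    case False
    define s where "s = norm (u, v)"
    have s: "e < s" using False by (simp add: e_def s_def)
    have s0: "s > 0" using s e by linarith
    have us: "\<bar>u\<bar> \<le> s" "\<bar>v\<bar> \<le> s"
      using norm_fst_le[of u v] norm_snd_le[of v u] by (auto simp: s_def)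
    have ss: "s\<^sup>2 = u\<^sup>2 + v\<^sup>2" by (simp add: s_def norm_prod_def)
    have "\<bar>p1 y * u\<bar> \<le> L * s" "\<bar>p2 y * v\<bar> \<le> L * s"
      using bnd[of y] us L0 by (auto simp: abs_mult intro!: mult_mono)
    moreover have "\<bar>q1 y * (u\<^sup>2 - v\<^sup>2)\<bar> \<le> L * s\<^sup>2"
    proof -
      have "\<bar>u\<^sup>2 - v\<^sup>2\<bar> \<le> s\<^sup>2" unfolding ss by (simp add: abs_le_iff)
      then show ?thesis unfolding abs_mult using bnd[of y] L0 by (intro mult_mono) auto
    qed
    moreover have "\<bar>q2 y * (u * v)\<bar> \<le> L * s\<^sup>2"
    proof -
      have "\<bar>u * v\<bar> \<le> s\<^sup>2" unfolding abs_mult power2_eq_square using us by (intro mult_mono) auto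
      then show ?thesis unfolding abs_mult[of "q2 y"] using bnd[of y] L0 by (intro mult_mono) auto
    qed
    moreover have "\<bar>f (y + (u, v)) - f y\<bar> \<le> 2 * B"
      using B[of "y + (u, v)"] B[of y] by linarith
    ultimately have "\<bar>f (y + (u, v)) - f y - (p1 y * u + p2 y * v + q1 y * (u\<^sup>2 - v\<^sup>2) + q2 y * (u * v))\<bar>
       \<le> 2 * B + 2 * (L * s) + 2 * (L * s\<^sup>2)" by linarith
    \<comment> \<open>As \<open>s / e > 1\<close>, each term may be raised to the third power of
      \<open>s\<close> by factors \<open>s / e\<close>.\<close>
    also have "\<dots> \<le> 2 * B * (s / e) ^ 3 + 2 * (L * s) * (s / e)\<^sup>2 + 2 * (L * s\<^sup>2) * (s / e)"
    proof -
      have 1: "1 \<le> s / e" using s e by simp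
      then have "1 \<le> (s / e) ^ 3" "1 \<le> (s / e)\<^sup>2" by (auto intro!: one_le_power)
      moreover have le: "a \<le> a * c" if "0 \<le> a" "1 \<le> c" for a c :: real
        using mult_left_mono[OF that(2,1)] by simp
      ultimately show ?thesis using B0 L0 s0 1
        by (intro add_mono le) auto
    qed
    also have "\<dots> = (2 * B / e ^ 3 + 2 * L / e\<^sup>2 + 2 * L / e) * s ^ 3"
      using e by (simp add: field_simps power2_eq_square power3_eq_cube)
    also have "\<dots> \<le> K * s ^ 3"
      unfolding K_def using d s0 by (intro mult_right_mono) auto
    finally show ?thesis by (simp add: s_def)
  qed
  have "continuous_on UNIV f"
    unfolding f_def using d by (intro continuous_intros) (auto simp: max_def)
  moreover have "bounded (range f)" using B by (auto simp: bounded_iff)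
  ultimately have "iso_taylor S f"
    unfolding iso_taylor_def using m bnd main by blast
  moreover have "f z = ln (dist z w)" if "z \<in> S" for z
    using dS[OF that] D0[OF that] d by (subst feq) (auto simp: D_def dist_commute)
  ultimately show ?thesis using that by blast
qed

text \<open>\<open>ba\<close>, \<open>bb\<close>, \<open>bc\<close> are the barycentric coordinates
  for the vertices \<open>(-1, 0)\<close>, \<open>(1, 0)\<close>, \<open>(0, sqrt 3)\<close>. At the
  position of a state of the game they are the shares of the capital held by players 1, 2, 3, so the
  faces of the triangle correspond to eliminated players.\<close>

definition bc :: "real \<times> real \<Rightarrow> real" where "bc z = snd z / sqrt 3"
definition bb :: "real \<times> real \<Rightarrow> real" where "bb z = (1 + fst z - snd z / sqrt 3) / 2"
definition ba :: "real \<times> real \<Rightarrow> real" where "ba z = (1 - fst z - snd z / sqrt 3) / 2"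

lemmas bary_defs = ba_def bb_def bc_def

lemma bary_sum: "ba z + bb z + bc z = 1" by (simp add: bary_defs field_simps)

lemma continuous_on_bary [continuous_intros]:
  "continuous_on S f \<Longrightarrow> continuous_on S (\<lambda>x. ba (f x))"
  "continuous_on S f \<Longrightarrow> continuous_on S (\<lambda>x. bb (f x))"
  "continuous_on S f \<Longrightarrow> continuous_on S (\<lambda>x. bc (f x))"
  unfolding bary_defs by (intro continuous_intros; simp)+

lemma triangle_eq: "triangle = {z. 0 \<le> ba z \<and> 0 \<le> bb z \<and> 0 \<le> bc z}"
proof (intro set_eqI iffI)
  fix z :: "real \<times> real" assume "z \<in> triangle"
  then obtain a b c where abc: "0 \<le> a" "0 \<le> b" "0 \<le> c" "a + b + c = 1"
    and z: "z = a *\<^sub>R (-1, 0) + b *\<^sub>R (1, 0) + c *\<^sub>R (0, sqrt 3)"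
    unfolding triangle_def convex_hull_3 by auto
  show "z \<in> {z. 0 \<le> ba z \<and> 0 \<le> bb z \<and> 0 \<le> bc z}"
    using abc by (auto simp: z bary_defs)
next
  fix z :: "real \<times> real" assume "z \<in> {z. 0 \<le> ba z \<and> 0 \<le> bb z \<and> 0 \<le> bc z}"
  moreover have "z = ba z *\<^sub>R (-1, 0) + bb z *\<^sub>R (1, 0) + bc z *\<^sub>R (0, sqrt 3)"
    by (simp add: prod_eq_iff bary_defs field_simps)
  ultimately show "z \<in> triangle"
    unfolding triangle_def convex_hull_3 using bary_sum[of z] by blast
qed

lemma closed_triangle: "closed triangle"
  unfolding triangle_eq by (intro closed_Collect_conj closed_Collect_le continuous_intros)

lemma compact_triangle: "compact triangle"
  unfolding triangle_def by (intro finite_imp_compact_convex_hull) auto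

lemma interior_triangle: "interior triangle = {z. 0 < ba z \<and> 0 < bb z \<and> 0 < bc z}"
proof -
  have half: "interior {z. 0 \<le> f z} = {z. 0 < f z}"
    if f: "f = (\<lambda>z. v \<bullet> z - b)" "v \<noteq> 0" for f :: "real \<times> real \<Rightarrow> real" and v b
    using interior_halfspace_ge[OF f(2), of b] f(1) by simp
  have 1: "interior {z. 0 \<le> ba z} = {z. 0 < ba z}"
    by (rule half[where v = "(-1/2, -1/(2 * sqrt 3))" and b = "-1/2"])
       (auto simp: fun_eq_iff ba_def inner_prod_def zero_prod_def field_simps)
  have 2: "interior {z. 0 \<le> bb z} = {z. 0 < bb z}"
    by (rule half[where v = "(1/2, -1/(2 * sqrt 3))" and b = "-1/2"])
       (auto simp: fun_eq_iff bb_def inner_prod_def zero_prod_def field_simps)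
  have 3: "interior {z. 0 \<le> bc z} = {z. 0 < bc z}"
    by (rule half[where v = "(0, 1/sqrt 3)" and b = "0"])
       (auto simp: fun_eq_iff bc_def inner_prod_def zero_prod_def)
  have "triangle = {z. 0 \<le> ba z} \<inter> ({z. 0 \<le> bb z} \<inter> {z. 0 \<le> bc z})"
    by (auto simp: triangle_eq)
  have "interior triangle = interior ({z. 0 \<le> ba z} \<inter> ({z. 0 \<le> bb z} \<inter> {z. 0 \<le> bc z}))"
    by (rule arg_cong[OF \<open>triangle = _\<close>])
  then have "interior triangle = {z. 0 < ba z} \<inter> ({z. 0 < bb z} \<inter> {z. 0 < bc z})"
    by (simp only: interior_Int 1 2 3)
  then show ?thesis by auto
qed

lemma frontier_triangle: 
  "frontier triangle = {z. 0 \<le> ba z \<and> 0 \<le> bb z \<and> 0 \<le> bc z \<and> (ba z = 0 \<or> bb z = 0 \<or> bc z = 0)}"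
proof -
  have "frontier triangle = triangle - {z. 0 < ba z \<and> 0 < bb z \<and> 0 < bc z}"
    using closed_triangle by (simp add: frontier_def interior_triangle[symmetric] closure_closed)
  also have "\<dots> = {z. 0 \<le> ba z \<and> 0 \<le> bb z \<and> 0 \<le> bc z \<and> (ba z = 0 \<or> bb z = 0 \<or> bc z = 0)}"
    unfolding triangle_eq by (intro set_eqI) (simp, linarith)
  finally show ?thesis .
qed

lemma frontier_triangle_subset: "frontier triangle \<subseteq> triangle"
  unfolding frontier_triangle unfolding triangle_eq by auto

lemma compact_frontier_triangle: "compact (frontier triangle)"
  using compact_triangle by (rule compact_frontier)

lemma V3_eq: "V3 = {z. 0 \<le> ba z \<and> 0 \<le> bb z \<and> bc z = 0}"
proof (intro set_eqI iffI)
  fix z assume "z \<in> V3"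
  then obtain u where "0 \<le> u" "u \<le> 1" "z = (1 - u) *\<^sub>R (-1, 0) + u *\<^sub>R (1, 0)"
    unfolding V3_def closed_segment_def by auto
  then show "z \<in> {z. 0 \<le> ba z \<and> 0 \<le> bb z \<and> bc z = 0}" by (auto simp: bary_defs)
next
  fix z assume z: "z \<in> {z. 0 \<le> ba z \<and> 0 \<le> bb z \<and> bc z = 0}"
  then have "snd z = 0" "bb z \<le> 1" using bary_sum[of z] by (auto simp: bc_def)
  moreover from \<open>snd z = 0\<close> have "fst z = 2 * bb z - 1" by (simp add: bb_def field_simps)
  ultimately have "z = (1 - bb z) *\<^sub>R (-1, 0) + bb z *\<^sub>R (1, 0)" "bb z \<le> 1"
    by (auto simp: prod_eq_iff)
  then show "z \<in> V3" using z unfolding V3_def closed_segment_def by blast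
qed

text \<open>\<open>\<nu>\<close> is minus the gradient of a barycentric coordinate that vanishes at
  \<open>w\<close>; its squared norm is 1/3, the rate \<open>c\<close> at which that coordinate
  decreases. At a vertex either of the two vanishing coordinates will do. The sign of the inner
  product makes the distance from \<open>w + t *\<^sub>R \<nu>\<close> to every point of the
  triangle increase with \<open>t\<close>.\<close>

lemma frontier_triangle_outward:
  assumes "w \<in> frontier triangle"
  obtains \<nu> where "norm \<nu> \<le> 1" "\<And>z. z \<in> triangle \<Longrightarrow> (z - w) \<bullet> \<nu> \<le> 0"
    "\<And>t. t > 0 \<Longrightarrow> w + t *\<^sub>R \<nu> \<notin> triangle"
proof -
  note result = that
  have out: thesis
    if c: "c > 0" and nrm: "norm \<nu> \<le> 1" and g: "\<And>z. (z - w) \<bullet> \<nu> = g w - g z"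
      and gt: "\<And>t. g (w + t *\<^sub>R \<nu>) = g w - t * c" and w0: "g w = 0"
      and tri: "\<And>z. z \<in> triangle \<Longrightarrow> 0 \<le> g z"
    for \<nu> and c :: real and g :: "real \<times> real \<Rightarrow> real"
  proof (rule result[OF nrm])
    show "(z - w) \<bullet> \<nu> \<le> 0" if "z \<in> triangle" for z using g tri[OF that] w0 by simp
    show "w + t *\<^sub>R \<nu> \<notin> triangle" if "t > 0" for t
      using tri[of "w + t *\<^sub>R \<nu>"] that c by (auto simp: gt w0 mult_le_0_iff)
  qed
  consider "ba w = 0" | "bb w = 0" | "bc w = 0" using assms by (auto simp: frontier_triangle)
  then show ?thesis
  proof cases
    case 1
    show ?thesis
    proof (rule out[of "1/3" "(1/2, 1/(2 * sqrt 3))" ba])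
      show "norm (1/2 :: real, 1/(2 * sqrt 3)) \<le> 1"
        unfolding norm_prod_def by (simp add: power_divide power_mult_distrib)
      show "(z - w) \<bullet> (1/2, 1/(2 * sqrt 3)) = ba w - ba z" for z
        by (simp add: inner_prod_def ba_def diff_divide_distrib)
      show "ba (w + t *\<^sub>R (1/2, 1/(2 * sqrt 3))) = ba w - t * (1/3)" for t
        by (simp add: ba_def field_simps)
    qed (use 1 in \<open>auto simp: triangle_eq\<close>)
  next
    case 2
    show ?thesis
    proof (rule out[of "1/3" "(-1/2, 1/(2 * sqrt 3))" bb])
      show "norm (-1/2 :: real, 1/(2 * sqrt 3)) \<le> 1"
        unfolding norm_prod_def by (simp add: power_divide power_mult_distrib)
      show "(z - w) \<bullet> (-1/2, 1/(2 * sqrt 3)) = bb w - bb z" for z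
        by (simp add: inner_prod_def bb_def diff_divide_distrib add_divide_distrib)
      show "bb (w + t *\<^sub>R (-1/2, 1/(2 * sqrt 3))) = bb w - t * (1/3)" for t
        by (simp add: bb_def field_simps)
    qed (use 2 in \<open>auto simp: triangle_eq\<close>)
  next
    case 3
    show ?thesis
    proof (rule out[of "1/3" "(0, -1/sqrt 3)" bc])
      show "norm (0 :: real, -1/sqrt 3) \<le> 1"
        unfolding norm_prod_def by (simp add: power_divide)
      show "(z - w) \<bullet> (0, -1/sqrt 3) = bc w - bc z" for z
        by (simp add: inner_prod_def bc_def diff_divide_distrib)
      show "bc (w + t *\<^sub>R (0, -1/sqrt 3)) = bc w - t * (1/3)" for t
        by (simp add: bc_def field_simps)
    qed (use 3 in \<open>auto simp: triangle_eq\<close>)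
  qed
qed

section \<open>Uniqueness of the exit law from logarithmic potentials\<close>

text \<open>The quotient is the integral of \<open>exp (- t * s)\<close> over \<open>s\<close>
  between \<open>a\<close> and \<open>b\<close>; exchanging the order of integration leaves the
  integral of \<open>1 / s\<close>.\<close>

lemma frullani_exp:
  assumes "0 < a" "a \<le> b"
  shows "(\<integral>\<^sup>+t. ennreal ((exp (- t * a) - exp (- t * b)) / t) * indicator {0<..} t \<partial>lborel) = ennreal (ln (b / a))"
proof -
  have b: "b > 0" using assms by simp
  have in1: "(\<integral>\<^sup>+s. ennreal (exp (- t * s)) * indicator {a..b} s \<partial>lborel) = ennreal ((exp (- t * a) - exp (- t * b)) / t)"
    if "t > 0" for t
  proof -
    have "(\<integral>\<^sup>+s. ennreal (exp (- t * s)) * indicator {a..b} s \<partial>lborel) = ennreal (- exp (- t * b) / t - (- exp (- t * a) / t))"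
      by (rule nn_integral_FTC_Icc) (use that assms in \<open>auto intro!: derivative_eq_intros\<close>)
    then show ?thesis by (simp add: diff_divide_distrib)
  qed
  have in2: "(\<integral>\<^sup>+t. ennreal (exp (- t * s)) * indicator {0<..} t \<partial>lborel) = ennreal (1 / s)" if "s > 0" for s
  proof -
    have "(\<integral>\<^sup>+t. ennreal (exp (- t * s)) * indicator {0<..} t \<partial>lborel) = (\<integral>\<^sup>+t. ennreal (exp (- t * s)) * indicator {0..} t \<partial>lborel)"
      by (rule nn_integral_cong_AE) (use AE_lborel_singleton[of 0] in \<open>eventually_elim, auto split: split_indicator\<close>)
    also have "\<dots> = ennreal (0 - (- exp (- 0 * s) / s))"
    proof (rule nn_integral_FTC_atLeast)
      have "filterlim (\<lambda>t. - (t * s)) at_bot at_top"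
        unfolding filterlim_uminus_at_bot using that
        by (simp add: filterlim_at_top_mult_tendsto_pos[OF tendsto_const] filterlim_tendsto_pos_mult_at_top[OF tendsto_const] mult.commute[of _ s] filterlim_ident)
      then have "((\<lambda>t. exp (- (t * s))) \<longlongrightarrow> 0) at_top" by (rule filterlim_compose[OF exp_at_bot])
      then have "((\<lambda>t. - exp (- (t * s)) / s) \<longlongrightarrow> - 0 / s) at_top" by (intro tendsto_intros) (use that in auto)
      then show "((\<lambda>t. - exp (- t * s) / s) \<longlongrightarrow> 0) at_top" by simp
    qed (use that in \<open>auto intro!: derivative_eq_intros\<close>)
    finally show ?thesis by simp
  qed
  have "(\<integral>\<^sup>+t. ennreal ((exp (- t * a) - exp (- t * b)) / t) * indicator {0<..} t \<partial>lborel)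
      = (\<integral>\<^sup>+t. (\<integral>\<^sup>+s. ennreal (exp (- t * s)) * indicator {a..b} s * indicator {0<..} t \<partial>lborel) \<partial>lborel)"
  proof (intro nn_integral_cong)
    fix t :: real
    show "ennreal ((exp (- t * a) - exp (- t * b)) / t) * indicator {0<..} t
      = (\<integral>\<^sup>+s. ennreal (exp (- t * s)) * indicator {a..b} s * indicator {0<..} t \<partial>lborel)"
      using in1[of t] by (cases "t > 0") auto
  qed
  also have "\<dots> = (\<integral>\<^sup>+s. (\<integral>\<^sup>+t. ennreal (exp (- t * s)) * indicator {a..b} s * indicator {0<..} t \<partial>lborel) \<partial>lborel)"
    by (rule lborel_pair.Fubini') measurable
  also have "\<dots> = (\<integral>\<^sup>+s. ennreal (1 / s) * indicator {a..b} s \<partial>lborel)"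
  proof (intro nn_integral_cong)
    fix s :: real
    have "(\<integral>\<^sup>+t. ennreal (exp (- t * s)) * indicator {a..b} s * indicator {0<..} t \<partial>lborel)
      = (\<integral>\<^sup>+t. ennreal (exp (- t * s)) * indicator {0<..} t * indicator {a..b} s \<partial>lborel)"
      by (intro nn_integral_cong) (simp add: ac_simps)
    also have "\<dots> = (\<integral>\<^sup>+t. ennreal (exp (- t * s)) * indicator {0<..} t \<partial>lborel) * indicator {a..b} s"
      by (rule nn_integral_multc) measurable
    also have "\<dots> = ennreal (1 / s) * indicator {a..b} s"
      using in2[of s] assms by (auto split: split_indicator)
    finally show "(\<integral>\<^sup>+t. ennreal (exp (- t * s)) * indicator {a..b} s * indicator {0<..} t \<partial>lborel) = \<dots>" .
  qed
  also have "\<dots> = ennreal (ln b - ln a)"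
    by (rule nn_integral_FTC_Icc) (use assms in \<open>auto intro!: derivative_eq_intros\<close>)
  finally show ?thesis using assms b by (simp add: ln_div)
qed

text \<open>
  Frullani's integral for \<open>2 * ln (R / r)\<close>. At \<open>r = 0\<close> it is \<open>\<infinity>\<close>, whereas the real logarithm has the junk value
  \<open>ln (R / 0) = 0\<close>.
\<close>
definition logk :: "real \<Rightarrow> real \<Rightarrow> ennreal" where
  "logk R r = (\<integral>\<^sup>+t. ennreal ((exp (- t * r\<^sup>2) - exp (- t * R\<^sup>2)) / t) * indicator {0<..} t \<partial>lborel)"

lemma logk_eq: "0 < r \<Longrightarrow> r \<le> R \<Longrightarrow> logk R r = ennreal (2 * ln (R / r))"
  unfolding logk_def by (subst frullani_exp) (auto simp: power_divide[symmetric] ln_realpow)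

lemma logk_antimono: "0 \<le> r \<Longrightarrow> r \<le> r' \<Longrightarrow> logk R r' \<le> logk R r"
  unfolding logk_def
  by (intro nn_integral_mono) (auto split: split_indicator intro!: ennreal_leI divide_right_mono)

lemma logk_0: assumes "R > 0" shows "logk R 0 = \<infinity>"
proof (rule ccontr)
  assume "logk R 0 \<noteq> \<infinity>"
  then obtain c where c: "logk R 0 = ennreal c" "0 \<le> c" by (cases "logk R 0") auto
  \<comment> \<open>The radius is chosen so that its kernel value \<open>2 * (c + 1)\<close> exceeds
    the supposed bound \<open>c\<close>.\<close>
  have "ennreal (2 * ln (R / (R * exp (- c - 1)))) \<le> ennreal c"
    using logk_antimono[of 0 "R * exp (- c - 1)" R] logk_eq[of "R * exp (- c - 1)" R] c assms by simp
  moreover have "ln (R / (R * exp (- c - 1))) = c + 1" using assms by (simp add: ln_div)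
  ultimately have "ennreal (2 * (c + 1)) \<le> ennreal c" by simp
  then have "2 * (c + 1) \<le> c" using c(2) by (rule iffD1[OF ennreal_le_iff, rotated])
  then show False using c by simp
qed

lemma logk_LIMSEQ:
  assumes "decseq r" "r \<longlonglongrightarrow> l" "0 \<le> l"
  shows "(\<lambda>n. logk R (r n)) \<longlonglongrightarrow> logk R l"
  unfolding logk_def
proof (rule nn_integral_LIMSEQ)
  have "r n \<ge> 0" for n using decseq_ge[OF assms(1,2), of n] assms(3) by simp
  then show "incseq (\<lambda>n t. ennreal ((exp (- t * (r n)\<^sup>2) - exp (- t * R\<^sup>2)) / t) * indicator {0<..} t)"
    using assms(1) by (intro incseq_SucI le_funI)
       (auto split: split_indicator intro!: ennreal_leI divide_right_mono power_mono decseq_SucD)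
  show "(\<lambda>n. ennreal ((exp (- t * (r n)\<^sup>2) - exp (- t * R\<^sup>2)) / t) * indicator {0<..} t)
     \<longlonglongrightarrow> ennreal ((exp (- t * l\<^sup>2) - exp (- t * R\<^sup>2)) / t) * indicator {0<..} t" for t
    by (cases "t > 0") (auto intro!: tendsto_intros assms(2))
qed auto

text \<open>The slack 1 leaves room for poles that are pushed out of the triangle by at most a unit
  vector: their distances stay below \<open>R\<close>, where \<open>logk_eq\<close> applies.\<close>

lemma triangle_diameter: obtains R where "R > 0" "\<And>z w. z \<in> triangle \<Longrightarrow> w \<in> triangle \<Longrightarrow> dist z w + 1 \<le> R"
proof -
  obtain D where D: "\<And>z. z \<in> triangle \<Longrightarrow> dist 0 z \<le> D"
    using bounded_any_center[of triangle "0"] compact_imp_bounded[OF compact_triangle] by auto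
  show ?thesis
  proof (rule that[of "max 1 (2 * D + 1)"])
    fix z w assume "z \<in> triangle" "w \<in> triangle"
    then show "dist z w + 1 \<le> max 1 (2 * D + 1)"
      using D[of z] D[of w] dist_triangle[of z w 0] by (simp add: dist_commute)
  qed simp
qed

text \<open>The poles \<open>W m\<close> approach \<open>w\<close> from outside along the outward
  normal. There the potential is known by hypothesis, and the kernels increase with \<open>m\<close>
  on the triangle, so monotone convergence passes to \<open>w\<close> with no prior integrability.
  The limit is finite because \<open>x\<close> is interior.\<close>

lemma potential_on_frontier:
  fixes \<mu> :: "(real \<times> real) measure"
  assumes "prob_space \<mu>" and sets: "sets \<mu> = sets borel"
    and K: "AE z in \<mu>. z \<in> frontier triangle"
    and x: "x \<in> interior triangle"
    and pot: "\<And>w. w \<notin> triangle \<Longrightarrow> (LINT z|\<mu>. ln (dist z w)) = ln (dist x w)"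
    and R: "R > 0" "\<And>z w. z \<in> triangle \<Longrightarrow> w \<in> triangle \<Longrightarrow> dist z w + 1 \<le> R"
    and w: "w \<in> frontier triangle"
  shows "(\<integral>\<^sup>+z. logk R (dist z w) \<partial>\<mu>) = ennreal (2 * ln (R / dist x w))"
proof -
  interpret prob_space \<mu> by fact
  have [measurable_cong]: "sets \<mu> = sets borel" by fact
  obtain \<nu> where \<nu>: "norm \<nu> \<le> 1" "\<And>z. z \<in> triangle \<Longrightarrow> (z - w) \<bullet> \<nu> \<le> 0"
    "\<And>t. t > 0 \<Longrightarrow> w + t *\<^sub>R \<nu> \<notin> triangle"
    using frontier_triangle_outward[OF w] by blast
  define W where "W m = w + inverse (real (Suc m)) *\<^sub>R \<nu>" for m
  have Wout: "W m \<notin> triangle" for m unfolding W_def by (rule \<nu>) simp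
  have wT: "w \<in> triangle" using w frontier_triangle_subset by auto
  have dle: "dist z (W m) \<le> R" if "z \<in> triangle" for z m
  proof -
    have "dist w (W m) \<le> 1"
      using \<nu>(1) by (simp add: W_def dist_norm mult_le_one inverse_le_1_iff)
    then show ?thesis using R(2)[OF that wT] dist_triangle[of z "W m" w] by simp
  qed
  have dpos: "dist z (W m) > 0" if "z \<in> triangle" for z m using that Wout[of m] by auto
  have lim: "(\<lambda>m. dist z (W m)) \<longlonglongrightarrow> dist z w" for z
  proof -
    have "(\<lambda>m. w + inverse (real (Suc m)) *\<^sub>R \<nu>) \<longlonglongrightarrow> w + 0 *\<^sub>R \<nu>"
      by (intro tendsto_intros LIMSEQ_inverse_real_of_nat)
    then show ?thesis unfolding W_def by (intro tendsto_intros) simp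
  qed
  have dec: "decseq (\<lambda>m. dist z (W m))" if "z \<in> triangle" for z
  \<comment> \<open>The squared distance to \<open>w + s *\<^sub>R \<nu>\<close> is a quadratic in
    \<open>s\<close> whose linear coefficient \<open>- 2 * ((z - w) \<bullet> \<nu>)\<close> is
    nonnegative.\<close>
  proof (intro decseq_SucI)
    fix m
    have mono: "norm (z - w - s *\<^sub>R \<nu>) \<le> norm (z - w - t *\<^sub>R \<nu>)" if "0 \<le> s" "s \<le> t" for s t
    proof -
      have "(norm (z - w - s *\<^sub>R \<nu>))\<^sup>2 = (norm (z - w))\<^sup>2 - 2 * s * ((z - w) \<bullet> \<nu>) + s\<^sup>2 * (norm \<nu>)\<^sup>2" for s
        unfolding power2_norm_eq_inner
        by (simp add: inner_diff_left inner_diff_right inner_commute power2_eq_square right_diff_distrib)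
      moreover have "s * - ((z - w) \<bullet> \<nu>) \<le> t * - ((z - w) \<bullet> \<nu>)"
        using that \<nu>(2)[OF \<open>z \<in> triangle\<close>] by (intro mult_right_mono) auto
      moreover have "s\<^sup>2 * (norm \<nu>)\<^sup>2 \<le> t\<^sup>2 * (norm \<nu>)\<^sup>2"
        using that by (intro mult_right_mono power_mono) auto
      ultimately have "(norm (z - w - s *\<^sub>R \<nu>))\<^sup>2 \<le> (norm (z - w - t *\<^sub>R \<nu>))\<^sup>2" by simp
      then show ?thesis by (rule power2_le_imp_le) simp
    qed
    show "dist z (W (Suc m)) \<le> dist z (W m)"
      using mono[of "inverse (real (Suc (Suc m)))" "inverse (real (Suc m))"]
      by (simp add: W_def dist_norm algebra_simps inverse_eq_divide frac_le)
  qed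
  have xT: "x \<in> triangle" using x interior_subset by auto
  have meas: "(\<lambda>z. logk R (dist z v)) \<in> borel_measurable \<mu>" for v
    unfolding logk_def by measurable
  \<comment> \<open>The indicator turns monotonicity, which holds on the triangle only, into
    monotonicity at every \<open>z\<close>.\<close>
  have "(\<lambda>m. \<integral>\<^sup>+z. logk R (dist z (W m)) * indicator (frontier triangle) z \<partial>\<mu>)
      \<longlonglongrightarrow> (\<integral>\<^sup>+z. logk R (dist z w) * indicator (frontier triangle) z \<partial>\<mu>)"
  proof (rule nn_integral_LIMSEQ)
    show "incseq (\<lambda>m z. logk R (dist z (W m)) * indicator (frontier triangle) z)"
      using dec frontier_triangle_subset
      by (intro incseq_SucI le_funI) (auto split: split_indicator intro!: logk_antimono decseq_SucD)
    show "(\<lambda>z. logk R (dist z (W m)) * indicator (frontier triangle) z) \<in> borel_measurable \<mu>" for m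
      by (intro borel_measurable_times_ennreal meas borel_measurable_indicator)
         (simp add: sets borel_closed frontier_closed)
    show "(\<lambda>m. logk R (dist z (W m)) * indicator (frontier triangle) z) \<longlonglongrightarrow>
        logk R (dist z w) * indicator (frontier triangle) z" for z
      using logk_LIMSEQ[OF dec lim, of z] frontier_triangle_subset by (auto split: split_indicator)
  qed
  moreover have "(\<integral>\<^sup>+z. logk R (dist z v) * indicator (frontier triangle) z \<partial>\<mu>) = (\<integral>\<^sup>+z. logk R (dist z v) \<partial>\<mu>)" for v
    by (rule nn_integral_cong_AE) (use K in \<open>eventually_elim, auto\<close>)
  moreover have "(\<integral>\<^sup>+z. logk R (dist z (W m)) \<partial>\<mu>) = ennreal (2 * ln (R / dist x (W m)))" for m
  proof -
    obtain f where f: "iso_taylor triangle f" "\<And>z. z \<in> triangle \<Longrightarrow> f z = ln (dist z (W m))"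
      using iso_taylor_ln_dist[OF compact_triangle _ Wout] xT by blast
    obtain B where B: "\<And>z. \<bar>f z\<bar> \<le> B" using f(1) by (auto simp: iso_taylor_def bounded_iff)
    have [measurable]: "f \<in> borel_measurable borel"
      using f(1) by (auto simp: iso_taylor_def intro: borel_measurable_continuous_onI)
    have int: "integrable \<mu> f" by (rule integrable_const_bound[of _ B]) (auto simp: B)
    have KT: "AE z in \<mu>. z \<in> triangle" using K by eventually_elim (use frontier_triangle_subset in auto)
    have lnd: "ln (R / dist z (W m)) = ln R - ln (dist z (W m))" if "z \<in> triangle" for z
      using dpos[OF that, of m] R(1) by (simp add: ln_div)
    have "(\<integral>\<^sup>+z. logk R (dist z (W m)) \<partial>\<mu>) = (\<integral>\<^sup>+z. ennreal (2 * ln R - 2 * f z) \<partial>\<mu>)"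
    proof (rule nn_integral_cong_AE, use KT in eventually_elim)
      case (elim z)
      show ?case using dpos[OF elim] dle[OF elim, of m] lnd[OF elim] f(2)[OF elim]
        by (subst logk_eq) auto
    qed
    also have "\<dots> = ennreal (LINT z|\<mu>. 2 * ln R - 2 * f z)"
    proof (rule nn_integral_eq_integral)
      show "AE z in \<mu>. 0 \<le> 2 * ln R - 2 * f z"
        using KT
      proof eventually_elim
        case (elim z)
        have "ln (dist z (W m)) \<le> ln R"
          using dpos[OF elim, of m] dle[OF elim, of m] by (intro ln_mono)
        then show ?case using f(2)[OF elim] by simp
      qed
    qed (use int in auto)
    also have "(LINT z|\<mu>. 2 * ln R - 2 * f z) = 2 * ln R - 2 * (LINT z|\<mu>. f z)"
      using int by (simp add: prob_space)
    also have "(LINT z|\<mu>. f z) = (LINT z|\<mu>. ln (dist z (W m)))"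
      by (rule integral_cong_AE) (use KT f(2) in \<open>auto\<close>)
    also have "\<dots> = ln (dist x (W m))" by (rule pot[OF Wout])
    finally show ?thesis using lnd[OF xT] by (simp add: right_diff_distrib)
  qed
  ultimately have "(\<lambda>m. ennreal (2 * ln (R / dist x (W m)))) \<longlonglongrightarrow> (\<integral>\<^sup>+z. logk R (dist z w) \<partial>\<mu>)"
    by simp
  moreover have "x \<noteq> w" using x w by (auto simp: frontier_def)
  then have "(\<lambda>m. ennreal (2 * ln (R / dist x (W m)))) \<longlonglongrightarrow> ennreal (2 * ln (R / dist x w))"
    using R(1) lim by (intro tendsto_ennrealI tendsto_mult tendsto_const tendsto_ln tendsto_divide lim) auto
  ultimately show ?thesis by (rule LIMSEQ_unique)
qed

text \<open>The kernel is infinite at distance 0, so an atom at \<open>w\<close> would make the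
  potential there infinite.\<close>

lemma potential_no_atom:
  fixes \<mu> :: "(real \<times> real) measure"
  assumes "prob_space \<mu>" and sets: "sets \<mu> = sets borel"
    and K: "AE z in \<mu>. z \<in> frontier triangle"
    and x: "x \<in> interior triangle"
    and pot: "\<And>w. w \<notin> triangle \<Longrightarrow> (LINT z|\<mu>. ln (dist z w)) = ln (dist x w)"
    and w: "w \<in> frontier triangle"
  shows "emeasure \<mu> {w} = 0"
proof (rule ccontr)
  assume ne: "emeasure \<mu> {w} \<noteq> 0"
  obtain R where R: "R > 0" "\<And>z w. z \<in> triangle \<Longrightarrow> w \<in> triangle \<Longrightarrow> dist z w + 1 \<le> R"
    using triangle_diameter by blast
  have "(\<integral>\<^sup>+z. \<infinity> * indicator {w} z \<partial>\<mu>) \<le> (\<integral>\<^sup>+z. logk R (dist z w) \<partial>\<mu>)"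
    by (intro nn_integral_mono) (auto simp: logk_0 R split: split_indicator)
  also have "\<dots> < \<infinity>"
    using potential_on_frontier[OF assms(1-5) R w] by simp
  also have "(\<integral>\<^sup>+z. \<infinity> * indicator {w} z \<partial>\<mu>) = \<infinity>"
    using ne by (subst nn_integral_cmult_indicator) (auto simp: sets ennreal_top_mult)
  finally show False by simp
qed

lemma (in prob_space) abs_expectation_le:
  fixes f :: "'a \<Rightarrow> real"
  assumes "f \<in> borel_measurable M" "AE x in M. \<bar>f x\<bar> \<le> B"
  shows "\<bar>expectation f\<bar> \<le> B"
proof -
  have int: "integrable M f" by (rule integrable_const_bound[of _ B]) (use assms in auto)
  have "\<bar>expectation f\<bar> \<le> expectation (\<lambda>x. \<bar>f x\<bar>)"
    using integral_norm_bound[of M f] by simp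
  also have "\<dots> \<le> expectation (\<lambda>x. B)"
    using int assms by (intro integral_mono_AE) auto
  finally show ?thesis by (simp add: prob_space)
qed

section \<open>Positive definiteness of the Gaussian kernel\<close>

lemma char_std_normal_cos_sin:
  "(LINT u|std_normal_distribution. cos (s * u)) = exp (- s\<^sup>2 / 2)"
  "(LINT u|std_normal_distribution. sin (s * u)) = 0"
proof -
  interpret N: real_distribution std_normal_distribution by (rule real_dist_normal_dist)
  have int: "complex_integrable std_normal_distribution (\<lambda>u. cis (s * u))"
    by (rule N.integrable_const_bound[of _ 1]) (auto simp: cis_conv_exp intro!: borel_measurable_continuous_onI continuous_intros)
  have "char std_normal_distribution s = exp (- (s\<^sup>2) / 2)"
    by (simp add: char_std_normal_distribution)
  then have *: "(CLINT u|std_normal_distribution. cis (s * u)) = complex_of_real (exp (- (s\<^sup>2) / 2))"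
    by (simp add: char_def cis_conv_exp)
  show "(LINT u|std_normal_distribution. cos (s * u)) = exp (- s\<^sup>2 / 2)"
    using arg_cong[OF *, of Re] int by (simp add: integral_Re[symmetric] del: integral_Re)
  show "(LINT u|std_normal_distribution. sin (s * u)) = 0"
    using arg_cong[OF *, of Im] int by (simp add: integral_Im[symmetric] del: integral_Im)
qed

abbreviation "gauss2 \<equiv> std_normal_distribution \<Otimes>\<^sub>M std_normal_distribution"

lemma prob_space_gauss2: "prob_space gauss2"
proof -
  interpret N: real_distribution std_normal_distribution by (rule real_dist_normal_dist)
  interpret P: pair_prob_space std_normal_distribution std_normal_distribution ..
  show ?thesis by (rule P.prob_space_axioms)
qed

lemma sets_gauss2 [measurable_cong]: "sets gauss2 = sets borel"
proof -
  have "sets gauss2 = sets (borel \<Otimes>\<^sub>M borel :: (real \<times> real) measure)" by (intro sets_pair_measure_cong) auto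
  also have "\<dots> = sets borel" by (simp only: borel_prod)
  finally show ?thesis .
qed

text \<open>The Gaussian kernel is the characteristic function of a standard normal vector at
  frequency \<open>sqrt (2 * t)\<close>; the sine products of the addition theorem integrate to
  0.\<close>

lemma gauss2_cos:
  fixes v :: "real \<times> real"
  assumes "t \<ge> 0"
  shows "(LINT \<zeta>|gauss2. cos (sqrt (2 * t) * (v \<bullet> \<zeta>))) = exp (- t * (norm v)\<^sup>2)"
proof -
  interpret N: real_distribution std_normal_distribution by (rule real_dist_normal_dist)
  interpret P: pair_prob_space std_normal_distribution std_normal_distribution ..
  define s where "s = sqrt (2 * t)"
  obtain a b where v: "v = (a, b)" by (cases v)
  have int: "integrable gauss2 (\<lambda>\<zeta>. cos (s * (v \<bullet> \<zeta>)))"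
    by (rule P.P.integrable_const_bound[of _ 1])
       (auto intro!: borel_measurable_continuous_onI continuous_intros simp: measurable_cong_sets[OF sets_gauss2 refl])
  have ic: "integrable std_normal_distribution (\<lambda>u. cos (r * u))" 
    "integrable std_normal_distribution (\<lambda>u. sin (r * u))" for r
    by (rule N.integrable_const_bound[of _ 1]; auto)+
  have "(LINT \<zeta>|gauss2. cos (s * (v \<bullet> \<zeta>))) = (LINT x|std_normal_distribution. LINT y|std_normal_distribution. cos (s * (v \<bullet> (x, y))))"
    using P.integral_fst'[OF int] by simp
  also have "\<dots> = (LINT x|std_normal_distribution. LINT y|std_normal_distribution.
      cos (s * a * x) * cos (s * b * y) - sin (s * a * x) * sin (s * b * y))"
    by (simp add: v inner_prod_def cos_add algebra_simps)
  also have "\<dots> = (LINT x|std_normal_distribution. cos (s * a * x) * exp (- (s * b)\<^sup>2 / 2))"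
    by (intro Bochner_Integration.integral_cong refl)
       (subst Bochner_Integration.integral_diff; use ic in \<open>simp add: char_std_normal_cos_sin\<close>)
  also have "\<dots> = exp (- (s * a)\<^sup>2 / 2) * exp (- (s * b)\<^sup>2 / 2)"
    by (simp add: char_std_normal_cos_sin)
  also have "\<dots> = exp (- t * (norm v)\<^sup>2)"
    using assms by (simp add: exp_add[symmetric] v norm_prod_def s_def power_mult_distrib algebra_simps)
  finally show ?thesis by (simp add: s_def)
qed

definition gauss_energy :: "real \<Rightarrow> (real \<times> real) measure \<Rightarrow> (real \<times> real) measure \<Rightarrow> real" where
  "gauss_energy t \<alpha> \<beta> = (LINT w|\<beta>. LINT z|\<alpha>. exp (- t * (dist z w)\<^sup>2))"

text \<open>Expanding the cosine of a difference separates \<open>z\<close> from \<open>w\<close>,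
  so the mutual energy becomes the inner product of the two characteristic functions in the space of
  square integrable functions of \<open>G\<close>.\<close>

lemma gauss_energy_char:
  assumes "prob_space \<alpha>" "prob_space \<beta>" "prob_space G"
    and sets: "sets \<alpha> = sets borel" "sets \<beta> = sets borel" "sets G = sets borel"
    and G: "\<And>v. (LINT \<zeta>|G. cos (s * (v \<bullet> \<zeta>))) = exp (- t * (norm v)\<^sup>2)"
  shows "gauss_energy t \<alpha> \<beta> = (LINT \<zeta>|G.
     (LINT z|\<alpha>. cos (s * (z \<bullet> \<zeta>))) * (LINT w|\<beta>. cos (s * (w \<bullet> \<zeta>))) +
     (LINT z|\<alpha>. sin (s * (z \<bullet> \<zeta>))) * (LINT w|\<beta>. sin (s * (w \<bullet> \<zeta>))))"
proof -
  interpret a: prob_space \<alpha> by fact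
  interpret b: prob_space \<beta> by fact
  interpret g: prob_space G by fact
  interpret ga: pair_prob_space G \<alpha> ..
  interpret gb: pair_prob_space G \<beta> ..
  note [measurable_cong] = sets
  define C S where "C \<zeta> = (LINT z|\<alpha>. cos (s * (z \<bullet> \<zeta>)))" and "S \<zeta> = (LINT z|\<alpha>. sin (s * (z \<bullet> \<zeta>)))" for \<zeta>
  have [measurable]: "C \<in> borel_measurable G" "S \<in> borel_measurable G"
    unfolding C_def S_def by measurable
  have CS: "\<bar>C \<zeta>\<bar> \<le> 1" "\<bar>S \<zeta>\<bar> \<le> 1" for \<zeta>
  proof -
    show "\<bar>C \<zeta>\<bar> \<le> 1" unfolding C_def by (rule a.abs_expectation_le) auto
    show "\<bar>S \<zeta>\<bar> \<le> 1" unfolding S_def by (rule a.abs_expectation_le) auto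
  qed
  have ia: "integrable \<alpha> (\<lambda>z. cos (s * (z \<bullet> \<zeta>)))" "integrable \<alpha> (\<lambda>z. sin (s * (z \<bullet> \<zeta>)))" for \<zeta>
    by (rule a.integrable_const_bound[of _ 1]; simp)+
  have ib: "integrable \<beta> (\<lambda>z. cos (s * (z \<bullet> \<zeta>)))" "integrable \<beta> (\<lambda>z. sin (s * (z \<bullet> \<zeta>)))" for \<zeta>
    by (rule b.integrable_const_bound[of _ 1]; simp)+
  have 1: "(LINT z|\<alpha>. exp (- t * (dist z w)\<^sup>2)) = (LINT \<zeta>|G. C \<zeta> * cos (s * (w \<bullet> \<zeta>)) + S \<zeta> * sin (s * (w \<bullet> \<zeta>)))" for w
  proof -
    have "(LINT z|\<alpha>. exp (- t * (dist z w)\<^sup>2)) = (LINT z|\<alpha>. LINT \<zeta>|G. cos (s * ((z - w) \<bullet> \<zeta>)))"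
      using G by (simp add: dist_norm)
    also have "\<dots> = (LINT \<zeta>|G. LINT z|\<alpha>. cos (s * ((z - w) \<bullet> \<zeta>)))"
      by (rule ga.Fubini_integral, rule ga.P.integrable_const_bound[of _ 1]) auto
    also have "\<dots> = (LINT \<zeta>|G. C \<zeta> * cos (s * (w \<bullet> \<zeta>)) + S \<zeta> * sin (s * (w \<bullet> \<zeta>)))"
    proof (intro Bochner_Integration.integral_cong refl)
      fix \<zeta>
      have "(LINT z|\<alpha>. cos (s * ((z - w) \<bullet> \<zeta>))) = (LINT z|\<alpha>. cos (s * (z \<bullet> \<zeta>)) * cos (s * (w \<bullet> \<zeta>)) + sin (s * (z \<bullet> \<zeta>)) * sin (s * (w \<bullet> \<zeta>)))"
        by (simp add: inner_diff_left right_diff_distrib cos_diff)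
      also have "\<dots> = C \<zeta> * cos (s * (w \<bullet> \<zeta>)) + S \<zeta> * sin (s * (w \<bullet> \<zeta>))"
        unfolding C_def S_def using ia by (subst Bochner_Integration.integral_add) auto
      finally show "(LINT z|\<alpha>. cos (s * ((z - w) \<bullet> \<zeta>))) = \<dots>" .
    qed
    finally show ?thesis .
  qed
  have "gauss_energy t \<alpha> \<beta> = (LINT w|\<beta>. LINT \<zeta>|G. C \<zeta> * cos (s * (w \<bullet> \<zeta>)) + S \<zeta> * sin (s * (w \<bullet> \<zeta>)))"
    unfolding gauss_energy_def 1 ..
  also have "\<dots> = (LINT \<zeta>|G. LINT w|\<beta>. C \<zeta> * cos (s * (w \<bullet> \<zeta>)) + S \<zeta> * sin (s * (w \<bullet> \<zeta>)))"
  proof (rule gb.Fubini_integral, rule gb.P.integrable_const_bound[of _ 2])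
    have "\<bar>C \<zeta> * cos u + S \<zeta> * sin u\<bar> \<le> 2" for \<zeta> u
    proof -
      have "\<bar>C \<zeta> * cos u\<bar> \<le> 1 * 1" "\<bar>S \<zeta> * sin u\<bar> \<le> 1 * 1"
        unfolding abs_mult using CS by (intro mult_mono; simp)+
      then show ?thesis by linarith
    qed
    then show "AE x in G \<Otimes>\<^sub>M \<beta>. norm (case x of (\<zeta>, w) \<Rightarrow> C \<zeta> * cos (s * (w \<bullet> \<zeta>)) + S \<zeta> * sin (s * (w \<bullet> \<zeta>))) \<le> 2"
      by (auto simp: split_beta)
  qed measurable
  also have "\<dots> = (LINT \<zeta>|G. C \<zeta> * (LINT w|\<beta>. cos (s * (w \<bullet> \<zeta>))) + S \<zeta> * (LINT w|\<beta>. sin (s * (w \<bullet> \<zeta>))))"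
    using ib by simp
  finally show ?thesis unfolding C_def S_def .
qed

text \<open>\<open>D\<close> is the integral of the squared modulus of the difference of the
  characteristic functions against a Gaussian law. That law has a positive density and the
  difference is continuous, so one single \<open>t\<close> with \<open>D = 0\<close> forces equality
  at every frequency.\<close>

lemma gauss_energy_zero_imp_char_eq:
  fixes \<alpha> \<beta> :: "(real \<times> real) measure"
  assumes "prob_space \<alpha>" "prob_space \<beta>"
    and sets: "sets \<alpha> = sets borel" "sets \<beta> = sets borel" and t: "t > 0"
  defines "D \<equiv> gauss_energy t \<alpha> \<alpha> + gauss_energy t \<beta> \<beta> - 2 * gauss_energy t \<alpha> \<beta>"
  shows "D \<ge> 0"
    and "D = 0 \<Longrightarrow> (LINT z|\<alpha>. cos (z \<bullet> \<zeta>)) = (LINT z|\<beta>. cos (z \<bullet> \<zeta>))"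
    and "D = 0 \<Longrightarrow> (LINT z|\<alpha>. sin (z \<bullet> \<zeta>)) = (LINT z|\<beta>. sin (z \<bullet> \<zeta>))"
proof -
  interpret a: prob_space \<alpha> by fact
  interpret b: prob_space \<beta> by fact
  interpret g: prob_space gauss2 by (rule prob_space_gauss2)
  define s where "s = sqrt (2 * t)"
  have s: "s > 0" using t by (simp add: s_def)
  have G: "(LINT \<zeta>|gauss2. cos (s * (v \<bullet> \<zeta>))) = exp (- t * (norm v)\<^sup>2)" for v
    unfolding s_def using t by (intro gauss2_cos) simp
  define C where "C M \<zeta> = (LINT z|M. cos (s * (z \<bullet> \<zeta>)))" for M :: "(real \<times> real) measure" and \<zeta>
  define S where "S M \<zeta> = (LINT z|M. sin (s * (z \<bullet> \<zeta>)))" for M :: "(real \<times> real) measure" and \<zeta>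
  have cont: "continuous_on UNIV (C M)" "continuous_on UNIV (S M)" and bnd: "\<bar>C M \<zeta>\<bar> \<le> 1" "\<bar>S M \<zeta>\<bar> \<le> 1"
    if M: "prob_space M" "sets M = sets borel" for M :: "(real \<times> real) measure" and \<zeta>
  proof -
    interpret M: prob_space M by fact
    note [measurable_cong] = M(2)
    have "isCont (C M) \<zeta>" "isCont (S M) \<zeta>" for \<zeta>
      unfolding continuous_at_sequentially C_def S_def comp_def
      by (intro allI impI integral_dominated_convergence[where w = "\<lambda>_. 1"];
          auto intro!: tendsto_intros)+
    then show "continuous_on UNIV (C M)" "continuous_on UNIV (S M)"
      by (auto simp: continuous_on_eq_continuous_at)
    show "\<bar>C M \<zeta>\<bar> \<le> 1" unfolding C_def by (rule M.abs_expectation_le) auto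
    show "\<bar>S M \<zeta>\<bar> \<le> 1" unfolding S_def by (rule M.abs_expectation_le) auto
  qed
  have en: "gauss_energy t M N = (LINT \<zeta>|gauss2. C M \<zeta> * C N \<zeta> + S M \<zeta> * S N \<zeta>)"
    if "prob_space M" "prob_space N" "sets M = sets borel" "sets N = sets borel" for M N
    unfolding C_def S_def
    by (rule gauss_energy_char[OF that(1,2) prob_space_gauss2 that(3,4) sets_gauss2 G])
  have int: "integrable gauss2 (\<lambda>\<zeta>. C M \<zeta> * C N \<zeta> + S M \<zeta> * S N \<zeta>)"
    if MN: "prob_space M" "prob_space N" "sets M = sets borel" "sets N = sets borel" for M N
  proof (rule g.integrable_const_bound[of _ 2])
    have "\<bar>C M \<zeta> * C N \<zeta> + S M \<zeta> * S N \<zeta>\<bar> \<le> 2" for \<zeta>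
    proof -
      have "\<bar>C M \<zeta> * C N \<zeta>\<bar> \<le> 1 * 1" "\<bar>S M \<zeta> * S N \<zeta>\<bar> \<le> 1 * 1"
        unfolding abs_mult using bnd MN by (intro mult_mono; simp)+
      then show ?thesis by linarith
    qed
    then show "AE \<zeta> in gauss2. norm (C M \<zeta> * C N \<zeta> + S M \<zeta> * S N \<zeta>) \<le> 2" by simp
    have "continuous_on UNIV (\<lambda>\<zeta>. C M \<zeta> * C N \<zeta> + S M \<zeta> * S N \<zeta>)"
      using cont MN by (intro continuous_intros)
    then show "(\<lambda>\<zeta>. C M \<zeta> * C N \<zeta> + S M \<zeta> * S N \<zeta>) \<in> borel_measurable gauss2"
      unfolding measurable_cong_sets[OF sets_gauss2 refl] by (rule borel_measurable_continuous_onI)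
  qed
  define H where "H \<zeta> = (C \<alpha> \<zeta> - C \<beta> \<zeta>)\<^sup>2 + (S \<alpha> \<zeta> - S \<beta> \<zeta>)\<^sup>2" for \<zeta>
  have H_eq: "H = (\<lambda>\<zeta>. (C \<alpha> \<zeta> * C \<alpha> \<zeta> + S \<alpha> \<zeta> * S \<alpha> \<zeta>) + (C \<beta> \<zeta> * C \<beta> \<zeta> + S \<beta> \<zeta> * S \<beta> \<zeta>)
      - 2 * (C \<alpha> \<zeta> * C \<beta> \<zeta> + S \<alpha> \<zeta> * S \<beta> \<zeta>))"
    by (simp add: H_def fun_eq_iff power2_eq_square algebra_simps)
  have Hint: "integrable gauss2 H" unfolding H_eq
    by (intro Bochner_Integration.integrable_diff Bochner_Integration.integrable_add integrable_mult_right int assms)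
  have HD: "D = (LINT \<zeta>|gauss2. H \<zeta>)"
    unfolding D_def H_eq en[OF assms(1,1,3,3)] en[OF assms(2,2,4,4)] en[OF assms(1,2,3,4)]
    by (simp add: int assms del: distrib_left_numeral)
  have H0: "H \<zeta> \<ge> 0" for \<zeta> by (simp add: H_def)
  show "D \<ge> 0" unfolding HD by (rule integral_nonneg_AE) (simp add: H0)
  have Hcont: "continuous_on UNIV H"
    unfolding H_def using cont assms by (intro continuous_intros)
  have zero: "H \<zeta> = 0" if D: "D = 0" for \<zeta>
  proof (rule ccontr)
    assume "H \<zeta> \<noteq> 0"
    have AE: "AE \<zeta> in gauss2. H \<zeta> = 0"
      using integral_nonneg_eq_0_iff_AE[OF Hint] D HD H0 by simp
    \<comment> \<open>A positive density transfers the null set to Lebesgue measure, for which a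
      nonempty open set is not null.\<close>
    have dens: "gauss2 = density (lborel \<Otimes>\<^sub>M lborel) (\<lambda>(x, y). ennreal (std_normal_density x) * ennreal (std_normal_density y))"
      by (subst pair_measure_density) (auto simp: prob_space_imp_sigma_finite prob_space_normal_density sigma_finite_lborel)
    have "AE \<zeta> in lborel. H \<zeta> = 0"
      using AE unfolding dens lborel_prod
      by (subst (asm) AE_density) (auto simp: lborel_prod[symmetric] ennreal_mult''[symmetric] normal_density_pos)
    then have "{\<zeta>. H \<zeta> \<noteq> 0} \<in> null_sets lborel"
      using Hcont
      by (subst AE_iff_null_sets) (auto intro!: borel_open open_Collect_neq)
    then have "negligible {\<zeta>. H \<zeta> \<noteq> 0}"
      by (simp add: negligible_iff_null_sets null_sets_completionI)
    moreover have "open {\<zeta>. H \<zeta> \<noteq> 0}" using Hcont by (intro open_Collect_neq) auto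
    ultimately show False using open_not_negligible \<open>H \<zeta> \<noteq> 0\<close> by blast
  qed
  have eq: "C \<alpha> \<zeta> = C \<beta> \<zeta>" "S \<alpha> \<zeta> = S \<beta> \<zeta>" if "D = 0" for \<zeta>
    using zero[OF that, of \<zeta>] by (auto simp: H_def sum_power2_eq_zero_iff)
  show "D = 0 \<Longrightarrow> (LINT z|\<alpha>. cos (z \<bullet> \<zeta>)) = (LINT z|\<beta>. cos (z \<bullet> \<zeta>))"
    using eq(1)[of "\<zeta> /\<^sub>R s"] s by (simp add: C_def mult.assoc[symmetric])
  show "D = 0 \<Longrightarrow> (LINT z|\<alpha>. sin (z \<bullet> \<zeta>)) = (LINT z|\<beta>. sin (z \<bullet> \<zeta>))"
    using eq(2)[of "\<zeta> /\<^sub>R s"] s by (simp add: S_def mult.assoc[symmetric])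
qed

text \<open>Tonelli's theorem, after inserting Frullani's integral for the kernel. Since distances
  in \<open>K\<close> are at most \<open>R\<close>, the integrand is nonnegative and the truncation
  by \<open>ennreal\<close> changes nothing on \<open>K\<close>.\<close>

lemma log_energy_eq:
  fixes \<alpha> \<beta> :: "(real \<times> real) measure"
  assumes "prob_space \<alpha>" "prob_space \<beta>" and sets: "sets \<alpha> = sets borel" "sets \<beta> = sets borel"
    and K: "AE z in \<alpha>. z \<in> K" "AE z in \<beta>. z \<in> K"
    and R: "R > 0" "\<And>z w. z \<in> K \<Longrightarrow> w \<in> K \<Longrightarrow> dist z w \<le> R"
  shows "(\<integral>\<^sup>+w. \<integral>\<^sup>+z. logk R (dist z w) \<partial>\<alpha> \<partial>\<beta>)
    = (\<integral>\<^sup>+t. ennreal ((gauss_energy t \<alpha> \<beta> - exp (- t * R\<^sup>2)) / t) * indicator {0<..} t \<partial>lborel)"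
    and "\<And>t. t \<ge> 0 \<Longrightarrow> gauss_energy t \<alpha> \<beta> \<ge> exp (- t * R\<^sup>2)"
proof -
  interpret a: prob_space \<alpha> by fact
  interpret b: prob_space \<beta> by fact
  interpret pa: pair_sigma_finite \<alpha> lborel ..
  interpret pb: pair_sigma_finite \<beta> lborel ..
  note [measurable_cong] = sets
  define e where "e t z w = exp (- t * (dist z w)\<^sup>2)" for t and z w :: "real \<times> real"
  define I where "I t w = (LINT z|\<alpha>. e t z w)" for t w
  have e1: "\<bar>e t z w\<bar> \<le> 1" "0 \<le> e t z w" if "t \<ge> 0" for t z w using that by (auto simp: e_def)
  have eR: "exp (- t * R\<^sup>2) \<le> e t z w" if "t \<ge> 0" "z \<in> K" "w \<in> K" for t z w
    unfolding e_def using that(1) R(2)[OF that(2,3)] by (auto intro!: mult_left_mono power_mono)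
  have [measurable]: "(\<lambda>w. I t w) \<in> borel_measurable \<beta>" for t
    unfolding I_def e_def by measurable
  have inte: "integrable \<alpha> (\<lambda>z. e t z w)" if "t \<ge> 0" for t w
    by (rule a.integrable_const_bound[of _ 1]) (use e1[OF that] in \<open>auto simp: e_def\<close>)
  have I1: "\<bar>I t w\<bar> \<le> 1" if "t \<ge> 0" for t w
    unfolding I_def by (rule a.abs_expectation_le) (use e1[OF that] in \<open>auto simp: e_def\<close>)
  have intI: "integrable \<beta> (I t)" if "t \<ge> 0" for t
    by (rule b.integrable_const_bound[of _ 1]) (use I1[OF that] in \<open>auto\<close>)
  have IR: "exp (- t * R\<^sup>2) \<le> I t w" if "t \<ge> 0" "w \<in> K" for t w
  proof -
    have "(LINT z|\<alpha>. exp (- t * R\<^sup>2)) \<le> I t w"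
      unfolding I_def
    proof (rule integral_mono_AE)
      show "AE z in \<alpha>. exp (- t * R\<^sup>2) \<le> e t z w"
        using K(1) by eventually_elim (rule eR[OF that(1) _ that(2)])
    qed (use that inte in auto)
    then show ?thesis by (simp add: a.prob_space)
  qed
  have ge: "gauss_energy t \<alpha> \<beta> = (LINT w|\<beta>. I t w)" for t
    by (simp add: gauss_energy_def I_def e_def)
  show "gauss_energy t \<alpha> \<beta> \<ge> exp (- t * R\<^sup>2)" if "t \<ge> 0" for t
  proof -
    have "(LINT w|\<beta>. exp (- t * R\<^sup>2)) \<le> (LINT w|\<beta>. I t w)"
      using K(2) IR that intI by (intro integral_mono_AE) auto
    then show ?thesis by (simp add: b.prob_space ge)
  qed
  define f where "f t z w = ennreal ((e t z w - exp (- t * R\<^sup>2)) / t) * indicator {0<..} t" for t z w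
  have [measurable]: "(\<lambda>x. f (h x) (u x) (v x)) \<in> borel_measurable M"
    if [measurable]: "h \<in> borel_measurable M" "u \<in> borel_measurable M" "v \<in> borel_measurable M" for h u v and M :: "'c measure"
    unfolding f_def e_def by measurable
  have "(\<integral>\<^sup>+w. \<integral>\<^sup>+z. logk R (dist z w) \<partial>\<alpha> \<partial>\<beta>) = (\<integral>\<^sup>+w. \<integral>\<^sup>+z. \<integral>\<^sup>+t. f t z w \<partial>lborel \<partial>\<alpha> \<partial>\<beta>)"
    by (simp add: logk_def f_def e_def)
  also have "\<dots> = (\<integral>\<^sup>+w. \<integral>\<^sup>+t. \<integral>\<^sup>+z. f t z w \<partial>\<alpha> \<partial>lborel \<partial>\<beta>)"
    by (intro nn_integral_cong pa.Fubini'[symmetric]) (simp add: split_beta)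
  also have "\<dots> = (\<integral>\<^sup>+t. \<integral>\<^sup>+w. \<integral>\<^sup>+z. f t z w \<partial>\<alpha> \<partial>\<beta> \<partial>lborel)"
    by (intro pb.Fubini'[symmetric]) (simp add: split_beta)
  also have "\<dots> = (\<integral>\<^sup>+t. ennreal ((gauss_energy t \<alpha> \<beta> - exp (- t * R\<^sup>2)) / t) * indicator {0<..} t \<partial>lborel)"
  proof (intro nn_integral_cong)
    fix t :: real
    show "(\<integral>\<^sup>+w. \<integral>\<^sup>+z. f t z w \<partial>\<alpha> \<partial>\<beta>) = ennreal ((gauss_energy t \<alpha> \<beta> - exp (- t * R\<^sup>2)) / t) * indicator {0<..} t"
    proof (cases "t > 0")
      case True
      then have t: "t \<ge> 0" by simp
      have "(\<integral>\<^sup>+w. \<integral>\<^sup>+z. f t z w \<partial>\<alpha> \<partial>\<beta>) = (\<integral>\<^sup>+w. ennreal ((I t w - exp (- t * R\<^sup>2)) / t) \<partial>\<beta>)"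
      proof (rule nn_integral_cong_AE, use K(2) in eventually_elim)
        case (elim w)
        have "(\<integral>\<^sup>+z. f t z w \<partial>\<alpha>) = (\<integral>\<^sup>+z. ennreal ((e t z w - exp (- t * R\<^sup>2)) / t) \<partial>\<alpha>)"
          using True by (simp add: f_def)
        also have "\<dots> = ennreal (LINT z|\<alpha>. (e t z w - exp (- t * R\<^sup>2)) / t)"
        proof (rule nn_integral_eq_integral)
          show "AE z in \<alpha>. 0 \<le> (e t z w - exp (- t * R\<^sup>2)) / t"
            using K(1) by eventually_elim (use eR[OF t _ elim] True in simp)
        qed (simp add: inte t)
        also have "(LINT z|\<alpha>. (e t z w - exp (- t * R\<^sup>2)) / t) = (I t w - exp (- t * R\<^sup>2)) / t"
          using inte[OF t] by (simp add: I_def a.prob_space)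
        finally show ?case .
      qed
      also have "\<dots> = ennreal (LINT w|\<beta>. (I t w - exp (- t * R\<^sup>2)) / t)"
        using K(2) IR[OF t] True by (intro nn_integral_eq_integral) (auto simp: intI t)
      also have "(LINT w|\<beta>. (I t w - exp (- t * R\<^sup>2)) / t) = (gauss_energy t \<alpha> \<beta> - exp (- t * R\<^sup>2)) / t"
        using intI[OF t] by (simp add: ge b.prob_space)
      finally show ?thesis using True by simp
    qed (simp add: f_def)
  qed
  finally show "(\<integral>\<^sup>+w. \<integral>\<^sup>+z. logk R (dist z w) \<partial>\<alpha> \<partial>\<beta>) = \<dots>" .
qed

lemma gauss_energy_commute:
  assumes "prob_space \<alpha>" "prob_space \<beta>" and sets: "sets \<alpha> = sets borel" "sets \<beta> = sets borel" "t \<ge> 0"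
  shows "gauss_energy t \<alpha> \<beta> = gauss_energy t \<beta> \<alpha>"
proof -
  interpret a: prob_space \<alpha> by fact
  interpret b: prob_space \<beta> by fact
  interpret p: pair_prob_space \<alpha> \<beta> ..
  note [measurable_cong] = sets(1,2)
  have "gauss_energy t \<alpha> \<beta> = (LINT z|\<alpha>. LINT w|\<beta>. exp (- t * (dist z w)\<^sup>2))"
    unfolding gauss_energy_def
    by (rule p.Fubini_integral, rule p.P.integrable_const_bound[of _ 1]) (use sets(3) in auto)
  then show ?thesis by (simp add: gauss_energy_def dist_commute)
qed

lemma gauss_energy_measurable:
  assumes "prob_space \<alpha>" "prob_space \<beta>" and sets: "sets \<alpha> = sets borel" "sets \<beta> = sets borel"
  shows "(\<lambda>t. gauss_energy t \<alpha> \<beta>) \<in> borel_measurable borel"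
proof -
  interpret a: prob_space \<alpha> by fact
  interpret b: prob_space \<beta> by fact
  note [measurable_cong] = sets(1,2)
  show ?thesis unfolding gauss_energy_def by measurable
qed

section \<open>Trigonometric polynomials and equality of laws\<close>

inductive trig_poly :: "(real \<times> real \<Rightarrow> real) \<Rightarrow> bool" where
  cos: "trig_poly (\<lambda>z. c * cos (z \<bullet> \<zeta>))"
| sin: "trig_poly (\<lambda>z. c * sin (z \<bullet> \<zeta>))"
| add: "trig_poly f \<Longrightarrow> trig_poly g \<Longrightarrow> trig_poly (\<lambda>z. f z + g z)"

text \<open>Product-to-sum formulas; they make the trigonometric polynomials an algebra, as
  Stone-Weierstrass requires.\<close>

lemma trig_poly_mult:
  assumes "trig_poly f" "trig_poly g"
  shows "trig_poly (\<lambda>z. f z * g z)"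
  using assms
proof (induction f arbitrary: g)
  case (cos c \<zeta>)
  from cos show ?case
  proof (induction g)
    case (cos d \<xi>)
    have "trig_poly (\<lambda>z. (c * d / 2) * cos (z \<bullet> (\<zeta> - \<xi>)) + (c * d / 2) * cos (z \<bullet> (\<zeta> + \<xi>)))"
      by (intro trig_poly.intros)
    then show ?case 
      by (elim back_subst[of trig_poly])
         (simp add: fun_eq_iff inner_right_distrib inner_diff_right cos_add cos_diff sin_add sin_diff algebra_simps)
  next
    case (sin d \<xi>)
    have "trig_poly (\<lambda>z. (c * d / 2) * sin (z \<bullet> (\<zeta> + \<xi>)) + (- c * d / 2) * sin (z \<bullet> (\<zeta> - \<xi>)))"
      by (intro trig_poly.intros)
    then show ?case 
      by (elim back_subst[of trig_poly])
         (simp add: fun_eq_iff inner_right_distrib inner_diff_right cos_add cos_diff sin_add sin_diff algebra_simps)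
  qed (simp add: distrib_left trig_poly.add)
next
  case (sin c \<zeta>)
  from sin show ?case
  proof (induction g)
    case (cos d \<xi>)
    have "trig_poly (\<lambda>z. (c * d / 2) * sin (z \<bullet> (\<zeta> + \<xi>)) + (c * d / 2) * sin (z \<bullet> (\<zeta> - \<xi>)))"
      by (intro trig_poly.intros)
    then show ?case 
      by (elim back_subst[of trig_poly])
         (simp add: fun_eq_iff inner_right_distrib inner_diff_right cos_add cos_diff sin_add sin_diff algebra_simps)
  next
    case (sin d \<xi>)
    have "trig_poly (\<lambda>z. (c * d / 2) * cos (z \<bullet> (\<zeta> - \<xi>)) + (- c * d / 2) * cos (z \<bullet> (\<zeta> + \<xi>)))"
      by (intro trig_poly.intros)
    then show ?case 
      by (elim back_subst[of trig_poly])
         (simp add: fun_eq_iff inner_right_distrib inner_diff_right cos_add cos_diff sin_add sin_diff algebra_simps)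
  qed (simp add: distrib_left trig_poly.add)
qed (simp add: distrib_right trig_poly.add)

lemma trig_poly_const: "trig_poly (\<lambda>_. c)"
  using trig_poly.cos[of c 0] by simp

lemma continuous_on_trig_poly: "trig_poly f \<Longrightarrow> continuous_on S f"
  by (induction rule: trig_poly.induct) (auto intro!: continuous_intros)

lemma char_eq_imp_integral_eq:
  fixes \<alpha> \<beta> :: "(real \<times> real) measure"
  assumes "prob_space \<alpha>" "prob_space \<beta>" and sets: "sets \<alpha> = sets borel" "sets \<beta> = sets borel"
    and K: "compact K" "AE z in \<alpha>. z \<in> K" "AE z in \<beta>. z \<in> K"
    and eq: "\<And>\<zeta>. (LINT z|\<alpha>. cos (z \<bullet> \<zeta>)) = (LINT z|\<beta>. cos (z \<bullet> \<zeta>))"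
      "\<And>\<zeta>. (LINT z|\<alpha>. sin (z \<bullet> \<zeta>)) = (LINT z|\<beta>. sin (z \<bullet> \<zeta>))"
    and \<phi>: "continuous_on UNIV \<phi>"
  shows "(LINT z|\<alpha>. \<phi> z :: real) = (LINT z|\<beta>. \<phi> z)"
proof -
  interpret a: prob_space \<alpha> by fact
  interpret b: prob_space \<beta> by fact
  note [measurable_cong] = sets
  have int: "integrable \<alpha> f" "integrable \<beta> f" if "continuous_on UNIV f" for f :: "real \<times> real \<Rightarrow> real"
  proof -
    have "bounded (f ` K)"
      using K(1) that by (intro compact_imp_bounded compact_continuous_image) (auto intro: continuous_on_subset)
    then obtain B where B: "\<And>z. z \<in> K \<Longrightarrow> \<bar>f z\<bar> \<le> B" by (auto simp: bounded_iff)
    have [measurable]: "f \<in> borel_measurable borel" using that by (rule borel_measurable_continuous_onI)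
    show "integrable \<alpha> f" by (rule a.integrable_const_bound[of _ B]) (use K(2) B in auto)
    show "integrable \<beta> f" by (rule b.integrable_const_bound[of _ B]) (use K(3) B in auto)
  qed
  have tp: "(LINT z|\<alpha>. f z) = (LINT z|\<beta>. f z)" if "trig_poly f" for f
    using that
  proof induction
    case (add f g)
    then show ?case using int[OF continuous_on_trig_poly] by simp
  qed (simp_all add: eq)
  have "\<bar>(LINT z|\<alpha>. \<phi> z) - (LINT z|\<beta>. \<phi> z)\<bar> \<le> \<epsilon>" if \<epsilon>: "\<epsilon> > 0" for \<epsilon>
  proof -
    have "\<exists>f. trig_poly f \<and> (\<forall>z\<in>K. \<bar>\<phi> z - f z\<bar> < \<epsilon> / 2)"
    proof (rule Stone_Weierstrass_HOL)
      show "\<exists>f. trig_poly f \<and> f x \<noteq> f y" if "x \<in> K \<and> y \<in> K \<and> x \<noteq> y" for x y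
      proof (rule ccontr)
        assume no: "\<not> ?thesis"
        \<comment> \<open>Normalised so that the phases at \<open>x\<close> and \<open>y\<close>
          differ by 1, which is not a multiple of the period.\<close>
        define \<zeta> where "\<zeta> = (x - y) /\<^sub>R ((x - y) \<bullet> (x - y))"
        have "(x - y) \<bullet> \<zeta> = 1" using that by (simp add: \<zeta>_def)
        then have "x \<bullet> \<zeta> - y \<bullet> \<zeta> = 1" by (simp add: inner_diff_left)
        moreover have "cos (x \<bullet> \<zeta>) = cos (y \<bullet> \<zeta>)" "sin (x \<bullet> \<zeta>) = sin (y \<bullet> \<zeta>)"
          using no trig_poly.cos[of 1 \<zeta>] trig_poly.sin[of 1 \<zeta>] by auto
        then have "cos (x \<bullet> \<zeta> - y \<bullet> \<zeta>) = 1"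
          using sin_cos_squared_add[of "y \<bullet> \<zeta>"] by (simp add: cos_diff power2_eq_square)
        moreover have "cos 1 < cos (0::real)" by (rule cos_monotone_0_pi) (use pi_gt3 in auto)
        ultimately show False by simp
      qed
    qed (use K(1) \<phi> \<epsilon> in \<open>auto intro: trig_poly_const continuous_on_trig_poly trig_poly.add trig_poly_mult continuous_on_subset\<close>)
    then obtain f where f: "trig_poly f" "\<And>z. z \<in> K \<Longrightarrow> \<bar>\<phi> z - f z\<bar> < \<epsilon> / 2" by blast
    note cf = continuous_on_trig_poly[OF f(1)]
    have [measurable]: "f \<in> borel_measurable borel" "\<phi> \<in> borel_measurable borel"
      using cf \<phi> by (auto intro: borel_measurable_continuous_onI)
    have "\<bar>LINT z|\<alpha>. \<phi> z - f z\<bar> \<le> \<epsilon> / 2"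
      by (rule a.abs_expectation_le, measurable, use K(2) in eventually_elim, use f(2) in \<open>auto intro: less_imp_le\<close>)
    moreover have "\<bar>LINT z|\<beta>. \<phi> z - f z\<bar> \<le> \<epsilon> / 2"
      by (rule b.abs_expectation_le, measurable, use K(3) in eventually_elim, use f(2) in \<open>auto intro: less_imp_le\<close>)
    ultimately have "\<bar>(LINT z|\<alpha>. \<phi> z) - (LINT z|\<beta>. f z)\<bar> \<le> \<epsilon> / 2" "\<bar>(LINT z|\<beta>. \<phi> z) - (LINT z|\<beta>. f z)\<bar> \<le> \<epsilon> / 2"
      using tp[OF f(1)] int[OF cf] int[OF \<phi>] by simp_all
    then show ?thesis by linarith
  qed
  then show ?thesis using dense_le_bounded[of 0] by (metis abs_le_zero_iff dense_ge eq_iff_diff_eq_0)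
qed

text \<open>Every mutual logarithmic energy of two measures from \<open>\<mu>1\<close>,
  \<open>\<mu>2\<close> is the integral of the same function \<open>U\<close> against the second
  one. With the symmetry of the energy all four coincide, so the energy of the difference is
  0.\<close>

theorem potential_unique:
  fixes \<mu>1 \<mu>2 :: "(real \<times> real) measure"
  assumes p: "prob_space \<mu>1" "prob_space \<mu>2" and sets: "sets \<mu>1 = sets borel" "sets \<mu>2 = sets borel"
    and K: "AE z in \<mu>1. z \<in> frontier triangle" "AE z in \<mu>2. z \<in> frontier triangle"
    and x: "x \<in> interior triangle"
    and pot: "\<And>w. w \<notin> triangle \<Longrightarrow> (LINT z|\<mu>1. ln (dist z w)) = ln (dist x w)"
      "\<And>w. w \<notin> triangle \<Longrightarrow> (LINT z|\<mu>2. ln (dist z w)) = ln (dist x w)"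
    and \<phi>: "continuous_on UNIV \<phi>"
  shows "(LINT z|\<mu>1. \<phi> z :: real) = (LINT z|\<mu>2. \<phi> z)"
proof -
  interpret m1: prob_space \<mu>1 by fact
  interpret m2: prob_space \<mu>2 by fact
  obtain R where R: "R > 0" "\<And>z w. z \<in> triangle \<Longrightarrow> w \<in> triangle \<Longrightarrow> dist z w + 1 \<le> R"
    using triangle_diameter by blast
  have RK: "dist z w \<le> R" if "z \<in> frontier triangle" "w \<in> frontier triangle" for z w
    using R(2)[of z w] that frontier_triangle_subset by force
  define U where "U w = 2 * ln (R / dist x w)" for w
  obtain \<delta> where \<delta>: "\<delta> > 0" "ball x \<delta> \<subseteq> interior triangle"
    using x open_interior open_contains_ball by metis
  have U: "U w \<le> 2 * ln (R / \<delta>)" if "w \<in> frontier triangle" for w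
  proof -
    have "w \<notin> interior triangle" using that by (simp add: frontier_def)
    then have "\<delta> \<le> dist x w" using \<delta>(2) by (meson linorder_not_le mem_ball subsetD)
    then show ?thesis unfolding U_def using \<delta>(1) R(1) by (auto intro!: ln_mono frac_le divide_pos_pos)
  qed
  have E: "(\<integral>\<^sup>+w. \<integral>\<^sup>+z. logk R (dist z w) \<partial>\<alpha> \<partial>\<beta>) = (\<integral>\<^sup>+w. ennreal (U w) \<partial>\<beta>)"
    if "\<alpha> \<in> {\<mu>1, \<mu>2}" "AE w in \<beta>. w \<in> frontier triangle" for \<alpha> \<beta>
  proof (rule nn_integral_cong_AE, use that(2) in eventually_elim)
    case (elim w)
    show ?case unfolding U_def
      by (rule potential_on_frontier[OF _ _ _ x _ R elim]) (use that(1) p sets K pot in auto)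
  qed
  \<comment> \<open>Finiteness is what allows the energies to be subtracted; \<open>U\<close> is
    bounded because the frontier keeps a distance \<open>\<delta>\<close> from
    \<open>x\<close>.\<close>
  have fin: "(\<integral>\<^sup>+w. ennreal (U w) \<partial>\<beta>) < \<infinity>" if "prob_space \<beta>" "AE w in \<beta>. w \<in> frontier triangle" for \<beta>
  proof -
    interpret b: prob_space \<beta> by fact
    have "(\<integral>\<^sup>+w. ennreal (U w) \<partial>\<beta>) \<le> (\<integral>\<^sup>+w. ennreal (2 * ln (R / \<delta>)) \<partial>\<beta>)"
      by (rule nn_integral_mono_AE, use that(2) in eventually_elim) (use U in \<open>auto intro: ennreal_leI\<close>)
    then show ?thesis by (simp add: b.emeasure_space_1 le_less_trans)
  qed
  define g where "g \<alpha> \<beta> t = (gauss_energy t \<alpha> \<beta> - exp (- t * R\<^sup>2)) / t * indicator {0<..} t" for \<alpha> \<beta> t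
  have g: "integrable lborel (g \<alpha> \<beta>)" "ennreal (LINT t|lborel. g \<alpha> \<beta> t) = (\<integral>\<^sup>+w. ennreal (U w) \<partial>\<beta>)"
    "(LINT t|lborel. g \<alpha> \<beta> t) \<ge> 0"
    if "\<alpha> \<in> {\<mu>1, \<mu>2}" "\<beta> \<in> {\<mu>1, \<mu>2}" for \<alpha> \<beta>
  proof -
    have a: "prob_space \<alpha>" "prob_space \<beta>" "sets \<alpha> = sets borel" "sets \<beta> = sets borel"
      "AE z in \<alpha>. z \<in> frontier triangle" "AE z in \<beta>. z \<in> frontier triangle"
      using that p sets K by auto
    have [measurable]: "g \<alpha> \<beta> \<in> borel_measurable lborel"
      using gauss_energy_measurable[OF a(1-4)] unfolding g_def by measurable
    have nn: "g \<alpha> \<beta> t \<ge> 0" for t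
      using log_energy_eq(2)[OF a(1-6) R(1) RK, of t] by (auto simp: g_def split: split_indicator)
    have *: "(\<integral>\<^sup>+t. ennreal (g \<alpha> \<beta> t) \<partial>lborel) = (\<integral>\<^sup>+w. ennreal (U w) \<partial>\<beta>)"
    proof -
      have "ennreal (g \<alpha> \<beta> t) = ennreal ((gauss_energy t \<alpha> \<beta> - exp (- t * R\<^sup>2)) / t) * indicator {0<..} t" for t
        by (simp add: g_def split: split_indicator)
      then show ?thesis using log_energy_eq(1)[OF a(1-6) R(1) RK] E[OF that(1) a(6)] by simp
    qed
    then show i: "integrable lborel (g \<alpha> \<beta>)"
      using fin[OF a(2,6)] nn by (intro integrableI_nonneg) auto
    show "ennreal (LINT t|lborel. g \<alpha> \<beta> t) = (\<integral>\<^sup>+w. ennreal (U w) \<partial>\<beta>)"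
      using nn_integral_eq_integral[OF i] nn * by simp
    show "(LINT t|lborel. g \<alpha> \<beta> t) \<ge> 0" using nn by simp
  qed
  have eq: "(LINT t|lborel. g \<mu>1 \<beta> t) = (LINT t|lborel. g \<mu>2 \<beta> t)" if "\<beta> \<in> {\<mu>1, \<mu>2}" for \<beta>
    using g[of \<mu>1 \<beta>] g[of \<mu>2 \<beta>] that by (metis ennreal_inj insertCI)
  have com: "g \<mu>1 \<mu>2 = g \<mu>2 \<mu>1"
    using gauss_energy_commute[OF p sets] by (auto simp: g_def fun_eq_iff split: split_indicator)
  \<comment> \<open>In \<open>d\<close> the constants \<open>exp (- t * R\<^sup>2)\<close> cancel,
    so \<open>d\<close> is the nonnegative Gaussian energy \<open>D\<close> divided by
    \<open>t\<close>.\<close>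
  define D where "D t = gauss_energy t \<mu>1 \<mu>1 + gauss_energy t \<mu>2 \<mu>2 - 2 * gauss_energy t \<mu>1 \<mu>2" for t
  define d where "d t = g \<mu>1 \<mu>1 t + g \<mu>2 \<mu>2 t - 2 * g \<mu>1 \<mu>2 t" for t
  have dD: "d t = D t / t" if "t > 0" for t
    using that by (simp add: d_def D_def g_def diff_divide_distrib add_divide_distrib)
  have d0: "d t \<ge> 0" for t
  proof (cases "t > 0")
    case True
    then show ?thesis
      using gauss_energy_zero_imp_char_eq(1)[OF p sets True] dD[OF True] by (simp add: D_def)
  qed (simp add: d_def g_def)
  have int_d: "integrable lborel d"
    unfolding d_def by (intro Bochner_Integration.integrable_diff Bochner_Integration.integrable_add integrable_mult_right g) auto
  have "(LINT t|lborel. d t) = 0"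
    unfolding d_def using g(1) eq[of \<mu>1] eq[of \<mu>2] com by simp
  then have AE: "AE t in lborel. d t = 0"
    using integral_nonneg_eq_0_iff_AE[OF int_d] d0 by simp
  \<comment> \<open>A function that vanishes almost everywhere vanishes somewhere in the interval
    from 0 to 1.\<close>
  have "\<exists>t>0. d t = 0"
  proof (rule ccontr)
    assume no: "\<not> ?thesis"
    have "AE t in lborel. t \<notin> {0<..<1::real}" using AE by eventually_elim (use no in auto)
    then have "emeasure lborel {0<..<1::real} = 0"
      by (subst (asm) AE_iff_measurable[of "{0<..<1}"]) auto
    then show False by simp
  qed
  then obtain t where t: "t > 0" "d t = 0" by blast
  then have D: "D t = 0" using dD by simp
  note ch = gauss_energy_zero_imp_char_eq(2,3)[OF p sets t(1), folded D_def, OF D]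
  show ?thesis
    by (rule char_eq_imp_integral_eq[OF p sets compact_frontier_triangle K ch \<phi>])
qed

section \<open>Exit of planar Brownian motion\<close>

lemma lborel_pair_product_integral:
  fixes f g :: "real \<Rightarrow> real"
  assumes f: "integrable lborel f" and g: "integrable lborel g"
  shows "integrable lborel (\<lambda>z::real \<times> real. f (fst z) * g (snd z))"
    and "(LINT z|(lborel :: (real \<times> real) measure). f (fst z) * g (snd z)) = (LINT u|lborel. f u) * (LINT v|lborel. g v)"
proof -
  have [measurable]: "f \<in> borel_measurable borel" "g \<in> borel_measurable borel" using f g by auto
  have int: "integrable (lborel \<Otimes>\<^sub>M lborel) (\<lambda>z. f (fst z) * g (snd z))"
  proof (rule lborel_pair.Fubini_integrable)
    show "(\<lambda>z. f (fst z) * g (snd z)) \<in> borel_measurable (lborel \<Otimes>\<^sub>M lborel)" by measurable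
    show "integrable lborel (\<lambda>x. LINT y|lborel. norm (f (fst (x, y)) * g (snd (x, y))))"
      using f by (simp add: abs_mult)
    show "AE x in lborel. integrable lborel (\<lambda>y. f (fst (x, y)) * g (snd (x, y)))" using g by simp
  qed
  then show "integrable lborel (\<lambda>z::real \<times> real. f (fst z) * g (snd z))" by (simp add: lborel_prod)
  have "(LINT z|(lborel \<Otimes>\<^sub>M lborel). f (fst z) * g (snd z)) = (LINT u|lborel. LINT v|lborel. f u * g v)"
    using lborel_pair.integral_fst'[OF int] by simp
  then show "(LINT z|(lborel :: (real \<times> real) measure). f (fst z) * g (snd z)) = (LINT u|lborel. f u) * (LINT v|lborel. g v)"
    using f g by (simp add: lborel_prod)
qed

lemma tendsto_of_bool_all:
  assumes "\<And>l::nat. P (Suc l) \<Longrightarrow> P l"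
  shows "(\<lambda>l. of_bool (P l) :: real) \<longlonglongrightarrow> of_bool (\<forall>l. P l)"
proof (cases "\<forall>l. P l")
  case False
  then obtain l0 where l0: "\<not> P l0" by blast
  have "\<not> P l" if "l \<ge> l0" for l using that by (induction rule: dec_induct) (use l0 assms in auto)
  then have "eventually (\<lambda>l. of_bool (P l) = (0::real)) sequentially"
    by (auto simp: eventually_sequentially)
  then show ?thesis using False by (simp add: tendsto_eventually)
qed simp

lemma tendsto_of_bool_ex:
  assumes "\<And>l::nat. P l \<Longrightarrow> P (Suc l)"
  shows "(\<lambda>l. of_bool (P l) :: real) \<longlonglongrightarrow> of_bool (\<exists>l. P l)"
proof (cases "\<exists>l. P l")
  case True
  then obtain l0 where l0: "P l0" by blast
  have "P l" if "l \<ge> l0" for l using that by (induction rule: dec_induct) (use l0 assms in auto)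
  then have "eventually (\<lambda>l. of_bool (P l) = (1::real)) sequentially"
    by (auto simp: eventually_sequentially)
  then show ?thesis using True by (simp add: tendsto_eventually)
qed simp

section \<open>Moments and independence of Brownian increments\<close>

context standard_brownian_motion_2d
begin

definition incr :: "real \<Rightarrow> real \<Rightarrow> 'w \<Rightarrow> real \<times> real" where "incr s t \<omega> = W t \<omega> - W s \<omega>"

lemma measurable_incr [measurable]: "0 \<le> s \<Longrightarrow> 0 \<le> t \<Longrightarrow> incr s t \<in> borel_measurable M"
  unfolding incr_def [abs_def] using measurable_W by measurable

lemma incr_density:
  assumes "0 \<le> s" "s < t"
  defines "n \<equiv> normal_density 0 (sqrt (t - s))"
  shows "distributed M lborel (incr s t) (\<lambda>z. ennreal (n (fst z) * n (snd z)))"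
proof -
  have "(\<lambda>(u, v). ennreal (n u * n v)) = (\<lambda>z. ennreal (n (fst z) * n (snd z)))" by auto
  then show ?thesis
    using normal_increments[OF assms(1,2)] unfolding incr_def [abs_def] n_def by simp
qed

lemma incr_moment:
  assumes "0 \<le> s" "s < t"
  defines "m \<equiv> \<lambda>k. LINT u|lborel. normal_density 0 (sqrt (t - s)) u * u ^ k"
  shows "integrable M (\<lambda>\<omega>. fst (incr s t \<omega>) ^ i * snd (incr s t \<omega>) ^ j)"
    and "expectation (\<lambda>\<omega>. fst (incr s t \<omega>) ^ i * snd (incr s t \<omega>) ^ j) = m i * m j"
proof -
  define n where "n = normal_density 0 (sqrt (t - s))"
  have \<sigma>: "sqrt (t - s) > 0" using assms by simp
  note d = incr_density[OF assms(1,2), folded n_def]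
  have nn: "0 \<le> n u" for u by (simp add: n_def)
  have nk: "integrable lborel (\<lambda>u. n u * u ^ k)" for k
    using integrable_normal_moment[OF \<sigma>, of 0 k] by (simp add: n_def)
  have eq: "(\<lambda>z. n (fst z) * n (snd z) * (fst z ^ i * snd z ^ j)) = (\<lambda>z. (n (fst z) * fst z ^ i) * (n (snd z) * snd z ^ j))"
    by (simp add: fun_eq_iff ac_simps)
  have [measurable]: "(\<lambda>z::real\<times>real. fst z ^ i * snd z ^ j) \<in> borel_measurable borel"
    by (intro borel_measurable_continuous_onI continuous_intros)
  show "integrable M (\<lambda>\<omega>. fst (incr s t \<omega>) ^ i * snd (incr s t \<omega>) ^ j)"
    using distributed_integrable[OF d, of "\<lambda>z. fst z ^ i * snd z ^ j"] nn
      lborel_pair_product_integral(1)[OF nk nk, of i j] by (simp add: eq)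
  show "expectation (\<lambda>\<omega>. fst (incr s t \<omega>) ^ i * snd (incr s t \<omega>) ^ j) = m i * m j"
    using distributed_integral[OF d, of "\<lambda>z. fst z ^ i * snd z ^ j"] nn
      lborel_pair_product_integral(2)[OF nk nk, of i j] by (simp add: eq m_def flip: n_def)
qed

lemma incr_moments:
  assumes "0 \<le> s" "s < t"
  shows "integrable M (\<lambda>\<omega>. fst (incr s t \<omega>))" "expectation (\<lambda>\<omega>. fst (incr s t \<omega>)) = 0"
    "integrable M (\<lambda>\<omega>. snd (incr s t \<omega>))" "expectation (\<lambda>\<omega>. snd (incr s t \<omega>)) = 0"
    "integrable M (\<lambda>\<omega>. fst (incr s t \<omega>) * snd (incr s t \<omega>))" "expectation (\<lambda>\<omega>. fst (incr s t \<omega>) * snd (incr s t \<omega>)) = 0"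
    "integrable M (\<lambda>\<omega>. (fst (incr s t \<omega>))\<^sup>2 - (snd (incr s t \<omega>))\<^sup>2)"
    "expectation (\<lambda>\<omega>. (fst (incr s t \<omega>))\<^sup>2 - (snd (incr s t \<omega>))\<^sup>2) = 0"
    "integrable M (\<lambda>\<omega>. norm (incr s t \<omega>) ^ 3)"
    "expectation (\<lambda>\<omega>. norm (incr s t \<omega>) ^ 3) \<le> 5 * sqrt (t - s) ^ 3"
proof -
  define \<sigma> where "\<sigma> = sqrt (t - s)"
  have \<sigma>: "\<sigma> > 0" using assms by (simp add: \<sigma>_def)
  define m where "m k = (LINT u|lborel. normal_density 0 \<sigma> u * u ^ k)" for k
  note int = incr_moment(1)[OF assms]
  note ex = incr_moment(2)[OF assms, folded \<sigma>_def, folded m_def]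
  have m: "m 0 = 1" "m 1 = 0" "m 2 = \<sigma>\<^sup>2" "m 4 = 3 * \<sigma> ^ 4"
    using integral_normal_moment_even[OF \<sigma>, of 0 0] integral_normal_moment_odd[OF \<sigma>, of 0 0]
      integral_normal_moment_even[OF \<sigma>, of 0 1] integral_normal_moment_even[OF \<sigma>, of 0 2] \<sigma>
    by (simp_all add: m_def field_simps eval_nat_numeral)
  show "integrable M (\<lambda>\<omega>. fst (incr s t \<omega>))" "expectation (\<lambda>\<omega>. fst (incr s t \<omega>)) = 0"
    using int[of 1 0] ex[of 1 0] m by simp_all
  show "integrable M (\<lambda>\<omega>. snd (incr s t \<omega>))" "expectation (\<lambda>\<omega>. snd (incr s t \<omega>)) = 0"
    using int[of 0 1] ex[of 0 1] m by simp_all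
  show "integrable M (\<lambda>\<omega>. fst (incr s t \<omega>) * snd (incr s t \<omega>))" "expectation (\<lambda>\<omega>. fst (incr s t \<omega>) * snd (incr s t \<omega>)) = 0"
    using int[of 1 1] ex[of 1 1] m by simp_all
  show "integrable M (\<lambda>\<omega>. (fst (incr s t \<omega>))\<^sup>2 - (snd (incr s t \<omega>))\<^sup>2)"
    "expectation (\<lambda>\<omega>. (fst (incr s t \<omega>))\<^sup>2 - (snd (incr s t \<omega>))\<^sup>2) = 0"
    using int[of 2 0] int[of 0 2] ex[of 2 0] ex[of 0 2] by simp_all
  \<comment> \<open>With \<open>r\<close> the length of the increment, \<open>g\<close> is
    \<open>(\<sigma> * r\<^sup>2 + r ^ 4 / \<sigma>) / 2\<close>, which dominates
    \<open>r ^ 3\<close> by the inequality of arithmetic and geometric means and involves even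
    moments only. Its mean is \<open>(2 + 8) / 2 = 5\<close> times
    \<open>\<sigma> ^ 3\<close>.\<close>
  define g where "g \<omega> = (\<sigma> * (fst (incr s t \<omega>) ^ 2 * snd (incr s t \<omega>) ^ 0 + fst (incr s t \<omega>) ^ 0 * snd (incr s t \<omega>) ^ 2)
    + (fst (incr s t \<omega>) ^ 4 * snd (incr s t \<omega>) ^ 0 + 2 * (fst (incr s t \<omega>) ^ 2 * snd (incr s t \<omega>) ^ 2) +
       fst (incr s t \<omega>) ^ 0 * snd (incr s t \<omega>) ^ 4) / \<sigma>) / 2" for \<omega>
  have gint: "integrable M g"
    unfolding g_def by (intro integrable_divide Bochner_Integration.integrable_add integrable_mult_right int)
  have "expectation g = (\<sigma> * (m 2 * m 0 + m 0 * m 2) + (m 4 * m 0 + 2 * (m 2 * m 2) + m 0 * m 4) / \<sigma>) / 2"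
    unfolding g_def ex[symmetric] using int
    by (simp del: power_0 add: int)
  also have "\<dots> = (\<sigma> * (\<sigma>\<^sup>2 + \<sigma>\<^sup>2) + (3 * \<sigma> ^ 4 + 2 * (\<sigma>\<^sup>2 * \<sigma>\<^sup>2) + 3 * \<sigma> ^ 4) / \<sigma>) / 2"
    by (simp add: m)
  also have "\<dots> = 5 * \<sigma> ^ 3"
    using \<sigma> by (simp add: field_simps eval_nat_numeral)
  finally have gex: "expectation g = 5 * \<sigma> ^ 3" .
  have le: "norm (incr s t \<omega>) ^ 3 \<le> g \<omega>" for \<omega>
  proof -
    define r where "r = norm (incr s t \<omega>)"
    have r2: "r\<^sup>2 = (fst (incr s t \<omega>))\<^sup>2 + (snd (incr s t \<omega>))\<^sup>2"
      by (simp add: r_def norm_prod_def)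
    have "r ^ 4 = (r\<^sup>2)\<^sup>2" by simp
    then have r4: "r ^ 4 = fst (incr s t \<omega>) ^ 4 + 2 * ((fst (incr s t \<omega>))\<^sup>2 * (snd (incr s t \<omega>))\<^sup>2) + snd (incr s t \<omega>) ^ 4"
      unfolding r2 power2_sum by (simp add: power_mult_distrib)
    have g: "g \<omega> = (\<sigma> * r\<^sup>2 + r ^ 4 / \<sigma>) / 2" unfolding g_def r2 r4 by simp
    have "0 \<le> r\<^sup>2 * (\<sigma> - r)\<^sup>2 / \<sigma>" using \<sigma> by simp
    also have "\<dots> = \<sigma> * r\<^sup>2 + r ^ 4 / \<sigma> - 2 * r ^ 3"
      using \<sigma> by (simp add: field_simps eval_nat_numeral)
    finally show ?thesis unfolding g r_def[symmetric] by simp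
  qed
  show i3: "integrable M (\<lambda>\<omega>. norm (incr s t \<omega>) ^ 3)"
    by (rule Bochner_Integration.integrable_bound[OF gint]) (use assms le in \<open>auto intro!: AE_I2 order_trans[OF _ abs_ge_self]\<close>)
  have "expectation (\<lambda>\<omega>. norm (incr s t \<omega>) ^ 3) \<le> expectation g"
    by (rule integral_mono[OF i3 gint le])
  then show "expectation (\<lambda>\<omega>. norm (incr s t \<omega>) ^ 3) \<le> 5 * sqrt (t - s) ^ 3"
    unfolding gex \<sigma>_def .
qed

text \<open>The \<open>n\<close> equal increments up to \<open>t\<close> are independent of the next
  one, so the expectation factorises and the factor of mean zero kills it.\<close>

lemma past_orthogonal:
  fixes c :: "(nat \<Rightarrow> real \<times> real) \<Rightarrow> real" and \<psi> :: "real \<times> real \<Rightarrow> real"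
  assumes "0 \<le> t" "t < u" and n: "n > (0::nat)"
    and c: "c \<in> borel_measurable (PiM {..<n} (\<lambda>_. borel))" "\<And>v. \<bar>c v\<bar> \<le> B"
    and \<psi>: "\<psi> \<in> borel_measurable borel" "integrable M (\<lambda>\<omega>. \<psi> (incr t u \<omega>))" "expectation (\<lambda>\<omega>. \<psi> (incr t u \<omega>)) = 0"
  defines "\<tau> \<equiv> \<lambda>i. t * real i / real n"
  shows "expectation (\<lambda>\<omega>. c (\<lambda>i\<in>{..<n}. incr (\<tau> i) (\<tau> (Suc i)) \<omega>) * \<psi> (incr t u \<omega>)) = 0"
proof -
  \<comment> \<open>One further node \<open>u\<close> is appended to the grid; repeating it
    afterwards keeps the sequence monotone on all indices.\<close>
  define \<rho> where "\<rho> i = (if i \<le> n then \<tau> i else u)" for i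
  have \<tau>t: "\<tau> i \<le> t" if "i \<le> n" for i
    using that assms(1) n by (simp add: \<tau>_def field_simps mult_left_mono)
  have "mono \<rho>"
    unfolding \<rho>_def mono_iff_le_Suc
  proof
    fix i show "(if i \<le> n then \<tau> i else u) \<le> (if Suc i \<le> n then \<tau> (Suc i) else u)"
      using \<tau>t[of i] assms(1,2) by (auto simp: \<tau>_def divide_right_mono mult_left_mono)
  qed
  moreover have "0 \<le> \<rho> 0" by (simp add: \<rho>_def \<tau>_def)
  ultimately have "indep_vars (\<lambda>_. borel) (\<lambda>k \<omega>. W (\<rho> (Suc k)) \<omega> - W (\<rho> k) \<omega>) {..<Suc n}"
    by (intro independent_increments)
  then have "indep_var (PiM {..<n} (\<lambda>_. borel)) (\<lambda>\<omega>. \<lambda>k\<in>{..<n}. W (\<rho> (Suc k)) \<omega> - W (\<rho> k) \<omega>)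
     (PiM {n} (\<lambda>_. borel)) (\<lambda>\<omega>. \<lambda>k\<in>{n}. W (\<rho> (Suc k)) \<omega> - W (\<rho> k) \<omega>)"
    by (rule indep_var_restrict) auto
  from indep_var_compose[OF this c(1), of "\<lambda>v. \<psi> (v n)" borel]
  have "indep_var borel (\<lambda>\<omega>. c (\<lambda>k\<in>{..<n}. W (\<rho> (Suc k)) \<omega> - W (\<rho> k) \<omega>)) borel (\<lambda>\<omega>. \<psi> (W (\<rho> (Suc n)) \<omega> - W (\<rho> n) \<omega>))"
    using \<psi>(1) by (simp add: comp_def)
  moreover have "(\<lambda>\<omega>. c (\<lambda>k\<in>{..<n}. W (\<rho> (Suc k)) \<omega> - W (\<rho> k) \<omega>)) = (\<lambda>\<omega>. c (\<lambda>i\<in>{..<n}. incr (\<tau> i) (\<tau> (Suc i)) \<omega>))"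
    by (intro ext arg_cong[of _ _ c] restrict_ext) (simp add: \<rho>_def incr_def)
  moreover have "(\<lambda>\<omega>. \<psi> (W (\<rho> (Suc n)) \<omega> - W (\<rho> n) \<omega>)) = (\<lambda>\<omega>. \<psi> (incr t u \<omega>))"
    using n by (simp add: \<rho>_def \<tau>_def incr_def)
  ultimately have ind: "indep_var borel (\<lambda>\<omega>. c (\<lambda>i\<in>{..<n}. incr (\<tau> i) (\<tau> (Suc i)) \<omega>)) borel (\<lambda>\<omega>. \<psi> (incr t u \<omega>))"
    by simp
  have "random_variable borel (\<lambda>\<omega>. c (\<lambda>i\<in>{..<n}. incr (\<tau> i) (\<tau> (Suc i)) \<omega>))"
    using ind by (rule indep_var_rv1)
  then have "integrable M (\<lambda>\<omega>. c (\<lambda>i\<in>{..<n}. incr (\<tau> i) (\<tau> (Suc i)) \<omega>))"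
    by (intro integrable_const_bound[of _ B]) (use c(2) in auto)
  from indep_var_lebesgue_integral[OF ind this \<psi>(2)] \<psi>(3) show ?thesis by simp
qed

end

lemma antimono_threshold:
  fixes n :: nat
  assumes "\<And>i j :: nat. i \<le> j \<Longrightarrow> P j \<Longrightarrow> P i"
  shows "\<exists>\<sigma>\<le>n. \<forall>j<n. P j \<longleftrightarrow> j < \<sigma>"
proof (induction n)
  case (Suc n)
  then obtain \<sigma> where \<sigma>: "\<sigma> \<le> n" "\<forall>j<n. P j \<longleftrightarrow> j < \<sigma>" by blast
  show ?case
  proof (cases "P n")
    case True
    then have "\<forall>j<Suc n. P j \<longleftrightarrow> j < Suc n" using assms[OF _ True] by (auto simp: less_Suc_eq_le)
    then show ?thesis by blast
  next
    case False
    then have "\<forall>j<Suc n. P j \<longleftrightarrow> j < \<sigma>" using \<sigma> by (auto simp: less_Suc_eq)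
    then show ?thesis using \<sigma>(1) by (intro exI[of _ \<sigma>]) auto
  qed
qed simp

text \<open>Writes a stopped sequence as a sum over a fixed number of increments with weights that
  depend on the past only. It is applied both to the path and to a function of the path.\<close>

lemma sum_stopped_telescope:
  fixes a :: "nat \<Rightarrow> 'a::real_vector"
  assumes "\<sigma> \<le> n" "\<forall>j<n. P j \<longleftrightarrow> j < \<sigma>"
  shows "(\<Sum>j<n. of_bool (P j) *\<^sub>R (a (Suc j) - a j)) = a \<sigma> - a 0"
proof -
  have "(\<Sum>j<n. of_bool (P j) *\<^sub>R (a (Suc j) - a j)) = (\<Sum>j<\<sigma>. a (Suc j) - a j)"
    using assms by (intro sum.mono_neutral_cong_right) auto
  then show ?thesis by (simp add: sum_lessThan_telescope)
qed

lemma infdist_measurable [measurable]: "(\<lambda>z :: 'a :: metric_space. infdist z A) \<in> borel_measurable borel"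
  by (intro borel_measurable_continuous_onI continuous_intros)

section \<open>The event of not having left the triangle\<close>

locale brownian_triangle = standard_brownian_motion_2d M W
  for M :: "'w measure" and W +
  fixes x :: "real \<times> real"
  assumes x_interior: "x \<in> interior triangle"
begin

definition Y :: "real \<Rightarrow> 'w \<Rightarrow> real \<times> real" where "Y t \<omega> = x + W t \<omega>"

text \<open>The time \<open>t\<close> itself is included, so for \<open>0 \<le> t\<close> the
  predicate means that the exit time is greater than \<open>t\<close>, and it concerns a compact
  time interval.\<close>

definition inside :: "real \<Rightarrow> 'w \<Rightarrow> bool" where
  "inside t \<omega> \<longleftrightarrow> (\<forall>s. 0 \<le> s \<and> s \<le> t \<longrightarrow> Y s \<omega> \<notin> frontier triangle)"

lemma measurable_Y: "0 \<le> t \<Longrightarrow> Y t \<in> borel_measurable M"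
  unfolding Y_def [abs_def] using measurable_W by measurable

lemma Y_0: "\<omega> \<in> space M \<Longrightarrow> Y 0 \<omega> = x"
  using start_W by (simp add: Y_def zero_prod_def[symmetric])

lemma continuous_Y: "\<omega> \<in> space M \<Longrightarrow> continuous_on {0..} (\<lambda>t. Y t \<omega>)"
  unfolding Y_def by (intro continuous_intros continuous_W)

lemma inside_antimono: "s \<le> t \<Longrightarrow> inside t \<omega> \<Longrightarrow> inside s \<omega>"
  unfolding inside_def by auto

text \<open>A connected piece of path that starts in the triangle and ends outside must meet the
  frontier.\<close>

lemma inside_imp_triangle:
  assumes "\<omega> \<in> space M" "inside t \<omega>" "0 \<le> t"
  shows "Y t \<omega> \<in> triangle"
proof (rule ccontr)
  assume no: "Y t \<omega> \<notin> triangle"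
  have "connected ((\<lambda>t. Y t \<omega>) ` {0..t})"
    by (intro connected_continuous_image continuous_on_subset[OF continuous_Y[OF assms(1)]]) auto
  moreover have "(\<lambda>t. Y t \<omega>) ` {0..t} \<inter> triangle \<noteq> {}"
    using Y_0[OF assms(1)] x_interior interior_subset assms(3) by force
  moreover have "(\<lambda>t. Y t \<omega>) ` {0..t} - triangle \<noteq> {}" using no assms(3) by force
  ultimately have "(\<lambda>t. Y t \<omega>) ` {0..t} \<inter> frontier triangle \<noteq> {}"
    by (rule connected_Int_frontier)
  then show False using assms(2) by (auto simp: inside_def)
qed

text \<open>
  An approximation of the event \<open>inside t\<close> by finitely many times, to which independence of increments applies;
  \<open>l\<close> tends to infinity first.
\<close>
definition grid_inside :: "real \<Rightarrow> nat \<Rightarrow> nat \<Rightarrow> 'w \<Rightarrow> bool" where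
  "grid_inside t k l \<omega> \<longleftrightarrow>
     (\<forall>i\<le>2^l. inverse (real (Suc k)) \<le> infdist (Y (t * real i / 2 ^ l) \<omega>) (frontier triangle))"

lemma frontier_triangle_ne: "frontier triangle \<noteq> {}"
proof -
  have "(-1, 0) \<in> frontier triangle" by (simp add: frontier_triangle bary_defs)
  then show ?thesis by blast
qed

lemma grid_inside_Suc: "grid_inside t k (Suc l) \<omega> \<Longrightarrow> grid_inside t k l \<omega>"
  unfolding grid_inside_def
proof safe
  fix i :: nat assume "\<forall>i\<le>2 ^ Suc l. inverse (real (Suc k)) \<le> infdist (Y (t * real i / 2 ^ Suc l) \<omega>) (frontier triangle)"
    and "i \<le> 2 ^ l"
  from this(1)[rule_format, of "2 * i"] this(2)
  show "inverse (real (Suc k)) \<le> infdist (Y (t * real i / 2 ^ l) \<omega>) (frontier triangle)" by simp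
qed

text \<open>Dyadic fractions of \<open>t\<close> are dense, the path is continuous, and the
  non-strict lower bound on the distance survives the limit.\<close>

lemma all_grid_inside_iff:
  assumes \<omega>: "\<omega> \<in> space M" and t: "0 \<le> t"
  shows "(\<forall>l. grid_inside t k l \<omega>) \<longleftrightarrow> 
    (\<forall>s\<in>{0..t}. inverse (real (Suc k)) \<le> infdist (Y s \<omega>) (frontier triangle))"
proof
  assume all: "\<forall>l. grid_inside t k l \<omega>"
  show "\<forall>s\<in>{0..t}. inverse (real (Suc k)) \<le> infdist (Y s \<omega>) (frontier triangle)"
  proof
    fix s assume s: "s \<in> {0..t}"
    show "inverse (real (Suc k)) \<le> infdist (Y s \<omega>) (frontier triangle)"
    proof (cases "t = 0")
      case True
      then show ?thesis using s all[unfolded grid_inside_def, rule_format, of 0 0] by simp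
    next
      case False
      then have t0: "t > 0" using t by simp
      \<comment> \<open>\<open>q l\<close> is the largest grid time at level \<open>l\<close> that
        does not exceed \<open>s\<close>.\<close>
      define i where "i l = nat \<lfloor>s / t * 2 ^ l\<rfloor>" for l :: nat
      define q where "q l = t * real (i l) / 2 ^ l" for l
      have st: "0 \<le> s / t" "s / t \<le> 1" using s t0 by auto
      have "real (i l) \<le> s / t * 2 ^ l" for l
        unfolding i_def using st by (intro of_nat_floor mult_nonneg_nonneg) auto
      moreover have "s / t * 2 ^ l \<le> 1 * 2 ^ l" for l using st by (intro mult_right_mono) auto
      ultimately have "real (i l) \<le> 2 ^ l" for l by (metis mult_1 order_trans)
      then have il: "i l \<le> 2 ^ l" for l by (metis of_nat_le_iff of_nat_numeral of_nat_power)
      have up: "q l \<le> s" for l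
        using \<open>real (i l) \<le> s / t * 2 ^ l\<close> t0 by (simp add: q_def field_simps)
      have lo: "s - t / 2 ^ l \<le> q l" for l
      proof -
        have "0 \<le> s / t * 2 ^ l" using st by (intro mult_nonneg_nonneg) auto
        then have "s / t * 2 ^ l < real (i l) + 1"
          unfolding i_def using floor_correct[of "s / t * 2 ^ l"] by (simp add: of_nat_nat)
        then have "s * 2 ^ l < t + t * real (i l)" using t0 by (simp add: field_simps)
        moreover have "(s - t / 2 ^ l) * 2 ^ l = s * 2 ^ l - t" by (simp add: left_diff_distrib)
        ultimately show ?thesis by (simp add: q_def pos_le_divide_eq)
      qed
      have "(\<lambda>l. s - t / 2 ^ l) \<longlonglongrightarrow> s - 0"
        by (intro tendsto_diff tendsto_const) (use LIMSEQ_divide_realpow_zero[of 2 t] in simp)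
      then have "q \<longlonglongrightarrow> s"
        by (intro tendsto_sandwich[OF _ _ _ tendsto_const, of _ q]) (use lo up in auto)
      moreover have "q l \<in> {0..}" for l using t by (simp add: q_def)
      ultimately have "(\<lambda>l. Y (q l) \<omega>) \<longlonglongrightarrow> Y s \<omega>"
        using continuous_Y[OF \<omega>] s by (intro continuous_on_tendsto_compose[of "{0..}" "\<lambda>t. Y t \<omega>"]) auto
      then have "(\<lambda>l. infdist (Y (q l) \<omega>) (frontier triangle)) \<longlonglongrightarrow> infdist (Y s \<omega>) (frontier triangle)"
        by (rule tendsto_infdist)
      then show ?thesis
        by (rule LIMSEQ_le_const) (use all il in \<open>auto simp: q_def grid_inside_def\<close>)
    qed
  qed
next
  assume all: "\<forall>s\<in>{0..t}. inverse (real (Suc k)) \<le> infdist (Y s \<omega>) (frontier triangle)"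
  show "\<forall>l. grid_inside t k l \<omega>"
    unfolding grid_inside_def
  proof safe
    fix l i :: nat assume "i \<le> 2 ^ l"
    then have "real i \<le> 2 ^ l" by (metis of_nat_le_iff of_nat_numeral of_nat_power)
    then have "t * real i / 2 ^ l \<in> {0..t}" using t by (simp add: divide_le_eq mult_left_mono)
    then show "inverse (real (Suc k)) \<le> infdist (Y (t * real i / 2 ^ l) \<omega>) (frontier triangle)" using all by blast
  qed
qed

text \<open>The distance to the frontier attains a positive minimum on the compact time interval, so
  some \<open>1 / (k + 1)\<close> lies below it.\<close>

lemma inside_iff:
  assumes \<omega>: "\<omega> \<in> space M" and t: "0 \<le> t"
  shows "inside t \<omega> \<longleftrightarrow> (\<exists>k. \<forall>l. grid_inside t k l \<omega>)"
proof
  assume ins: "inside t \<omega>"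
  have "continuous_on {0..t} (\<lambda>s. infdist (Y s \<omega>) (frontier triangle))"
    using continuous_on_subset[OF continuous_Y[OF \<omega>], of "{0..t}"] by (intro continuous_on_infdist) auto
  then obtain s0 where s0: "s0 \<in> {0..t}" "\<And>s. s \<in> {0..t} \<Longrightarrow> infdist (Y s0 \<omega>) (frontier triangle) \<le> infdist (Y s \<omega>) (frontier triangle)"
    using continuous_attains_inf[of "{0..t}"] t by (metis atLeastatMost_empty_iff2 compact_Icc not_less)
  have "infdist (Y s0 \<omega>) (frontier triangle) > 0"
    using ins s0(1) by (intro infdist_pos_not_in_closed frontier_closed frontier_triangle_ne) (auto simp: inside_def)
  then obtain k where "inverse (real (Suc k)) < infdist (Y s0 \<omega>) (frontier triangle)"
    using reals_Archimedean by blast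
  then have "\<forall>s\<in>{0..t}. inverse (real (Suc k)) \<le> infdist (Y s \<omega>) (frontier triangle)" using s0(2) by force
  then show "\<exists>k. \<forall>l. grid_inside t k l \<omega>" using all_grid_inside_iff[OF \<omega> t] by blast
next
  assume "\<exists>k. \<forall>l. grid_inside t k l \<omega>"
  then obtain k where k: "\<forall>s\<in>{0..t}. inverse (real (Suc k)) \<le> infdist (Y s \<omega>) (frontier triangle)"
    using all_grid_inside_iff[OF \<omega> t] by blast
  show "inside t \<omega>" unfolding inside_def
  proof safe
    fix s assume s: "0 \<le> s" "s \<le> t" and "Y s \<omega> \<in> frontier triangle"
    then have "infdist (Y s \<omega>) (frontier triangle) = 0" by simp
    moreover have "inverse (real (Suc k)) \<le> infdist (Y s \<omega>) (frontier triangle)" using k s by simp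
    ultimately show False by simp
  qed
qed

lemma all_grid_inside_Suc:
  assumes "\<omega> \<in> space M" "0 \<le> t" "\<forall>l. grid_inside t k l \<omega>"
  shows "\<forall>l. grid_inside t (Suc k) l \<omega>"
proof -
  have "inverse (real (Suc (Suc k))) \<le> inverse (real (Suc k))" by simp
  then show ?thesis using assms(3) unfolding grid_inside_def by (meson order_trans)
qed

lemma measurable_grid_inside:
  assumes "0 \<le> t"
  shows "Measurable.pred M (grid_inside t k l)"
proof -
  have [measurable]: "Y (t * real i / 2 ^ l) \<in> borel_measurable M" for i
    using assms by (intro measurable_Y) auto
  have "Measurable.pred M (\<lambda>\<omega>. \<forall>i\<in>{..2^l}. inverse (real (Suc k)) \<le> infdist (Y (t * real i / 2 ^ l) \<omega>) (frontier triangle))"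
  proof (rule pred_intros_finite)
    show "Measurable.pred M (\<lambda>\<omega>. inverse (real (Suc k)) \<le> infdist (Y (t * real i / 2 ^ l) \<omega>) (frontier triangle))" for i
      by measurable
  qed simp
  then show ?thesis unfolding grid_inside_def [abs_def] by simp
qed

lemma measurable_inside: "0 \<le> t \<Longrightarrow> Measurable.pred M (inside t)"
proof -
  assume t: "0 \<le> t"
  have "Measurable.pred M (\<lambda>\<omega>. \<exists>k. \<forall>l. grid_inside t k l \<omega>)"
    by (rule pred_intros_countable)+ (rule measurable_grid_inside[OF t])
  also have "?this \<longleftrightarrow> ?thesis"
    by (rule measurable_cong) (simp add: inside_iff[OF _ t])
  finally show ?thesis .
qed

text \<open>The martingale property, in the form that annihilates each term of the Taylor polynomial
  before the exit. For the grid events it is \<open>past_orthogonal\<close>; these decrease in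
  \<open>l\<close> and then increase in \<open>k\<close> to \<open>inside t\<close>, and dominated
  convergence applies twice.\<close>

lemma inside_orthogonal:
  fixes p \<psi> :: "real \<times> real \<Rightarrow> real"
  assumes t: "0 \<le> t" "t < u" and p: "p \<in> borel_measurable borel" "\<And>y. \<bar>p y\<bar> \<le> B"
    and \<psi>: "\<psi> \<in> borel_measurable borel" "integrable M (\<lambda>\<omega>. \<psi> (incr t u \<omega>))" "expectation (\<lambda>\<omega>. \<psi> (incr t u \<omega>)) = 0"
  shows "expectation (\<lambda>\<omega>. of_bool (inside t \<omega>) * p (Y t \<omega>) * \<psi> (incr t u \<omega>)) = 0"
    and "integrable M (\<lambda>\<omega>. of_bool (inside t \<omega>) * p (Y t \<omega>) * \<psi> (incr t u \<omega>))"
proof -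
  note [measurable] = measurable_Y[OF t(1)] measurable_inside[OF t(1)] measurable_grid_inside[OF t(1)] p(1) \<psi>(1)
  have [measurable]: "incr t u \<in> borel_measurable M" using t by (intro measurable_incr) auto
  let ?H = "\<lambda>P \<omega>. of_bool P * p (Y t \<omega>) * \<psi> (incr t u \<omega>)"
  have B0: "B \<ge> 0" by (rule order_trans[OF abs_ge_zero p(2)[of 0]])
  have bnd: "norm (of_bool P * p (Y t \<omega>) * \<psi> (incr t u \<omega>)) \<le> B * \<bar>\<psi> (incr t u \<omega>)\<bar>" for P \<omega>
  proof (cases P)
    case True
    have "\<bar>p (Y t \<omega>)\<bar> * \<bar>\<psi> (incr t u \<omega>)\<bar> \<le> B * \<bar>\<psi> (incr t u \<omega>)\<bar>" by (intro mult_right_mono p(2)) simp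
    then show ?thesis using True by (simp add: abs_mult)
  qed (use B0 in simp)
  have dom: "integrable M (\<lambda>\<omega>. B * \<bar>\<psi> (incr t u \<omega>)\<bar>)" using \<psi>(2) by auto
  have grid: "expectation (\<lambda>\<omega>. ?H (grid_inside t k l \<omega>) \<omega>) = 0" for k l
  proof -
    define n :: nat where "n = 2 ^ l"
    have n: "n > 0" "real n = 2 ^ l" by (simp_all add: n_def)
    \<comment> \<open>The positions at the grid times are partial sums of the increments, so event
      and weight together are a function of the increments up to \<open>t\<close>.\<close>
    define c where "c v = of_bool (\<forall>i\<le>n. inverse (real (Suc k)) \<le> infdist (x + (\<Sum>j<i. v j)) (frontier triangle)) * p (x + (\<Sum>j<n. v j))"
      for v :: "nat \<Rightarrow> real \<times> real"
    have sm[measurable]: "(\<lambda>v. x + (\<Sum>j<i. v j)) \<in> borel_measurable (PiM {..<n} (\<lambda>_. borel))" if "i \<le> n" for i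
      using that by (intro borel_measurable_add borel_measurable_const borel_measurable_sum measurable_component_singleton) auto
    have "Measurable.pred (PiM {..<n} (\<lambda>_. borel)) (\<lambda>v. \<forall>i\<in>{..n}. inverse (real (Suc k)) \<le> infdist (x + (\<Sum>j<i. v j)) (frontier triangle))"
    proof (rule pred_intros_finite)
      fix i assume "i \<in> {..n}"
      then have [measurable]: "(\<lambda>v. x + (\<Sum>j<i. v j)) \<in> borel_measurable (PiM {..<n} (\<lambda>_. borel))" by (intro sm) simp
      show "Measurable.pred (PiM {..<n} (\<lambda>_. borel)) (\<lambda>v. inverse (real (Suc k)) \<le> infdist (x + (\<Sum>j<i. v j)) (frontier triangle))"
        by measurable
    qed simp
    then have [measurable]: "Measurable.pred (PiM {..<n} (\<lambda>_. borel)) (\<lambda>v. \<forall>i\<le>n. inverse (real (Suc k)) \<le> infdist (x + (\<Sum>j<i. v j)) (frontier triangle))"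
      by simp
    have c: "c \<in> borel_measurable (PiM {..<n} (\<lambda>_. borel))"
      unfolding c_def using measurable_compose[OF sm[of n] p(1)] by measurable
    have cB: "\<bar>c v\<bar> \<le> B" for v using p(2) B0 by (auto simp: c_def)
    have eq: "c (\<lambda>i\<in>{..<n}. incr (t * real i / real n) (t * real (Suc i) / real n) \<omega>) = of_bool (grid_inside t k l \<omega>) * p (Y t \<omega>)"
      if \<omega>: "\<omega> \<in> space M" for \<omega>
    proof -
      have "x + (\<Sum>j<i. (\<lambda>i\<in>{..<n}. incr (t * real i / real n) (t * real (Suc i) / real n) \<omega>) j) = Y (t * real i / real n) \<omega>" if "i \<le> n" for i
      proof -
        have "(\<Sum>j<i. (\<lambda>i\<in>{..<n}. incr (t * real i / real n) (t * real (Suc i) / real n) \<omega>) j)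
          = (\<Sum>j<i. W (t * real (Suc j) / real n) \<omega> - W (t * real j / real n) \<omega>)"
          using that by (intro sum.cong) (auto simp: incr_def)
        also have "\<dots> = W (t * real i / real n) \<omega> - W (t * real 0 / real n) \<omega>"
          by (rule sum_lessThan_telescope)
        finally show ?thesis using start_W[OF \<omega>] by (simp add: Y_def zero_prod_def[symmetric])
      qed
      from this this[of n] show ?thesis
        unfolding c_def grid_inside_def n_def[symmetric] n(2)[symmetric] using n(1) by auto
    qed
    have "expectation (\<lambda>\<omega>. c (\<lambda>i\<in>{..<n}. incr (t * real i / real n) (t * real (Suc i) / real n) \<omega>) * \<psi> (incr t u \<omega>)) = 0"
      by (rule past_orthogonal[OF t n(1) c cB \<psi>])
    also have "expectation (\<lambda>\<omega>. c (\<lambda>i\<in>{..<n}. incr (t * real i / real n) (t * real (Suc i) / real n) \<omega>) * \<psi> (incr t u \<omega>))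
        = expectation (\<lambda>\<omega>. ?H (grid_inside t k l \<omega>) \<omega>)"
      by (intro Bochner_Integration.integral_cong refl) (simp only: eq)
    finally show ?thesis .
  qed
  have "(\<lambda>l. expectation (\<lambda>\<omega>. ?H (grid_inside t k l \<omega>) \<omega>))
      \<longlonglongrightarrow> expectation (\<lambda>\<omega>. ?H (\<forall>l. grid_inside t k l \<omega>) \<omega>)" for k
  proof (rule integral_dominated_convergence[OF _ _ dom])
    show "AE \<omega> in M. (\<lambda>l. ?H (grid_inside t k l \<omega>) \<omega>)
      \<longlonglongrightarrow> ?H (\<forall>l. grid_inside t k l \<omega>) \<omega>"
      by (intro AE_I2 tendsto_mult tendsto_const tendsto_of_bool_all) (erule grid_inside_Suc)
  qed (use bnd in auto)
  then have all: "expectation (\<lambda>\<omega>. ?H (\<forall>l. grid_inside t k l \<omega>) \<omega>) = 0" for k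
    unfolding grid by (simp add: LIMSEQ_const_iff)
  have "(\<lambda>k. expectation (\<lambda>\<omega>. ?H (\<forall>l. grid_inside t k l \<omega>) \<omega>))
      \<longlonglongrightarrow> expectation (\<lambda>\<omega>. ?H (inside t \<omega>) \<omega>)"
  proof (rule integral_dominated_convergence[OF _ _ dom])
    show "AE \<omega> in M. (\<lambda>k. ?H (\<forall>l. grid_inside t k l \<omega>) \<omega>)
       \<longlonglongrightarrow> ?H (inside t \<omega>) \<omega>"
    proof (rule AE_I2)
      fix \<omega> assume \<omega>: "\<omega> \<in> space M"
      show "(\<lambda>k. ?H (\<forall>l. grid_inside t k l \<omega>) \<omega>)
       \<longlonglongrightarrow> ?H (inside t \<omega>) \<omega>"
        unfolding inside_iff[OF \<omega> t(1)]
        by (intro tendsto_mult tendsto_const tendsto_of_bool_ex all_grid_inside_Suc[OF \<omega> t(1)])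
    qed
  qed (use bnd in auto)
  then show "expectation (\<lambda>\<omega>. ?H (inside t \<omega>) \<omega>) = 0"
    unfolding all by (simp add: LIMSEQ_const_iff)
  show "integrable M (\<lambda>\<omega>. ?H (inside t \<omega>) \<omega>)"
    by (rule Bochner_Integration.integrable_bound[OF dom]) (use bnd B0 in \<open>auto simp: abs_mult\<close>)
qed

end

section \<open>The exit point as a limit of stopped discretisations\<close>

context brownian_triangle
begin

definition T :: "'w \<Rightarrow> ereal" where "T \<omega> = exit_time (\<lambda>t. x + W t \<omega>) triangle"

text \<open>On paths that never exit, \<open>real_of_ereal \<infinity> = 0\<close> makes the value
  \<open>x\<close>, an interior point that cannot be confused with a point of the frontier.\<close>

definition Z :: "'w \<Rightarrow> real \<times> real" where "Z \<omega> = x + W (real_of_ereal (T \<omega>)) \<omega>"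

text \<open>The set of times spent on the frontier is closed, so its infimum is attained.\<close>

lemma T_finite:
  assumes \<omega>: "\<omega> \<in> space M" and s: "0 \<le> s" "Y s \<omega> \<in> frontier triangle"
  obtains r where "0 \<le> r" "T \<omega> = ereal r" "Z \<omega> = Y r \<omega>" "Y r \<omega> \<in> frontier triangle"
    "\<And>t. 0 \<le> t \<Longrightarrow> inside t \<omega> \<longleftrightarrow> t < r"
proof -
  define S where "S = {0..} \<inter> (\<lambda>t. Y t \<omega>) -` frontier triangle"
  have "closed S" unfolding S_def
    by (rule continuous_closed_preimage[OF continuous_Y[OF \<omega>]]) auto
  moreover have "s \<in> S" using s by (simp add: S_def)
  moreover have bdd: "bdd_below S" by (rule bdd_belowI[of _ 0]) (simp add: S_def)
  ultimately have InfS: "Inf S \<in> S" by (intro closed_contains_Inf) auto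
  have Seq: "{t. 0 \<le> t \<and> x + W t \<omega> \<in> frontier triangle} = S" by (auto simp: S_def Y_def)
  have "T \<omega> = ereal (Inf S)"
    unfolding T_def exit_time_def Seq
  proof (rule antisym)
    show "Inf (ereal ` S) \<le> ereal (Inf S)" using InfS by (intro Inf_lower) auto
    show "ereal (Inf S) \<le> Inf (ereal ` S)" using bdd by (intro Inf_greatest) (auto intro: cInf_lower)
  qed
  moreover have "inside t \<omega> \<longleftrightarrow> t < Inf S" if t: "0 \<le> t" for t
  proof
    assume "inside t \<omega>"
    then show "t < Inf S" using InfS t by (auto simp: inside_def S_def not_le[symmetric])
  next
    assume "t < Inf S"
    show "inside t \<omega>" unfolding inside_def
    proof safe
      fix u assume u: "0 \<le> u" "u \<le> t" "Y u \<omega> \<in> frontier triangle"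
      then have "Inf S \<le> u" using bdd by (intro cInf_lower) (auto simp: S_def)
      then show False using u \<open>t < Inf S\<close> by simp
    qed
  qed
  ultimately show ?thesis using InfS by (intro that[of "Inf S"]) (auto simp: S_def Z_def Y_def)
qed

lemma T_infinite_iff:
  assumes \<omega>: "\<omega> \<in> space M"
  shows "T \<omega> = \<infinity> \<longleftrightarrow> (\<forall>n::nat. inside (real n) \<omega>)"
proof
  assume inf: "T \<omega> = \<infinity>"
  show "\<forall>n::nat. inside (real n) \<omega>"
    unfolding inside_def
  proof safe
    fix n s assume s: "0 \<le> s" "Y s \<omega> \<in> frontier triangle"
    show False by (rule T_finite[OF \<omega> s]) (simp add: inf)
  qed
next
  assume "\<forall>n::nat. inside (real n) \<omega>"
  then have eq: "{t. 0 \<le> t \<and> x + W t \<omega> \<in> frontier triangle} = {}"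
    unfolding inside_def Y_def using real_arch_simple by auto blast
  show "T \<omega> = \<infinity>" unfolding T_def exit_time_def eq by (simp add: top_ereal_def)
qed

lemma T_finite':
  assumes \<omega>: "\<omega> \<in> space M" and fin: "T \<omega> \<noteq> \<infinity>"
  obtains r where "0 \<le> r" "T \<omega> = ereal r" "Z \<omega> = Y r \<omega>" "Y r \<omega> \<in> frontier triangle"
    "\<And>t. 0 \<le> t \<Longrightarrow> inside t \<omega> \<longleftrightarrow> t < r"
proof -
  obtain s where "0 \<le> s" "Y s \<omega> \<in> frontier triangle"
    using fin T_infinite_iff[OF \<omega>] by (auto simp: inside_def)
  from T_finite[OF \<omega> this that] show ?thesis .
qed

lemma Z_infinite: "\<omega> \<in> space M \<Longrightarrow> T \<omega> = \<infinity> \<Longrightarrow> Z \<omega> = x"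
  using Y_0 by (simp add: Z_def Y_def)

abbreviation "mesh m j \<equiv> real j / real m ^ 4"

text \<open>
  The position at the first of the times \<open>j / m ^ 4\<close> that is not before \<open>T\<close>, or at time \<open>m\<close> if \<open>m < T\<close>. The horizon
  \<open>m\<close> tends to infinity, while the third order errors sum up to \<open>m ^ 5 * O((1 / m\<^sup>2) ^ 3)\<close>, which tends to 0.
\<close>
definition Zs :: "nat \<Rightarrow> 'w \<Rightarrow> real \<times> real" where
  "Zs m \<omega> = x + (\<Sum>j<m^5. of_bool (inside (mesh m j) \<omega>) *\<^sub>R (Y (mesh m (Suc j)) \<omega> - Y (mesh m j) \<omega>))"

lemma measurable_Zs [measurable]: "Zs m \<in> borel_measurable M"
proof -
  have [measurable]: "Y (mesh m j) \<in> borel_measurable M" for j by (rule measurable_Y) simp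
  have [measurable]: "Measurable.pred M (inside (mesh m j))" for j by (rule measurable_inside) simp
  show ?thesis unfolding Zs_def [abs_def] by measurable
qed

lemma Zs_stopped:
  assumes \<omega>: "\<omega> \<in> space M"
  shows "\<exists>\<sigma>\<le>m^5. (\<forall>j<\<sigma>. inside (mesh m j) \<omega>) \<and> (\<sigma> < m^5 \<longrightarrow> \<not> inside (mesh m \<sigma>) \<omega>) \<and>
      Zs m \<omega> = Y (mesh m \<sigma>) \<omega>"
    and Zs_telescope: "f (Zs m \<omega>) = f x + (\<Sum>j<m^5. of_bool (inside (mesh m j) \<omega>) *
       (f (Y (mesh m (Suc j)) \<omega>) - f (Y (mesh m j) \<omega>) :: real))"
proof -
  have anti: "inside (mesh m j) \<omega> \<Longrightarrow> inside (mesh m i) \<omega>" if "i \<le> j" for i j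
    using that by (elim inside_antimono[rotated]) (auto intro!: divide_right_mono)
  have "\<exists>\<sigma>\<le>m^5. \<forall>j<m^5. inside (mesh m j) \<omega> \<longleftrightarrow> j < \<sigma>"
    by (rule antimono_threshold) (rule anti)
  then obtain \<sigma> where \<sigma>: "\<sigma> \<le> m^5" "\<forall>j<m^5. inside (mesh m j) \<omega> \<longleftrightarrow> j < \<sigma>" by blast
  have Zs: "Zs m \<omega> = Y (mesh m \<sigma>) \<omega>"
    unfolding Zs_def sum_stopped_telescope[OF \<sigma>, of "\<lambda>j. Y (mesh m j) \<omega>"] using Y_0[OF \<omega>] by simp
  show "\<exists>\<sigma>\<le>m^5. (\<forall>j<\<sigma>. inside (mesh m j) \<omega>) \<and> (\<sigma> < m^5 \<longrightarrow> \<not> inside (mesh m \<sigma>) \<omega>) \<and>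
      Zs m \<omega> = Y (mesh m \<sigma>) \<omega>"
    using \<sigma> Zs by (intro exI[of _ \<sigma>]) auto
  show "f (Zs m \<omega>) = f x + (\<Sum>j<m^5. of_bool (inside (mesh m j) \<omega>) * (f (Y (mesh m (Suc j)) \<omega>) - f (Y (mesh m j) \<omega>)))"
    unfolding Zs using sum_stopped_telescope[OF \<sigma>, of "\<lambda>j. f (Y (mesh m j) \<omega>)"] Y_0[OF \<omega>] by simp
qed

text \<open>Once the horizon \<open>m\<close> exceeds the exit time \<open>r\<close>, the stopping
  time lies between \<open>r\<close> and \<open>r + 1 / m ^ 4\<close>; the path is continuous at
  \<open>r\<close>.\<close>

lemma Zs_tendsto:
  assumes \<omega>: "\<omega> \<in> space M" and fin: "T \<omega> \<noteq> \<infinity>"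
  shows "(\<lambda>m. Zs m \<omega>) \<longlonglongrightarrow> Z \<omega>"
proof -
  obtain r where r': "0 \<le> r" "T \<omega> = ereal r" "Z \<omega> = Y r \<omega>" "Y r \<omega> \<in> frontier triangle"
    "\<And>t. 0 \<le> t \<Longrightarrow> inside t \<omega> \<longleftrightarrow> t < r"
    by (rule T_finite'[OF \<omega> fin]) blast
  note r = r'(1,3,5)
  have "\<exists>q. Zs m \<omega> = Y q \<omega> \<and> 0 \<le> q \<and> q \<le> r + 1 / real m ^ 4 \<and> (real m \<ge> r \<longrightarrow> r \<le> q)" for m
  proof -
    obtain \<sigma> where \<sigma>: "\<sigma> \<le> m^5" "\<And>j. j < \<sigma> \<Longrightarrow> inside (mesh m j) \<omega>" "\<sigma> < m^5 \<Longrightarrow> \<not> inside (mesh m \<sigma>) \<omega>"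
      "Zs m \<omega> = Y (mesh m \<sigma>) \<omega>"
      using Zs_stopped[OF \<omega>, where m = m] by blast
    have 1: "0 \<le> mesh m \<sigma>" by simp
    have 2: "mesh m \<sigma> \<le> r + 1 / real m ^ 4"
    proof (cases \<sigma>)
      case (Suc j)
      then have "mesh m j < r" using \<sigma>(2)[of j] r(3)[of "mesh m j"] by simp
      then show ?thesis using Suc by (simp add: add_divide_distrib)
    qed (use r(1) in simp)
    have 3: "r \<le> mesh m \<sigma>" if "real m \<ge> r"
    proof (cases "\<sigma> < m^5")
      case True
      then show ?thesis using \<sigma>(3) r(3)[OF 1] by simp
    next
      case False
      then have "\<sigma> = m ^ 5" using \<sigma>(1) by simp
      moreover have "real (m ^ 5) = real m * real m ^ 4" by (simp add: eval_nat_numeral)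
      ultimately have "mesh m \<sigma> = real m" by simp
      then show ?thesis using that by simp
    qed
    show ?thesis using \<sigma>(4) 1 2 3 by blast
  qed
  then obtain q where q: "\<And>m. Zs m \<omega> = Y (q m) \<omega>" "\<And>m. 0 \<le> q m" "\<And>m. q m \<le> r + 1 / real m ^ 4"
    "\<And>m. real m \<ge> r \<Longrightarrow> r \<le> q m" by metis
  have "(\<lambda>m. r + 1 / real m ^ 4) \<longlonglongrightarrow> r + 0"
    by (intro tendsto_add tendsto_const) real_asymp
  then have lim: "(\<lambda>m. r + 1 / real m ^ 4) \<longlonglongrightarrow> r" by simp
  have "q \<longlonglongrightarrow> r"
  proof (rule tendsto_sandwich[OF _ _ tendsto_const])
    obtain N :: nat where "r \<le> real N" using real_arch_simple by blast
    then have "r \<le> q m" if "m \<ge> N" for m using q(4)[of m] that by simp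
    then show "eventually (\<lambda>m. r \<le> q m) sequentially" by (rule eventually_sequentiallyI)
    show "eventually (\<lambda>m. q m \<le> r + 1 / real m ^ 4) sequentially" by (rule always_eventually) (simp add: q(3))
  qed (rule lim)
  then have "(\<lambda>m. Y (q m) \<omega>) \<longlonglongrightarrow> Y r \<omega>"
    using continuous_Y[OF \<omega>] q(2) r(1) by (intro continuous_on_tendsto_compose[of "{0..}" "\<lambda>t. Y t \<omega>"]) auto
  then show ?thesis by (simp add: q(1) r(2))
qed

lemma measurable_T_infinite: "Measurable.pred M (\<lambda>\<omega>. T \<omega> = \<infinity>)"
proof -
  have "Measurable.pred M (\<lambda>\<omega>. \<forall>n::nat. inside (real n) \<omega>)"
    by (rule pred_intros_countable) (simp add: measurable_inside)
  also have "?this \<longleftrightarrow> ?thesis"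
    by (rule measurable_cong) (simp add: T_infinite_iff)
  finally show ?thesis .
qed

lemma measurable_Z [measurable]: "Z \<in> borel_measurable M"
proof (rule borel_measurable_LIMSEQ_metric)
  \<comment> \<open>On paths that never exit, \<open>Zs m\<close> is the position at time
    \<open>m\<close> and need not converge, so it is replaced by \<open>x\<close> there.\<close>
  show "(\<lambda>\<omega>. if T \<omega> = \<infinity> then x else Zs m \<omega>) \<in> borel_measurable M" for m
    using measurable_T_infinite by (intro measurable_If borel_measurable_const measurable_Zs) simp
  show "(\<lambda>m. if T \<omega> = \<infinity> then x else Zs m \<omega>) \<longlonglongrightarrow> Z \<omega>" if "\<omega> \<in> space M" for \<omega>
    using Zs_tendsto[OF that] Z_infinite[OF that] by (cases "T \<omega> = \<infinity>") simp_all
qed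

text \<open>A path that never exits is still in the triangle at time \<open>n\<close>, where the
  density of the position is at most \<open>1 / (2 * pi * n)\<close>. The probability is therefore
  at most the area times this bound.\<close>

lemma AE_T_finite: "AE \<omega> in M. T \<omega> \<noteq> \<infinity>"
proof -
  define D where "D = (\<lambda>z. - x + z) ` triangle"
  have "compact D" unfolding D_def by (rule compact_translation[OF compact_triangle])
  then have D: "emeasure lborel D < \<infinity>" "D \<in> sets borel"
    using emeasure_bounded_finite[OF compact_imp_bounded[of D]] by (auto intro: borel_compact)
  define d where "d = measure lborel D"
  have bnd: "prob {\<omega> \<in> space M. T \<omega> = \<infinity>} \<le> d / (2 * pi * real n)" if n: "n > 0" for n :: nat
  proof -
    let ?X = "{\<omega> \<in> space M. T \<omega> = \<infinity>}"
    have Xm: "?X \<in> events" using measurable_T_infinite by simp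
    have nd: "normal_density 0 (sqrt (real n)) u \<le> 1 / sqrt (2 * pi * real n)" for u
    proof -
      have "exp (- (u\<^sup>2 / (2 * real n))) \<le> 1" by simp
      then show ?thesis using n by (simp add: normal_density_def divide_right_mono)
    qed
    have "incr 0 (real n) \<omega> \<in> D" if "\<omega> \<in> ?X" for \<omega>
    proof -
      have "inside (real n) \<omega>" using that T_infinite_iff[of \<omega>] by auto
      then have "Y (real n) \<omega> \<in> triangle" using that by (intro inside_imp_triangle) auto
      moreover have "incr 0 (real n) \<omega> = - x + Y (real n) \<omega>"
        using that start_W[of \<omega>] by (simp add: incr_def Y_def zero_prod_def[symmetric])
      ultimately show ?thesis by (auto simp: D_def)
    qed
    then have "emeasure M ?X \<le> emeasure M (incr 0 (real n) -` D \<inter> space M)"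
      using D(2) measurable_sets[OF measurable_incr[of 0 "real n"] D(2)] by (intro emeasure_mono) auto
    also have "\<dots> = (\<integral>\<^sup>+z. ennreal (normal_density 0 (sqrt (real n)) (fst z) * normal_density 0 (sqrt (real n)) (snd z)) * indicator D z \<partial>lborel)"
      using distributed_emeasure[OF incr_density[of 0 "real n"]] n D(2) by simp
    also have "\<dots> \<le> (\<integral>\<^sup>+z. ennreal (1 / (2 * pi * real n)) * indicator D z \<partial>lborel)"
    proof (intro nn_integral_mono mult_right_mono ennreal_leI)
      fix z :: "real \<times> real"
      have "normal_density 0 (sqrt (real n)) (fst z) * normal_density 0 (sqrt (real n)) (snd z)
        \<le> 1 / sqrt (2 * pi * real n) * (1 / sqrt (2 * pi * real n))"
        by (intro mult_mono nd) auto
      also have "\<dots> = 1 / (2 * pi * real n)" by simp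
      finally show "normal_density 0 (sqrt (real n)) (fst z) * normal_density 0 (sqrt (real n)) (snd z) \<le> 1 / (2 * pi * real n)" .
    qed simp
    also have "\<dots> = ennreal (1 / (2 * pi * real n)) * emeasure lborel D"
      using D by (subst nn_integral_cmult_indicator) auto
    also have "\<dots> = ennreal (d / (2 * pi * real n))"
      unfolding d_def using D(1) by (subst emeasure_eq_ennreal_measure) (auto simp: ennreal_mult[symmetric])
    finally show ?thesis
      by (simp add: emeasure_eq_measure d_def)
  qed
  have "(\<lambda>n. d / (2 * pi * real n)) \<longlonglongrightarrow> 0" by real_asymp
  then have "prob {\<omega> \<in> space M. T \<omega> = \<infinity>} \<le> 0"
    by (rule LIMSEQ_le_const) (use bnd in \<open>auto intro!: exI[of _ 1]\<close>)
  then have "prob {\<omega> \<in> space M. T \<omega> = \<infinity>} = 0" by (simp add: measure_le_0_iff)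
  then have "AE \<omega> in M. \<omega> \<notin> {\<omega> \<in> space M. T \<omega> = \<infinity>}"
    using measurable_T_infinite by (intro AE_not_in) (auto simp: null_sets_def emeasure_eq_measure)
  then show ?thesis using AE_space by eventually_elim auto
qed

lemma AE_Z_frontier: "AE \<omega> in M. Z \<omega> \<in> frontier triangle"
  using AE_T_finite AE_space
proof eventually_elim
  case (elim \<omega>)
  show ?case by (rule T_finite'[OF elim(2,1)]) simp
qed

text \<open>The polynomial part \<open>P\<close> has mean zero by \<open>inside_orthogonal\<close>;
  what remains is the third absolute moment of the increment, whence the factor 5.\<close>

lemma step_bound:
  assumes f: "f \<in> borel_measurable borel" "\<And>y. \<bar>f y\<bar> \<le> B"
    and p: "p1 \<in> borel_measurable borel" "p2 \<in> borel_measurable borel"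
      "q1 \<in> borel_measurable borel" "q2 \<in> borel_measurable borel"
      "\<And>y. \<bar>p1 y\<bar> \<le> L \<and> \<bar>p2 y\<bar> \<le> L \<and> \<bar>q1 y\<bar> \<le> L \<and> \<bar>q2 y\<bar> \<le> L"
    and K: "\<And>y u v. y \<in> triangle \<Longrightarrow> \<bar>f (y + (u, v)) - f y
           - (p1 y * u + p2 y * v + q1 y * (u\<^sup>2 - v\<^sup>2) + q2 y * (u * v))\<bar> \<le> K * norm (u, v) ^ 3"
    and t: "0 \<le> t" "t < u"
  shows "\<bar>expectation (\<lambda>\<omega>. of_bool (inside t \<omega>) * (f (Y u \<omega>) - f (Y t \<omega>)))\<bar> \<le> 5 * K * sqrt (u - t) ^ 3"
proof -
  note mom = incr_moments[OF t]
  define \<xi> where "\<xi> = incr t u"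
  note mom' = mom[folded \<xi>_def]
  have [measurable]: "Y t \<in> borel_measurable M" "Y u \<in> borel_measurable M" "\<xi> \<in> borel_measurable M"
    unfolding \<xi>_def using t by (auto intro!: measurable_Y measurable_incr)
  note [measurable] = f(1) measurable_inside[OF t(1)]
  have cm: "(\<lambda>z::real\<times>real. fst z) \<in> borel_measurable borel" "(\<lambda>z::real\<times>real. snd z) \<in> borel_measurable borel"
    "(\<lambda>z::real\<times>real. (fst z)\<^sup>2 - (snd z)\<^sup>2) \<in> borel_measurable borel" "(\<lambda>z::real\<times>real. fst z * snd z) \<in> borel_measurable borel"
    by (intro borel_measurable_continuous_onI continuous_intros)+
  have bp: "\<bar>p1 y\<bar> \<le> L" "\<bar>p2 y\<bar> \<le> L" "\<bar>q1 y\<bar> \<le> L" "\<bar>q2 y\<bar> \<le> L" for y using p(5)[of y] by auto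
  let ?I = "\<lambda>\<omega>. of_bool (inside t \<omega>) :: real"
  note o1 = inside_orthogonal[OF t p(1) bp(1) cm(1) mom(1,2), folded \<xi>_def]
  note o2 = inside_orthogonal[OF t p(2) bp(2) cm(2) mom(3,4), folded \<xi>_def]
  note o3 = inside_orthogonal[OF t p(3) bp(3) cm(3) mom(7,8), folded \<xi>_def]
  note o4 = inside_orthogonal[OF t p(4) bp(4) cm(4) mom(5,6), folded \<xi>_def]
  define P where "P \<omega> = ?I \<omega> * p1 (Y t \<omega>) * fst (\<xi> \<omega>) + ?I \<omega> * p2 (Y t \<omega>) * snd (\<xi> \<omega>)
     + ?I \<omega> * q1 (Y t \<omega>) * ((fst (\<xi> \<omega>))\<^sup>2 - (snd (\<xi> \<omega>))\<^sup>2) + ?I \<omega> * q2 (Y t \<omega>) * (fst (\<xi> \<omega>) * snd (\<xi> \<omega>))" for \<omega>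
  have Pint: "integrable M P" unfolding P_def by (intro Bochner_Integration.integrable_add o1 o2 o3 o4)
  have P0: "expectation P = 0" unfolding P_def using o1 o2 o3 o4 by simp
  have Dint: "integrable M (\<lambda>\<omega>. ?I \<omega> * (f (Y u \<omega>) - f (Y t \<omega>)))"
  proof (rule integrable_const_bound[of _ "2 * B"])
    have "\<bar>f (Y u \<omega>) - f (Y t \<omega>)\<bar> \<le> 2 * B" for \<omega> using f(2)[of "Y u \<omega>"] f(2)[of "Y t \<omega>"] by linarith
    moreover have "0 \<le> 2 * B" using calculation abs_ge_zero order_trans by blast
    ultimately show "AE \<omega> in M. norm (?I \<omega> * (f (Y u \<omega>) - f (Y t \<omega>))) \<le> 2 * B" by simp
  qed measurable
  have le: "\<bar>?I \<omega> * (f (Y u \<omega>) - f (Y t \<omega>)) - P \<omega>\<bar> \<le> K * norm (\<xi> \<omega>) ^ 3" if \<omega>: "\<omega> \<in> space M" for \<omega>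
  proof (cases "inside t \<omega>")
    case True
    then have "Y t \<omega> \<in> triangle" using inside_imp_triangle[OF \<omega> _ t(1)] by simp
    moreover have "Y u \<omega> = Y t \<omega> + (fst (\<xi> \<omega>), snd (\<xi> \<omega>))" by (simp add: \<xi>_def incr_def Y_def prod_eq_iff)
    ultimately show ?thesis
      using K[of "Y t \<omega>" "fst (\<xi> \<omega>)" "snd (\<xi> \<omega>)"] True by (simp add: P_def)
  next
    case False
    have "0 \<le> K * norm ((1::real), (0::real)) ^ 3"
      using K[of x 1 0] x_interior interior_subset by (meson abs_ge_zero order_trans subsetD)
    then have "0 \<le> K" by (simp add: norm_prod_def)
    then show ?thesis using False by (simp add: P_def)
  qed
  have "expectation (\<lambda>\<omega>. ?I \<omega> * (f (Y u \<omega>) - f (Y t \<omega>))) = expectation (\<lambda>\<omega>. ?I \<omega> * (f (Y u \<omega>) - f (Y t \<omega>)) - P \<omega>)"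
    using Dint Pint P0 by simp
  also have "\<bar>\<dots>\<bar> \<le> expectation (\<lambda>\<omega>. \<bar>?I \<omega> * (f (Y u \<omega>) - f (Y t \<omega>)) - P \<omega>\<bar>)"
    using integral_norm_bound[of M "\<lambda>\<omega>. ?I \<omega> * (f (Y u \<omega>) - f (Y t \<omega>)) - P \<omega>"] by simp
  also have "\<dots> \<le> expectation (\<lambda>\<omega>. K * norm (\<xi> \<omega>) ^ 3)"
    using Dint Pint mom'(9) le by (intro integral_mono) auto
  also have "\<dots> = K * expectation (\<lambda>\<omega>. norm (\<xi> \<omega>) ^ 3)" using mom'(9) by simp
  also have "\<dots> \<le> K * (5 * sqrt (u - t) ^ 3)"
  proof (rule mult_left_mono[OF mom'(10)])
    have "0 \<le> K * norm ((1::real), (0::real)) ^ 3"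
      using K[of x 1 0] x_interior interior_subset by (meson abs_ge_zero order_trans subsetD)
    then show "0 \<le> K" by (simp add: norm_prod_def)
  qed
  finally show ?thesis by (simp add: mult.commute mult.left_commute)
qed

theorem expectation_exit:
  assumes "iso_taylor triangle f"
  shows "expectation (\<lambda>\<omega>. f (Z \<omega>)) = f x"
proof -
  have cont: "continuous_on UNIV f" using assms by (simp add: iso_taylor_def)
  have f[measurable]: "f \<in> borel_measurable borel" by (rule borel_measurable_continuous_onI[OF cont])
  obtain B where B: "\<And>y. \<bar>f y\<bar> \<le> B" using assms by (auto simp: iso_taylor_def bounded_iff)
  obtain p1 p2 q1 q2 L K where p: "p1 \<in> borel_measurable borel" "p2 \<in> borel_measurable borel"
      "q1 \<in> borel_measurable borel" "q2 \<in> borel_measurable borel"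
      "\<And>y. \<bar>p1 y\<bar> \<le> L \<and> \<bar>p2 y\<bar> \<le> L \<and> \<bar>q1 y\<bar> \<le> L \<and> \<bar>q2 y\<bar> \<le> L"
    and K: "\<And>y u v. y \<in> triangle \<Longrightarrow> \<bar>f (y + (u, v)) - f y
           - (p1 y * u + p2 y * v + q1 y * (u\<^sup>2 - v\<^sup>2) + q2 y * (u * v))\<bar> \<le> K * norm (u, v) ^ 3"
    using assms unfolding iso_taylor_def by blast
  have bound: "\<bar>expectation (\<lambda>\<omega>. f (Zs m \<omega>)) - f x\<bar> \<le> 5 * K / real m" if m: "m > 0" for m
  proof -
    let ?D = "\<lambda>j \<omega>. of_bool (inside (mesh m j) \<omega>) * (f (Y (mesh m (Suc j)) \<omega>) - f (Y (mesh m j) \<omega>))"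
    have lt: "0 \<le> mesh m j" "mesh m j < mesh m (Suc j)" for j using m by (auto intro!: divide_strict_right_mono)
    have int: "integrable M (?D j)" for j
    proof (rule integrable_const_bound[of _ "2 * B"])
      note [measurable] = measurable_Y[OF lt(1)] measurable_inside[OF lt(1)]
      have "\<bar>f y - f z\<bar> \<le> 2 * B" for y z using B[of y] B[of z] by linarith
      moreover have "0 \<le> 2 * B" using calculation abs_ge_zero order_trans by blast
      ultimately show "AE \<omega> in M. norm (?D j \<omega>) \<le> 2 * B" by simp
      show "?D j \<in> borel_measurable M" by measurable
    qed
    have "expectation (\<lambda>\<omega>. f (Zs m \<omega>)) = expectation (\<lambda>\<omega>. f x + (\<Sum>j<m^5. ?D j \<omega>))"
      by (intro Bochner_Integration.integral_cong refl) (rule Zs_telescope)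
    also have "\<dots> = f x + (\<Sum>j<m^5. expectation (?D j))"
      using int by (subst Bochner_Integration.integral_add; (subst Bochner_Integration.integral_sum)?)
        (simp_all add: prob_space del: sum_of_bool_mult_eq)
    finally have "\<bar>expectation (\<lambda>\<omega>. f (Zs m \<omega>)) - f x\<bar> = \<bar>\<Sum>j<m^5. expectation (?D j)\<bar>" by simp
    \<comment> \<open>A time step of \<open>1 / m ^ 4\<close> has standard deviation
      \<open>1 / m ^ 2\<close>, hence a third order error of size \<open>1 / m ^ 6\<close>, and
      there are \<open>m ^ 5\<close> steps.\<close>
    also have "\<dots> \<le> (\<Sum>j<m^5. 5 * K * (1 / real m ^ 6))"
    proof (rule order_trans[OF sum_abs], rule sum_mono)
      fix j
      have "mesh m (Suc j) - mesh m j = (1 / real m ^ 2) ^ 2"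
        using m by (simp add: add_divide_distrib power_divide power_mult[symmetric])
      then have "sqrt (mesh m (Suc j) - mesh m j) = 1 / real m ^ 2" by (simp only: real_sqrt_abs) simp
      then have "sqrt (mesh m (Suc j) - mesh m j) ^ 3 = 1 / real m ^ 6"
        by (simp add: power_divide power_mult[symmetric])
      then show "\<bar>expectation (?D j)\<bar> \<le> 5 * K * (1 / real m ^ 6)"
        using step_bound[OF f B p K lt, of j] by simp
    qed
    also have "\<dots> = real m ^ 5 * (5 * K / (real m * real m ^ 5))" by (simp flip: power_Suc)
    also have "\<dots> = 5 * K / real m" using m by simp
    finally show ?thesis .
  qed
  have "(\<lambda>m. 5 * K / real m) \<longlonglongrightarrow> 0" by real_asymp
  then have "(\<lambda>m. expectation (\<lambda>\<omega>. f (Zs m \<omega>)) - f x) \<longlonglongrightarrow> 0"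
    by (rule Lim_null_comparison[rotated])
       (use bound in \<open>auto intro!: eventually_sequentiallyI[of 1]\<close>)
  then have 1: "(\<lambda>m. expectation (\<lambda>\<omega>. f (Zs m \<omega>))) \<longlonglongrightarrow> f x" by (simp add: LIM_zero_iff)
  have 2: "(\<lambda>m. expectation (\<lambda>\<omega>. f (Zs m \<omega>))) \<longlonglongrightarrow> expectation (\<lambda>\<omega>. f (Z \<omega>))"
  proof (rule integral_dominated_convergence[where w = "\<lambda>_. B"])
    show "AE \<omega> in M. (\<lambda>m. f (Zs m \<omega>)) \<longlonglongrightarrow> f (Z \<omega>)"
      using AE_T_finite AE_space
    proof eventually_elim
      case (elim \<omega>)
      show ?case
        by (rule continuous_on_tendsto_compose[OF cont Zs_tendsto]) (use elim in auto)
    qed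
  qed (use B in auto)
  from LIMSEQ_unique[OF 2 1] show ?thesis .
qed

end

section \<open>The gambler's ruin walk\<close>

abbreviation "rounds \<equiv> stream_space (measure_pmf round_pmf)"

lemma prob_space_rounds: "prob_space rounds"
  by (rule prob_space.prob_space_stream_space) (rule measure_pmf.prob_space_axioms)

lemma space_rounds [simp]: "space rounds = UNIV"
  by (simp add: space_stream_space)

lemma expectation_round_pmf:
  fixes g :: "round \<Rightarrow> real"
  shows "measure_pmf.expectation round_pmf g =
    (g ((1, 2), True) + g ((1, 2), False) + g ((1, 3), True) + g ((1, 3), False)
      + g ((2, 3), True) + g ((2, 3), False)) / 6"
proof -
  let ?A = "{(1, 2), (1, 3), (2, 3)} :: (nat \<times> nat) set"
  have "measure_pmf.expectation round_pmf g = (\<Sum>r\<in>?A \<times> UNIV. g r * pmf round_pmf r)"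
    by (rule integral_measure_pmf_real) (auto simp: round_pmf_def)
  also have "\<dots> = (\<Sum>q\<in>?A. \<Sum>b\<in>UNIV. g (q, b) * pmf round_pmf (q, b))"
    by (simp add: sum.cartesian_product)
  finally show ?thesis
    by (simp add: round_pmf_def pmf_pair UNIV_bool field_simps)
qed

lemma set_round_pmf: "set_pmf round_pmf = {(1, 2), (1, 3), (2, 3)} \<times> UNIV"
  by (auto simp: round_pmf_def)

lemma capitals_at_Stream: "capitals_at c (r ## \<omega>) (Suc k) = capitals_at (play_round r c) \<omega> k"
  by (induction k) auto

text \<open>The state type is uncountable, but each state is a discrete function of the previous one
  and of one of countably many rounds, so the discrete sigma-algebra works.\<close>

lemma measurable_capitals_at [measurable]:
  "(\<lambda>\<omega>. capitals_at c \<omega> k) \<in> rounds \<rightarrow>\<^sub>M count_space UNIV"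
proof (induction k)
  case (Suc k)
  have "(\<lambda>\<omega>. (\<lambda>r. play_round r (capitals_at c \<omega> k)) (\<omega> !! k)) \<in> rounds \<rightarrow>\<^sub>M count_space UNIV"
  proof (rule measurable_compose_countable[where f = "\<lambda>r \<omega>. play_round r (capitals_at c \<omega> k)"])
    show "(\<lambda>\<omega>. play_round r (capitals_at c \<omega> k)) \<in> rounds \<rightarrow>\<^sub>M count_space UNIV" for r
      by (rule measurable_compose[OF Suc]) simp
    have "(\<lambda>\<omega>. \<omega> !! k) \<in> rounds \<rightarrow>\<^sub>M measure_pmf round_pmf" by (rule measurable_snth)
    then show "(\<lambda>\<omega>. \<omega> !! k) \<in> rounds \<rightarrow>\<^sub>M count_space UNIV"
      by (simp add: measurable_cong_sets[OF refl sets_measure_pmf_count_space[symmetric]])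
  qed
  then show ?case by simp
qed simp

lemma elim_time_less_iff: "elim_time c \<omega> i < enat k \<longleftrightarrow> (\<exists>j<k. capitals_at c \<omega> j i = 0)"
  unfolding elim_time_def Inf_less_iff by auto

lemma elim_time_eq_iff:
  "elim_time c \<omega> i = enat k \<longleftrightarrow> capitals_at c \<omega> k i = 0 \<and> (\<forall>j<k. capitals_at c \<omega> j i \<noteq> 0)"
proof
  assume eq: "elim_time c \<omega> i = enat k"
  have "elim_time c \<omega> i < enat (Suc k)" using eq by simp
  then obtain j where j: "j < Suc k" "capitals_at c \<omega> j i = 0" unfolding elim_time_less_iff by blast
  have no: "\<forall>j<k. capitals_at c \<omega> j i \<noteq> 0"
    using eq elim_time_less_iff[of c \<omega> i k] by auto
  then have "j = k" using j less_Suc_eq by blast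
  then show "capitals_at c \<omega> k i = 0 \<and> (\<forall>j<k. capitals_at c \<omega> j i \<noteq> 0)" using j no by blast
next
  assume *: "capitals_at c \<omega> k i = 0 \<and> (\<forall>j<k. capitals_at c \<omega> j i \<noteq> 0)"
  show "elim_time c \<omega> i = enat k"
  proof (rule antisym)
    show "elim_time c \<omega> i \<le> enat k" unfolding elim_time_def using * by (intro Inf_lower) auto
    show "enat k \<le> elim_time c \<omega> i" using * elim_time_less_iff[of c \<omega> i k] by (auto simp: not_less[symmetric])
  qed
qed

lemma elimination_order_iff:
  "elimination_order c \<omega> \<sigma> \<longleftrightarrow> (\<exists>k. (\<exists>j<k. capitals_at c \<omega> j (\<sigma> ! 0) = 0) \<and>
      capitals_at c \<omega> k (\<sigma> ! 1) = 0 \<and> (\<forall>j<k. capitals_at c \<omega> j (\<sigma> ! 1) \<noteq> 0) \<and>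
      capitals_at c \<omega> k (\<sigma> ! 2) = (\<Sum>i\<in>{1, 2, 3}. c i))"
  unfolding elimination_order_def elim_time_less_iff elim_time_eq_iff by simp

lemma measurable_elimination_order [measurable]: "Measurable.pred rounds (\<lambda>\<omega>. elimination_order c \<omega> \<sigma>)"
proof -
  have [measurable]: "Measurable.pred rounds (\<lambda>\<omega>. P (capitals_at c \<omega> k))" for P k
    by (rule measurable_compose[OF measurable_capitals_at]) simp
  have [measurable]: "Measurable.pred rounds (\<lambda>\<omega>. capitals_at c \<omega> k i = n)" for k i n
    by measurable
  show ?thesis unfolding elimination_order_iff by measurable
qed

text \<open>Allows arbitrary states, including those with eliminated players, so that it can be
  followed along the game.\<close>

definition order_prob :: "capitals \<Rightarrow> nat list \<Rightarrow> real" where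
  "order_prob c \<sigma> = measure rounds {\<omega>. elimination_order c \<omega> \<sigma>}"

lemma elimination_prob_eq: "elimination_prob A B C \<sigma> = order_prob (init_capitals A B C) \<sigma>"
  by (simp add: elimination_prob_def order_prob_def)

lemma order_prob_01: "0 \<le> order_prob c \<sigma>" "order_prob c \<sigma> \<le> 1"
  unfolding order_prob_def by (simp_all add: prob_space.prob_le_1[OF prob_space_rounds])

text \<open>The tail of the stream is independent of the first round and has the law of the whole
  stream; \<open>Q r\<close> is the event seen from the tail.\<close>

lemma prob_first_step:
  assumes [measurable]: "Measurable.pred rounds P"
    and step: "\<And>r \<omega>. r \<in> set_pmf round_pmf \<Longrightarrow> P (r ## \<omega>) \<longleftrightarrow> Q r \<omega>"
  shows "measure rounds {\<omega>. P \<omega>} = measure_pmf.expectation round_pmf (\<lambda>r. measure rounds {\<omega>. Q r \<omega>})"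
proof -
  interpret R: prob_space rounds by (rule prob_space_rounds)
  have ev: "{\<omega> \<in> space rounds. P \<omega>} \<in> sets rounds" by measurable
  have "ennreal (measure rounds {\<omega>. P \<omega>}) = (\<integral>\<^sup>+r. ennreal (measure rounds {\<omega>. P (r ## \<omega>)}) \<partial>measure_pmf round_pmf)"
    using prob_space.prob_stream_space[OF measure_pmf.prob_space_axioms[of round_pmf] ev] by simp
  also have "\<dots> = (\<integral>\<^sup>+r. ennreal (measure rounds {\<omega>. Q r \<omega>}) \<partial>measure_pmf round_pmf)"
    by (rule nn_integral_cong_AE) (simp add: AE_measure_pmf_iff step)
  also have "\<dots> = ennreal (measure_pmf.expectation round_pmf (\<lambda>r. measure rounds {\<omega>. Q r \<omega>}))"
    by (rule nn_integral_eq_integral)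
       (auto intro!: measure_pmf.integrable_const_bound[where B = 1])
  finally show ?thesis by (subst (asm) ennreal_inj) (auto intro!: integral_nonneg_AE)
qed

section \<open>Elimination orders: first step, impossible orders, two players\<close>

definition all_alive :: "capitals \<Rightarrow> bool" where "all_alive c \<longleftrightarrow> 0 < c 1 \<and> 0 < c 2 \<and> 0 < c 3"

lemma alive_eq: "alive c = (if 0 < c 1 then {1} else {}) \<union> (if 0 < c 2 then {2} else {}) \<union> (if 0 < c 3 then {3} else {})"
  by (auto simp: alive_def)

lemma card_alive_3: "card (alive c) = 3 \<longleftrightarrow> all_alive c"
  unfolding alive_eq all_alive_def by simp

lemma play_round_all_alive: "all_alive c \<Longrightarrow> play_round r c = transfer (fst r) (snd r) c"
  by (simp add: play_round_def card_alive_3)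

lemma play_round_mono_alive:
  assumes "\<not> all_alive c" "i \<in> {1, 2, 3}" "c i = 0"
  shows "play_round r c i = 0"
proof (cases "card (alive c) = 2")
  case True
  have fin: "finite (alive c)" "alive c \<noteq> {}"
    using True by (auto intro: card_ge_0_finite)
  have "Min (alive c) \<noteq> i" "Max (alive c) \<noteq> i"
    using Min_in[OF fin] Max_in[OF fin] assms(3) by (auto simp: alive_def)
  then show ?thesis using True assms(3) by (auto simp: play_round_def transfer_def)
next
  case False
  then show ?thesis using assms by (auto simp: play_round_def card_alive_3)
qed

lemma capitals_at_dead:
  assumes "\<not> all_alive c" "i \<in> {1, 2, 3}" "c i = 0"
  shows "\<not> all_alive (capitals_at c \<omega> k) \<and> capitals_at c \<omega> k i = 0"
proof (induction k)
  case (Suc k)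
  then have "capitals_at c \<omega> (Suc k) i = 0"
    using play_round_mono_alive[of "capitals_at c \<omega> k" i] assms(2) by simp
  then show ?case using assms(2) unfolding all_alive_def by fastforce
qed (use assms in auto)

text \<open>Nobody is eliminated at time 0, so a shift by one round matches the witnessing times on
  both sides; the total capital that the winner must reach is preserved by the round.\<close>

lemma order_prob_first_step:
  assumes c: "all_alive c" and \<sigma>: "\<sigma> = [3, 2, 1] \<or> \<sigma> = [3, 1, 2]"
  shows "order_prob c \<sigma> = measure_pmf.expectation round_pmf (\<lambda>r. order_prob (play_round r c) \<sigma>)"
  unfolding order_prob_def
proof (rule prob_first_step)
  fix r :: round and \<omega> assume r: "r \<in> set_pmf round_pmf"
  have sum: "(\<Sum>i\<in>{1, 2, 3}. play_round r c i) = (\<Sum>i\<in>{1, 2, 3}. c i)"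
    using r c unfolding set_round_pmf play_round_all_alive[OF c]
    by (cases "snd r") (auto simp: transfer_def all_alive_def)
  have nz: "c (\<sigma> ! 0) \<noteq> 0" "c (\<sigma> ! 1) \<noteq> 0" using \<sigma> c by (auto simp: all_alive_def)
  let ?cap = "capitals_at c (r ## \<omega>)" and ?cap' = "capitals_at (play_round r c) \<omega>"
  have S: "?cap (Suc k) = ?cap' k" for k by (rule capitals_at_Stream)
  let ?E = "\<lambda>X k. (\<exists>j<k. X j (\<sigma> ! 0) = 0) \<and> X k (\<sigma> ! 1) = 0 \<and> (\<forall>j<k. X j (\<sigma> ! 1) \<noteq> 0) \<and> X k (\<sigma> ! 2) = (\<Sum>i\<in>{1, 2, 3}. c i)"
  show "elimination_order c (r ## \<omega>) \<sigma> \<longleftrightarrow> elimination_order (play_round r c) \<omega> \<sigma>"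
    unfolding elimination_order_iff sum
  proof
    assume "\<exists>k. ?E ?cap k"
    then obtain k j where k: "j < k" "?cap j (\<sigma> ! 0) = 0" "?cap k (\<sigma> ! 1) = 0" "\<forall>j<k. ?cap j (\<sigma> ! 1) \<noteq> 0"
      "?cap k (\<sigma> ! 2) = (\<Sum>i\<in>{1, 2, 3}. c i)" by blast
    obtain k' where k': "k = Suc k'" using k(1) by (cases k) auto
    obtain j' where j': "j = Suc j'" using k(2) nz(1) by (cases j) auto
    have "\<forall>l<k'. ?cap' l (\<sigma> ! 1) \<noteq> 0" using k(4) unfolding k' S[symmetric] by auto
    then show "\<exists>k. ?E ?cap' k"
      using k unfolding k' j' S by (intro exI[of _ k']) auto
  next
    assume "\<exists>k. ?E ?cap' k"
    then obtain k j where k: "j < k" "?cap' j (\<sigma> ! 0) = 0" "?cap' k (\<sigma> ! 1) = 0" "\<forall>j<k. ?cap' j (\<sigma> ! 1) \<noteq> 0"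
      "?cap' k (\<sigma> ! 2) = (\<Sum>i\<in>{1, 2, 3}. c i)" by blast
    have "?cap l (\<sigma> ! 1) \<noteq> 0" if "l < Suc k" for l
      using that k(4) nz(2) by (cases l) (auto simp: S simp del: capitals_at.simps(2))
    then show "\<exists>k. ?E ?cap k"
      using k unfolding S[symmetric] by (intro exI[of _ "Suc k"] conjI exI[of _ "Suc j"]) auto
  qed
qed measurable

text \<open>The second player of the order must have capital at time 0, since the second elimination
  comes strictly after the first. The missing player is then the supposed winner, who can never
  recover, while the total is positive because of player 3.\<close>

lemma order_prob_dead_other:
  assumes "c 3 \<noteq> 0" "\<not> all_alive c" and \<sigma>: "\<sigma> = [3, 2, 1] \<or> \<sigma> = [3, 1, 2]"
  shows "order_prob c \<sigma> = 0"
proof -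
  have "\<not> elimination_order c \<omega> \<sigma>" for \<omega>
  proof
    assume "elimination_order c \<omega> \<sigma>"
    then obtain k j where k: "j < k" "capitals_at c \<omega> k (\<sigma> ! 1) = 0" "\<forall>j<k. capitals_at c \<omega> j (\<sigma> ! 1) \<noteq> 0"
      "capitals_at c \<omega> k (\<sigma> ! 2) = (\<Sum>i\<in>{1, 2, 3}. c i)"
      unfolding elimination_order_iff by blast
    have "c (\<sigma> ! 1) \<noteq> 0" using k(3)[rule_format, of 0] k(1) by simp
    then have "c (\<sigma> ! 2) = 0" "\<sigma> ! 2 \<in> {1, 2, 3}" using assms by (auto simp: all_alive_def)
    from capitals_at_dead[OF assms(2) this(2,1)] k(4) assms(1) show False by simp
  qed
  then show ?thesis by (simp add: order_prob_def)
qed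

lemma play_round_two:
  assumes "0 < c 1" "0 < c 2" "c 3 = 0"
  shows "play_round r c = (if snd r then c(1 := c 1 - 1, 2 := c 2 + 1) else c(1 := c 1 + 1, 2 := c 2 - 1))"
proof -
  have al: "alive c = {1, 2}" using assms unfolding alive_eq by (simp add: insert_commute)
  have "Min {1, 2 :: nat} = 1" "Max {1, 2 :: nat} = 2" "card {1, 2 :: nat} = 2" by simp_all
  then show ?thesis by (simp only: play_round_def al transfer_def) simp
qed

lemma play_round_one:
  assumes "c i = 0" "c j = 0" "{i, j} \<subseteq> {1, 2, 3}" "i \<noteq> j"
  shows "play_round r c = c"
proof -
  have "alive c \<subseteq> {1, 2, 3} - {i, j}" using assms by (auto simp: alive_def)
  then have "card (alive c) \<le> card ({1, 2, 3} - {i, j})" by (intro card_mono) auto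
  also have "\<dots> = 1" using assms by (auto simp: insert_Diff_if)
  finally show ?thesis by (simp add: play_round_def)
qed

lemma capitals_at_two_sum:
  assumes "c 3 = 0"
  shows "capitals_at c \<omega> k 3 = 0 \<and> capitals_at c \<omega> k 1 + capitals_at c \<omega> k 2 = c 1 + c 2"
proof (induction k)
  case (Suc k)
  let ?d = "capitals_at c \<omega> k"
  consider "0 < ?d 1 \<and> 0 < ?d 2" | "?d 1 = 0" | "?d 2 = 0" by auto
  then show ?case
  proof cases
    case 1
    then show ?thesis using Suc by (auto simp: play_round_two)
  next
    case 2
    then show ?thesis using Suc play_round_one[of ?d 1 3] by simp
  next
    case 3
    then show ?thesis using Suc play_round_one[of ?d 2 3] by simp
  qed
qed (use assms in simp)

text \<open>The increments of \<open>h\<close> are constant, equal to \<open>h 1\<close>, and the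
  boundary value at \<open>N\<close> fixes them.\<close>

lemma linear_of_discrete_harmonic:
  fixes h :: "nat \<Rightarrow> real"
  assumes "h 0 = 0" "h N = 1" "N > 0" and harm: "\<And>a. 0 < a \<Longrightarrow> a < N \<Longrightarrow> h a = (h (a - 1) + h (a + 1)) / 2"
    and a: "a \<le> N"
  shows "h a = real a / real N"
proof -
  have lin: "h a = real a * h 1 \<and> (a < N \<longrightarrow> h (Suc a) = real (Suc a) * h 1)" if "a \<le> N" for a
    using that
  proof (induction a)
    case (Suc a)
    then have IH: "h a = real a * h 1" "h (Suc a) = real (Suc a) * h 1" by auto
    show ?case
    proof (intro conjI impI)
      assume "Suc a < N"
      then have "h (Suc a) = (h a + h (Suc (Suc a))) / 2" using harm[of "Suc a"] by simp
      then have "h (Suc (Suc a)) = 2 * h (Suc a) - h a" by simp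
      then show "h (Suc (Suc a)) = real (Suc (Suc a)) * h 1" unfolding IH by (simp add: algebra_simps)
    qed (use IH in simp)
  qed (use assms(1) in simp)
  have "h 1 = 1 / real N" using lin[of N] assms(2,3) by (simp add: field_simps)
  then show ?thesis using lin[OF a] by simp
qed

text \<open>The classical fair ruin problem: player 3 is out at time 0, so the order occurs iff
  player \<open>i\<close> is ever ruined, in which case \<open>j\<close> holds everything. That
  probability is discrete harmonic in the capital of \<open>j\<close>.\<close>

lemma order_prob_two:
  assumes c: "0 < c 1" "0 < c 2" "c 3 = 0"
    and ij: "(i = 2 \<and> j = 1) \<or> (i = 1 \<and> j = (2::nat))"
  shows "order_prob c [3, i, j] = real (c j) / real (c 1 + c 2)"
proof -
  have ij': "i \<noteq> j" "i \<noteq> 3" "j \<noteq> 3" "{i, j} = {1, 2}" using ij by auto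
  define N where "N = c 1 + c 2"
  have N: "N > 0" "c i + c j = N" using c ij by (auto simp: N_def)
  define st where "st a = c(j := a, i := N - a)" for a
  have st: "st a j = a" "st a i = N - a" "st a 3 = 0" for a using ij' c by (auto simp: st_def)
  have st_c: "st (c j) = c" using N by (auto simp: st_def fun_eq_iff)
  define h where "h a = measure rounds {\<omega>. \<exists>k. capitals_at (st a) \<omega> k i = 0}" for a
  have hm: "Measurable.pred rounds (\<lambda>\<omega>. \<exists>k. capitals_at d \<omega> k i = 0)" for d
  proof -
    have [measurable]: "Measurable.pred rounds (\<lambda>\<omega>. capitals_at d \<omega> k i = 0)" for k
      by (rule measurable_compose[OF measurable_capitals_at]) simp
    show ?thesis by measurable
  qed
  have "elimination_order c \<omega> [3, i, j] \<longleftrightarrow> (\<exists>k. capitals_at c \<omega> k i = 0)" for \<omega>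
  proof
    assume "\<exists>k. capitals_at c \<omega> k i = 0"
    then obtain k where k: "capitals_at c \<omega> k i = 0" "\<forall>l<k. capitals_at c \<omega> l i \<noteq> 0"
      using exists_least_iff[of "\<lambda>k. capitals_at c \<omega> k i = 0"] by blast
    \<comment> \<open>The first elimination must be strictly earlier than the second; player 3
      supplies time 0, and \<open>i\<close> starts with capital.\<close>
    have "0 < k" using k(1) ij c by (cases k) auto
    moreover have "capitals_at c \<omega> 0 3 = 0" using c by simp
    moreover have "capitals_at c \<omega> k j = c 1 + c 2"
      using capitals_at_two_sum[where c = c and \<omega> = \<omega> and k = k] c(3) k(1) ij by auto
    ultimately show "elimination_order c \<omega> [3, i, j]"
      unfolding elimination_order_iff using k c by (intro exI[of _ k] conjI exI[of _ 0]) auto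
  qed (auto simp: elimination_order_iff)
  then have "order_prob c [3, i, j] = h (c j)" by (simp add: order_prob_def h_def st_c)
  also have "h (c j) = real (c j) / real N"
  proof (rule linear_of_discrete_harmonic)
    have frozen: "capitals_at (st 0) \<omega> k = st 0" for \<omega> k
    proof (induction k)
      case (Suc k)
      have "play_round (\<omega> !! k) (st 0) = st 0"
        by (rule play_round_one[of _ j 3]) (use st ij in auto)
      then show ?case using Suc by simp
    qed simp
    then show "h 0 = 0" using N by (simp add: h_def st)
    have "\<exists>k. capitals_at (st N) \<omega> k i = 0" for \<omega> by (rule exI[of _ 0]) (simp add: st)
    then show "h N = 1"
      using prob_space.prob_space[OF prob_space_rounds] by (simp add: h_def)
    fix a assume a: "0 < a" "a < N"
    have pos: "0 < st a 1" "0 < st a 2" using a st[of a] ij by auto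
    \<comment> \<open>Heads make player 1 pay, so which side of the coin hurts \<open>j\<close>
      depends on whether \<open>j\<close> is player 1.\<close>
    have step: "play_round r (st a) = (if snd r \<longleftrightarrow> j = 1 then st (a - 1) else st (a + 1))" for r
      unfolding play_round_two[OF pos st(3)] using ij a
      by (elim disjE conjE) (simp_all add: st_def fun_upd_twist Suc_diff_Suc Suc_diff_le)
    have "h a = measure_pmf.expectation round_pmf (\<lambda>r. measure rounds {\<omega>. \<exists>k. capitals_at (play_round r (st a)) \<omega> k i = 0})"
      unfolding h_def
    proof (rule prob_first_step[OF hm])
      fix r \<omega>
      show "(\<exists>k. capitals_at (st a) (r ## \<omega>) k i = 0) \<longleftrightarrow> (\<exists>k. capitals_at (play_round r (st a)) \<omega> k i = 0)"
      proof
        assume "\<exists>k. capitals_at (st a) (r ## \<omega>) k i = 0"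
        then obtain k where k: "capitals_at (st a) (r ## \<omega>) k i = 0" by blast
        then obtain k' where "k = Suc k'" using st(2)[of a] a by (cases k) auto
        then show "\<exists>k. capitals_at (play_round r (st a)) \<omega> k i = 0" using k capitals_at_Stream by metis
      qed (metis capitals_at_Stream)
    qed
    also have "\<dots> = measure_pmf.expectation round_pmf (\<lambda>r. if snd r \<longleftrightarrow> j = 1 then h (a - 1) else h (a + 1))"
      by (intro Bochner_Integration.integral_cong refl) (simp add: step h_def)
    also have "\<dots> = (h (a - 1) + h (a + 1)) / 2"
      unfolding expectation_round_pmf by (cases "j = 1") simp_all
    finally show "h a = (h (a - 1) + h (a + 1)) / 2" .
  qed (use N c ij in \<open>auto simp: N_def\<close>)
  finally show ?thesis by (simp add: N_def)
qed

section \<open>The embedded walk, stopped at the first elimination\<close>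

definition emb :: "nat \<Rightarrow> capitals \<Rightarrow> real \<times> real" where
  "emb N c = ((real (c 2) - real (c 1)) / real N, sqrt 3 * real (c 3) / real N)"

text \<open>At most one player is out. The walk stops at the first elimination and one transfer
  ruins at most one player, so this is invariant and keeps the walk off the vertices.\<close>

definition valid :: "nat \<Rightarrow> capitals \<Rightarrow> bool" where
  "valid N c \<longleftrightarrow> c 1 + c 2 + c 3 = N \<and> (c 1 = 0 \<longrightarrow> 0 < c 2 \<and> 0 < c 3) \<and>
     (c 2 = 0 \<longrightarrow> 0 < c 1 \<and> 0 < c 3) \<and> (c 3 = 0 \<longrightarrow> 0 < c 1 \<and> 0 < c 2)"

lemma bary_emb:
  assumes "c 1 + c 2 + c 3 = N" "N > 0"
  shows "ba (emb N c) = real (c 1) / real N" "bb (emb N c) = real (c 2) / real N" "bc (emb N c) = real (c 3) / real N"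
proof -
  have "real N = real (c 1) + real (c 2) + real (c 3)" using assms(1) by (metis of_nat_add)
  then have sum: "real (c 1) / real N + real (c 2) / real N + real (c 3) / real N = 1"
    using assms(2) by (simp flip: add_divide_distrib)
  have fst: "fst (emb N c) = real (c 2) / real N - real (c 1) / real N"
    by (simp add: emb_def diff_divide_distrib)
  have snd: "snd (emb N c) / sqrt 3 = real (c 3) / real N" by (simp add: emb_def)
  have lin: "p + q + r = 1 \<Longrightarrow> (1 - (q - p) - r) / 2 = p" "p + q + r = 1 \<Longrightarrow> (1 + (q - p) - r) / 2 = q"
    for p q r :: real by (simp_all add: field_simps)
  show "ba (emb N c) = real (c 1) / real N" unfolding ba_def fst snd by (rule lin(1)[OF sum])
  show "bb (emb N c) = real (c 2) / real N" unfolding bb_def fst snd by (rule lin(2)[OF sum])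
  show "bc (emb N c) = real (c 3) / real N" unfolding bc_def by (rule snd)
qed

lemma valid_pos: "valid N c \<Longrightarrow> N > 0"
  by (auto simp: valid_def)

lemma emb_triangle:
  assumes "valid N c"
  shows "emb N c \<in> triangle"
  using bary_emb[of c N] valid_pos[OF assms] assms by (simp add: valid_def triangle_eq)

lemma emb_frontier:
  assumes "valid N c"
  shows "emb N c \<in> frontier triangle \<longleftrightarrow> \<not> all_alive c"
  using bary_emb[of c N] valid_pos[OF assms] assms by (auto simp: valid_def frontier_triangle all_alive_def)

lemma emb_V3:
  assumes "valid N c"
  shows "emb N c \<in> V3 \<longleftrightarrow> c 3 = 0"
  using bary_emb[of c N] valid_pos[OF assms] assms by (simp add: valid_def V3_eq)

text \<open>The game is frozen at the first elimination, so that its final positions lie on the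
  frontier. The play of the remaining two enters through the values of \<open>order_prob\<close>
  there.\<close>

definition walk_step :: "capitals \<Rightarrow> capitals pmf" where
  "walk_step c = (if all_alive c then map_pmf (\<lambda>r. play_round r c) round_pmf else return_pmf c)"

primrec walk :: "capitals \<Rightarrow> nat \<Rightarrow> capitals pmf" where
  "walk c 0 = return_pmf c"
| "walk c (Suc k) = bind_pmf (walk c k) walk_step"

lemma finite_walk_step: "finite (set_pmf (walk_step c))"
  by (simp add: walk_step_def set_round_pmf)

lemma finite_walk [simp]: "finite (set_pmf (walk c k))"
  by (induction k) (auto simp: finite_walk_step)

lemma expectation_walk_Suc:
  fixes F :: "capitals \<Rightarrow> real"
  shows "measure_pmf.expectation (walk c (Suc k)) F =
    measure_pmf.expectation (walk c k) (\<lambda>d. measure_pmf.expectation (walk_step d) F)"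
proof -
  have "measure_pmf.expectation (walk c (Suc k)) F
      = (\<Sum>a\<in>set_pmf (walk c k). pmf (walk c k) a *\<^sub>R measure_pmf.expectation (walk_step a) F)"
    unfolding walk.simps by (rule pmf_expectation_bind) (auto simp: finite_walk_step)
  also have "\<dots> = measure_pmf.expectation (walk c k) (\<lambda>d. measure_pmf.expectation (walk_step d) F)"
    by (subst integral_measure_pmf_real[of "set_pmf (walk c k)"]) (auto simp: mult.commute)
  finally show ?thesis .
qed

lemma expectation_walk_step:
  fixes F :: "capitals \<Rightarrow> real"
  shows "measure_pmf.expectation (walk_step c) F =
    (if all_alive c then measure_pmf.expectation round_pmf (\<lambda>r. F (play_round r c)) else F c)"
  by (simp add: walk_step_def)

lemma valid_walk_step: "valid N c \<Longrightarrow> d \<in> set_pmf (walk_step c) \<Longrightarrow> valid N d"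
proof (cases "all_alive c")
  case True
  assume "valid N c" "d \<in> set_pmf (walk_step c)"
  then obtain r where r: "r \<in> set_pmf round_pmf" "d = transfer (fst r) (snd r) c"
    using True by (auto simp: walk_step_def play_round_all_alive)
  then show "valid N d"
    using True \<open>valid N c\<close> unfolding set_round_pmf
    by (cases "snd r") (auto simp: transfer_def valid_def all_alive_def)
qed (simp add: walk_step_def)

lemma valid_walk: "valid N c \<Longrightarrow> d \<in> set_pmf (walk c k) \<Longrightarrow> valid N d"
  by (induction k arbitrary: d) (auto intro: valid_walk_step)

lemma integrable_walk [simp]: "integrable (measure_pmf (walk c k)) (F :: capitals \<Rightarrow> real)"
  by (rule integrable_measure_pmf_finite) simp

text \<open>The six increments have length \<open>2 / N\<close> and point to the corners of a
  regular hexagon, which is why the walk is isotropic to second order.\<close>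

lemma emb_step:
  assumes "all_alive c" "N > 0"
  defines "h \<equiv> 1 / real N"
  shows "measure_pmf.expectation round_pmf (\<lambda>r. F (emb N (play_round r c)) :: real) =
    (F (emb N c + (2 * h, 0)) + F (emb N c + (-2 * h, 0)) + F (emb N c + (h, sqrt 3 * h)) + F (emb N c + (-h, - sqrt 3 * h))
     + F (emb N c + (-h, sqrt 3 * h)) + F (emb N c + (h, - sqrt 3 * h))) / 6"
proof -
  have pos: "1 \<le> c 1" "1 \<le> c 2" "1 \<le> c 3" using assms(1) by (auto simp: all_alive_def)
  have e: "emb N (play_round ((1, 2), True) c) = emb N c + (2 * h, 0)"
    "emb N (play_round ((1, 2), False) c) = emb N c + (-2 * h, 0)"
    "emb N (play_round ((1, 3), True) c) = emb N c + (h, sqrt 3 * h)"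
    "emb N (play_round ((1, 3), False) c) = emb N c + (-h, - sqrt 3 * h)"
    "emb N (play_round ((2, 3), True) c) = emb N c + (-h, sqrt 3 * h)"
    "emb N (play_round ((2, 3), False) c) = emb N c + (h, - sqrt 3 * h)"
    unfolding play_round_all_alive[OF assms(1)] using pos
    by (auto simp: transfer_def emb_def h_def of_nat_diff add_divide_distrib diff_divide_distrib algebra_simps)
  show ?thesis unfolding expectation_round_pmf e ..
qed

text \<open>Each round with three players raises the expected squared norm by the squared step
  length \<open>4 / N^2\<close>, while the triangle is bounded. This bounds the expected number of
  such rounds.\<close>

lemma walk_alive_sum:
  assumes v: "valid N c" and D: "\<And>z. z \<in> triangle \<Longrightarrow> (norm z)\<^sup>2 \<le> D"
  shows "(\<Sum>k<n. measure_pmf.prob (walk c k) {d. all_alive d}) \<le> D * real N ^ 2 / 4"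
proof -
  have N: "N > 0" by (rule valid_pos[OF v])
  define V where "V d = (norm (emb N d))\<^sup>2" for d
  have step: "measure_pmf.expectation (walk_step d) V = V d + 4 / real N ^ 2 * indicator {d. all_alive d} d" for d
  proof (cases "all_alive d")
    case True
    obtain a b where ab: "emb N d = (a, b)" by (cases "emb N d")
    have nn: "(norm (u, v))\<^sup>2 = u\<^sup>2 + v\<^sup>2" for u v :: real by (simp add: norm_prod_def)
    have "measure_pmf.expectation (walk_step d) V = measure_pmf.expectation round_pmf (\<lambda>r. (\<lambda>z. (norm z)\<^sup>2) (emb N (play_round r d)))"
      using True by (simp add: expectation_walk_step V_def)
    also have "\<dots> = a\<^sup>2 + b\<^sup>2 + 4 / real N ^ 2"
      unfolding emb_step[OF True N, where F = "\<lambda>z. (norm z)\<^sup>2"] ab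
      by (simp add: nn) (simp add: power2_eq_square algebra_simps)
    finally show ?thesis using True by (simp add: V_def ab nn)
  qed (simp add: expectation_walk_step)
  have "measure_pmf.expectation (walk c n) V = V c + 4 / real N ^ 2 * (\<Sum>k<n. measure_pmf.prob (walk c k) {d. all_alive d})"
  proof (induction n)
    case (Suc n)
    have "measure_pmf.expectation (walk c (Suc n)) V = measure_pmf.expectation (walk c n) (\<lambda>d. V d + 4 / real N ^ 2 * indicator {d. all_alive d} d)"
      unfolding expectation_walk_Suc step ..
    also have "\<dots> = measure_pmf.expectation (walk c n) V + 4 / real N ^ 2 * measure_pmf.prob (walk c n) {d. all_alive d}"
      by simp
    finally show ?case using Suc by (simp add: algebra_simps)
  qed simp
  moreover have "measure_pmf.expectation (walk c n) V \<le> measure_pmf.expectation (walk c n) (\<lambda>_. D)"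
    by (rule integral_mono_AE) (auto simp: AE_measure_pmf_iff V_def intro!: D emb_triangle valid_walk[OF v])
  moreover have "V c \<ge> 0" by (simp add: V_def)
  ultimately have "4 / real N ^ 2 * (\<Sum>k<n. measure_pmf.prob (walk c k) {d. all_alive d}) \<le> D" by simp
  then show ?thesis using N by (simp add: field_simps)
qed

lemma triangle_norm_bound: obtains D where "D > 0" "\<And>z. z \<in> triangle \<Longrightarrow> (norm z)\<^sup>2 \<le> D"
proof -
  obtain B where B: "B > 0" "\<And>z. z \<in> triangle \<Longrightarrow> norm z \<le> B"
    using compact_imp_bounded[OF compact_triangle] bounded_pos by blast
  show ?thesis
    by (rule that[of "B\<^sup>2"]) (use B in \<open>auto intro!: power_mono\<close>)
qed

text \<open>Otherwise the sums bounded in \<open>walk_alive_sum\<close> would grow linearly.\<close>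

lemma walk_absorbed:
  assumes v: "valid N c" and \<epsilon>: "\<epsilon> > 0"
  obtains k where "measure_pmf.prob (walk c k) {d. all_alive d} \<le> \<epsilon>"
proof -
  obtain D where D: "D > 0" "\<And>z. z \<in> triangle \<Longrightarrow> (norm z)\<^sup>2 \<le> D" using triangle_norm_bound by blast
  have "\<exists>k. measure_pmf.prob (walk c k) {d. all_alive d} \<le> \<epsilon>"
  proof (rule ccontr)
    assume "\<not> ?thesis"
    then have gt: "\<epsilon> \<le> measure_pmf.prob (walk c k) {d. all_alive d}" for k by (meson linear)
    obtain n :: nat where n: "D * real N ^ 2 / 4 / \<epsilon> < real n" using reals_Archimedean2 by blast
    have "real n * \<epsilon> = (\<Sum>k<n. \<epsilon>)" by simp
    also have "\<dots> \<le> (\<Sum>k<n. measure_pmf.prob (walk c k) {d. all_alive d})" by (intro sum_mono gt)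
    also have "\<dots> \<le> D * real N ^ 2 / 4" by (rule walk_alive_sum[OF v D(2)])
    finally show False using n \<epsilon> by (simp add: divide_less_eq)
  qed
  then show ?thesis using that by blast
qed

lemma abs_mean6_le:
  fixes M :: real
  assumes "\<bar>a\<bar> \<le> M" "\<bar>b\<bar> \<le> M" "\<bar>c\<bar> \<le> M" "\<bar>d\<bar> \<le> M" "\<bar>e\<bar> \<le> M" "\<bar>f\<bar> \<le> M"
  shows "\<bar>(a + b + c + d + e + f) / 6\<bar> \<le> M"
proof -
  have "\<bar>a + b + c + d + e + f\<bar> \<le> 6 * M" using assms by linarith
  then show ?thesis by simp
qed

text \<open>Each live round contributes an error of at most \<open>K\<close> times the cube of the
  step length \<open>2 / N\<close>, and by \<open>walk_alive_sum\<close> there are on average at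
  most \<open>D * N^2 / 4\<close> of them. The bound is uniform in the number of rounds.\<close>

lemma walk_expectation:
  assumes "iso_taylor triangle f"
  obtains C where "C \<ge> 0" "\<And>N c k. valid N c \<Longrightarrow>
    \<bar>measure_pmf.expectation (walk c k) (\<lambda>d. f (emb N d)) - f (emb N c)\<bar> \<le> C / real N"
proof -
  obtain p1 p2 q1 q2 K where K: "\<And>y u v. y \<in> triangle \<Longrightarrow> \<bar>f (y + (u, v)) - f y
           - (p1 y * u + p2 y * v + q1 y * (u\<^sup>2 - v\<^sup>2) + q2 y * (u * v))\<bar> \<le> K * norm (u, v) ^ 3"
    using assms unfolding iso_taylor_def by blast
  have "(-1, 0) \<in> triangle" by (simp add: triangle_eq bary_defs)
  from K[OF this, of 1 0] have K0: "K \<ge> 0"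
    using order_trans[OF abs_ge_zero] by (fastforce simp: norm_prod_def)
  obtain D where D: "D > 0" "\<And>z. z \<in> triangle \<Longrightarrow> (norm z)\<^sup>2 \<le> D" using triangle_norm_bound by blast
  have main: "\<bar>measure_pmf.expectation (walk c k) (\<lambda>d. f (emb N d)) - f (emb N c)\<bar> \<le> 2 * K * D / real N"
    if v: "valid N c" for N c k
  proof -
    have N: "N > 0" by (rule valid_pos[OF v])
    let ?F = "\<lambda>d. f (emb N d)"
    define e where "e d = measure_pmf.expectation (walk_step d) ?F - f (emb N d)" for d
    have step: "\<bar>e d\<bar> \<le> 8 * K / real N ^ 3 * indicator {d. all_alive d} d" if vd: "valid N d" for d
    proof (cases "all_alive d")
      case True
      define h where "h = 1 / real N"
      have h: "h > 0" using N by (simp add: h_def)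
      define y where "y = emb N d"
      have y: "y \<in> triangle" unfolding y_def by (rule emb_triangle[OF vd])
      let ?P = "\<lambda>u v. p1 y * u + p2 y * v + q1 y * (u\<^sup>2 - v\<^sup>2) + q2 y * (u * v)"
      have s3: "(sqrt 3 * h)\<^sup>2 = 3 * h\<^sup>2" by (simp add: power_mult_distrib)
      have n: "norm (2 * h, 0 :: real) = 2 * h" "norm (- 2 * h, 0 :: real) = 2 * h" "norm (h, sqrt 3 * h) = 2 * h"
         "norm (- h, - sqrt 3 * h) = 2 * h" "norm (- h, sqrt 3 * h) = 2 * h" "norm (h, - sqrt 3 * h) = 2 * h"
      proof -
        have "sqrt (4 * h\<^sup>2) = 2 * h" using h by (simp add: real_sqrt_mult)
        then show "norm (2 * h, 0 :: real) = 2 * h" "norm (- 2 * h, 0 :: real) = 2 * h" "norm (h, sqrt 3 * h) = 2 * h"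
         "norm (- h, - sqrt 3 * h) = 2 * h" "norm (- h, sqrt 3 * h) = 2 * h" "norm (h, - sqrt 3 * h) = 2 * h"
          using s3 h by (simp_all add: norm_prod_def)
      qed
      define R where "R u v = f (y + (u, v)) - f y - ?P u v" for u v
      have R: "\<bar>R u v\<bar> \<le> 8 * K * h ^ 3" if "norm (u, v) = 2 * h" for u v
        using K[OF y, of u v] unfolding R_def that by (simp add: power_mult_distrib)
      have fR: "f (y + (u, v)) = f y + ?P u v + R u v" for u v by (simp add: R_def)
      have "e d = measure_pmf.expectation round_pmf (\<lambda>r. f (emb N (play_round r d))) - f y"
        using True by (simp add: e_def expectation_walk_step y_def)
      \<comment> \<open>Over the six hexagon steps the linear, the trace-free and the mixed terms
        each sum to 0.\<close>
      also have "\<dots> = (R (2 * h) 0 + R (-2 * h) 0 + R h (sqrt 3 * h) + R (- h) (- sqrt 3 * h) + R (- h) (sqrt 3 * h) + R h (- sqrt 3 * h)) / 6"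
        unfolding emb_step[OF True N] y_def[symmetric] h_def[symmetric] fR
        using s3 by (simp add: algebra_simps)
      also have "\<bar>\<dots>\<bar> \<le> 8 * K * h ^ 3"
        by (rule abs_mean6_le[OF R[OF n(1)] R[OF n(2)] R[OF n(3)] R[OF n(4)] R[OF n(5)] R[OF n(6)]])
      finally show ?thesis using True by (simp add: h_def power_divide)
    qed (simp add: e_def expectation_walk_step)
    have "\<bar>measure_pmf.expectation (walk c k) ?F - f (emb N c)\<bar>
      \<le> 8 * K / real N ^ 3 * (\<Sum>j<k. measure_pmf.prob (walk c j) {d. all_alive d})"
    proof (induction k)
      case (Suc k)
      have "measure_pmf.expectation (walk c (Suc k)) ?F - measure_pmf.expectation (walk c k) ?F = measure_pmf.expectation (walk c k) e"
        unfolding expectation_walk_Suc e_def by simp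
      also have "\<bar>\<dots>\<bar> \<le> measure_pmf.expectation (walk c k) (\<lambda>d. \<bar>e d\<bar>)"
        using integral_norm_bound[of "measure_pmf (walk c k)" e] by simp
      also have "\<dots> \<le> measure_pmf.expectation (walk c k) (\<lambda>d. 8 * K / real N ^ 3 * indicator {d. all_alive d} d)"
      proof (rule integral_mono_AE)
        show "AE d in measure_pmf (walk c k). \<bar>e d\<bar> \<le> 8 * K / real N ^ 3 * indicator {d. all_alive d} d"
          unfolding AE_measure_pmf_iff by (intro ballI step valid_walk[OF v])
      qed auto
      also have "\<dots> = 8 * K / real N ^ 3 * measure_pmf.prob (walk c k) {d. all_alive d}" by simp
      finally have "\<bar>measure_pmf.expectation (walk c (Suc k)) ?F - measure_pmf.expectation (walk c k) ?F\<bar> \<le> \<dots>" .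
      then show ?case using Suc by (simp add: distrib_left)
    qed simp
    also have "\<dots> \<le> 8 * K / real N ^ 3 * (D * real N ^ 2 / 4)"
      using K0 by (intro mult_left_mono walk_alive_sum[OF v D(2)]) auto
    also have "\<dots> = 2 * K * D / real N" using N by (simp add: eval_nat_numeral)
    finally show ?thesis .
  qed
  show ?thesis by (rule that[of "2 * K * D"]) (use K0 D main in auto)
qed

text \<open>On \<open>V3\<close> the distance to \<open>(1, 0)\<close> is twice the share of player
  1, which is his chance to win; elsewhere on the frontier player 3 is still in and another player
  is out.\<close>

lemma order_prob_frontier:
  assumes v: "valid N c" and dead: "\<not> all_alive c"
  shows "order_prob c [3, 2, 1] = (if emb N c \<in> V3 then norm (emb N c - (1, 0)) / 2 else 0)"
    and "order_prob c [3, 2, 1] + order_prob c [3, 1, 2] = indicator V3 (emb N c)"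
proof -
  have N: "real N > 0" "c 1 + c 2 + c 3 = N" using v valid_pos[OF v] by (auto simp: valid_def)
  show "order_prob c [3, 2, 1] = (if emb N c \<in> V3 then norm (emb N c - (1, 0)) / 2 else 0)"
  proof (cases "c 3 = 0")
    case True
    then have pos: "0 < c 1" "0 < c 2" and N2: "N = c 1 + c 2" using v by (auto simp: valid_def)
    have "(real (c 2) - real (c 1)) / real N - 1 = - (2 * (real (c 1) / real N))"
      using N(1) by (simp add: N2 field_simps)
    then have "norm (emb N c - (1, 0)) = 2 * (real (c 1) / real N)"
      using True by (simp add: emb_def norm_prod_def)
    then show ?thesis
      using True order_prob_two[OF pos True, of 2 1, folded N2] emb_V3[OF v] by simp
  qed (use order_prob_dead_other[of c] dead emb_V3[OF v] in simp)
  show "order_prob c [3, 2, 1] + order_prob c [3, 1, 2] = indicator V3 (emb N c)"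
  proof (cases "c 3 = 0")
    case True
    then have pos: "0 < c 1" "0 < c 2" using v by (auto simp: valid_def)
    show ?thesis
      using True order_prob_two[OF pos True, of 2 1] order_prob_two[OF pos True, of 1 2] emb_V3[OF v] pos
      by (simp add: add_divide_distrib[symmetric])
  qed (use order_prob_dead_other[of c] dead emb_V3[OF v] in simp)
qed

text \<open>First-step analysis for live states; frozen states do not move. So the desired
  probability may be read off at the stopped position.\<close>

lemma order_prob_walk:
  assumes \<sigma>: "\<sigma> = [3, 2, 1] \<or> \<sigma> = [3, 1, 2]"
  shows "measure_pmf.expectation (walk c k) (\<lambda>d. order_prob d \<sigma>) = order_prob c \<sigma>"
proof (induction k)
  case (Suc k)
  have "measure_pmf.expectation (walk_step d) (\<lambda>d. order_prob d \<sigma>) = order_prob d \<sigma>" for d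
    using order_prob_first_step[OF _ \<sigma>, of d] by (simp add: expectation_walk_step)
  then show ?case using Suc unfolding expectation_walk_Suc by simp
qed simp

section \<open>Passage to the limit\<close>

text \<open>
  A parametrisation of the boundary by its length, used to lift the exit laws to the real line, where Helly's
  selection theorem is available. It is constant outside of \<open>{0..6}\<close>.
\<close>
definition loop :: "real \<Rightarrow> real \<times> real" where
  "loop s = (let b = max 0 (1 - \<bar>s - 2\<bar> / 2); c = max 0 (1 - \<bar>s - 4\<bar> / 2) in (2 * b + c - 1, sqrt 3 * c))"

text \<open>Tents that peak at the parameters 2 and 4, where the curve passes the vertices
  \<open>(1, 0)\<close> and \<open>(0, sqrt 3)\<close>; at 0 and 6 it is at \<open>(-1, 0)\<close>.
  Every side has length 2.\<close>

lemma bary_loop: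
  "bb (loop s) = max 0 (1 - \<bar>s - 2\<bar> / 2)" "bc (loop s) = max 0 (1 - \<bar>s - 4\<bar> / 2)"
  "ba (loop s) = 1 - max 0 (1 - \<bar>s - 2\<bar> / 2) - max 0 (1 - \<bar>s - 4\<bar> / 2)"
  unfolding loop_def Let_def bary_defs by (simp_all add: diff_divide_distrib add_divide_distrib)

lemma isCont_loop: "isCont loop s"
proof -
  have "continuous_on UNIV loop" unfolding loop_def Let_def by (intro continuous_intros) auto
  then show ?thesis by (simp add: continuous_on_eq_continuous_at)
qed

lemma loop_frontier: "loop s \<in> frontier triangle"
proof -
  have "0 \<le> 1 - max 0 (1 - \<bar>s - 2\<bar> / 2) - max 0 (1 - \<bar>s - 4\<bar> / 2)" by (smt (verit) field_sum_of_halves)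
  moreover have "1 - max 0 (1 - \<bar>s - 2\<bar> / 2) - max 0 (1 - \<bar>s - 4\<bar> / 2) = 0 \<or>
      max 0 (1 - \<bar>s - 2\<bar> / 2) = 0 \<or> max 0 (1 - \<bar>s - 4\<bar> / 2) = 0"
    by (smt (verit) field_sum_of_halves)
  ultimately show ?thesis unfolding frontier_triangle mem_Collect_eq bary_loop by simp
qed

lemma bary_inj: "bb z = bb w \<Longrightarrow> bc z = bc w \<Longrightarrow> z = w"
  by (simp add: bary_defs prod_eq_iff)

lemma loop_surj:
  assumes "z \<in> frontier triangle"
  shows "\<exists>s. 0 \<le> s \<and> s \<le> 6 \<and> loop s = z"
proof -
  have z: "0 \<le> ba z" "0 \<le> bb z" "0 \<le> bc z" "ba z + bb z + bc z = 1"
    using assms bary_sum[of z] by (auto simp: frontier_triangle)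
  consider "bc z = 0" | "ba z = 0" | "bb z = 0" using assms by (auto simp: frontier_triangle)
  then show ?thesis
  proof cases
    case 1
    have "loop (2 * bb z) = z"
      by (rule bary_inj; unfold bary_loop) (use z 1 in \<open>smt (verit) field_sum_of_halves\<close>)+
    then show ?thesis using z by (intro exI[of _ "2 * bb z"]) auto
  next
    case 2
    have "loop (2 + 2 * bc z) = z"
      by (rule bary_inj; unfold bary_loop) (use z 2 in \<open>smt (verit) field_sum_of_halves\<close>)+
    then show ?thesis using z by (intro exI[of _ "2 + 2 * bc z"]) auto
  next
    case 3
    have "loop (6 - 2 * bc z) = z"
      by (rule bary_inj; unfold bary_loop) (use z 3 in \<open>smt (verit) field_sum_of_halves\<close>)+
    then show ?thesis using z by (intro exI[of _ "6 - 2 * bc z"]) auto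
  qed
qed

text \<open>Any choice of a preimage will do: it only pushes forward discrete laws, for which every
  map is measurable. The value 0 off the frontier keeps all values between 0 and 6.\<close>

definition unloop :: "real \<times> real \<Rightarrow> real" where
  "unloop z = (if z \<in> frontier triangle then SOME s. 0 \<le> s \<and> s \<le> 6 \<and> loop s = z else 0)"

lemma unloop: "0 \<le> unloop z" "unloop z \<le> 6" "z \<in> frontier triangle \<Longrightarrow> loop (unloop z) = z"
  using someI_ex[OF loop_surj[of z]] by (auto simp: unloop_def)

lemma not_tendsto_subseq:
  fixes f :: "nat \<Rightarrow> real"
  assumes "\<not> f \<longlonglongrightarrow> l"
  shows "\<exists>\<epsilon> s. \<epsilon> > 0 \<and> strict_mono (s :: nat \<Rightarrow> nat) \<and> (\<forall>n. \<epsilon> \<le> dist (f (s n)) l)"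
proof -
  obtain \<epsilon> where "\<epsilon> > 0" and inf: "infinite {n. \<not> dist (f n) l < \<epsilon>}"
    using assms by (auto simp: tendsto_iff not_eventually INFM_iff_infinite cofinite_eq_sequentially[symmetric])
  define s where "s = enumerate {n. \<not> dist (f n) l < \<epsilon>}"
  have "strict_mono s" unfolding s_def using inf by (intro strict_monoI enumerate_mono)
  moreover have "\<epsilon> \<le> dist (f (s n)) l" for n
    using enumerate_in_set[OF inf, of n] by (simp add: s_def not_less)
  ultimately show ?thesis using \<open>\<epsilon> > 0\<close> by blast
qed

text \<open>Near such a parameter the indicator is constant: either \<open>bc\<close> stays
  positive, or \<open>ba\<close> and \<open>bb\<close> stay positive and a point of the frontier
  must then have \<open>bc = 0\<close>.\<close>

lemma isCont_indicator_V3_loop: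
  assumes \<psi>: "continuous_on UNIV (\<psi> :: real \<times> real \<Rightarrow> real)"
    and s: "loop s \<notin> {(-1, 0), (1, 0)}"
  shows "isCont (\<lambda>s. indicator V3 (loop s) * \<psi> (loop s)) s"
proof -
  have cont: "isCont (\<lambda>s. g (loop s)) s" if "continuous_on UNIV g" for g :: "real \<times> real \<Rightarrow> real"
    using that unfolding continuous_on_eq_continuous_at[OF open_UNIV]
    by (intro isCont_o2[OF isCont_loop]) blast
  have cb: "isCont (\<lambda>s. ba (loop s)) s" "isCont (\<lambda>s. bb (loop s)) s" "isCont (\<lambda>s. bc (loop s)) s"
    using cont[OF continuous_on_bary(1)[OF continuous_on_id]] cont[OF continuous_on_bary(2)[OF continuous_on_id]]
      cont[OF continuous_on_bary(3)[OF continuous_on_id]] by simp_all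
  have pos: "\<forall>\<^sub>F t in nhds s. 0 < g t" if "isCont g s" "0 < g s" for g :: "real \<Rightarrow> real"
    using that order_tendstoD(1)[of g "g s" "nhds s" 0] by (simp add: continuous_at tendsto_at_iff_tendsto_nhds)
  have fr: "0 \<le> ba (loop s)" "0 \<le> bb (loop s)" "0 \<le> bc (loop s)" using loop_frontier[of s] by (auto simp: frontier_triangle)
  show ?thesis
  proof (cases "bc (loop s) = 0")
    case False
    then have "0 < bc (loop s)" using fr by simp
    from pos[OF cb(3) this] have "\<forall>\<^sub>F t in nhds s. indicator V3 (loop t) * \<psi> (loop t) = 0"
      by eventually_elim (auto simp: V3_eq)
    from isCont_cong[OF this] show ?thesis by simp
  next
    case True
    have "ba (loop s) \<noteq> 0" "bb (loop s) \<noteq> 0"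
      using s True bary_inj[of "loop s" "(1, 0)"] bary_inj[of "loop s" "(-1, 0)"] bary_sum[of "loop s"]
      by (auto simp: bary_defs)
    then have "0 < ba (loop s)" "0 < bb (loop s)" using fr by simp_all
    from pos[OF cb(1) this(1)] pos[OF cb(2) this(2)]
    have "\<forall>\<^sub>F t in nhds s. indicator V3 (loop t) * \<psi> (loop t) = \<psi> (loop t)"
    proof eventually_elim
      case (elim t)
      then show ?case using loop_frontier[of t] by (auto simp: V3_eq frontier_triangle)
    qed
    from isCont_cong[OF this] show ?thesis using cont[OF \<psi>] by simp
  qed
qed

text \<open>The indicator of the closed set \<open>V3\<close> is the pointwise limit of the
  continuous cutoffs \<open>max 0 (1 - k * infdist z V3)\<close>.\<close>

lemma integral_indicator_V3_eq:
  fixes \<mu>1 \<mu>2 :: "(real \<times> real) measure"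
  assumes p: "prob_space \<mu>1" "prob_space \<mu>2" "sets \<mu>1 = sets borel" "sets \<mu>2 = sets borel"
    and eq: "\<And>\<phi>. continuous_on UNIV \<phi> \<Longrightarrow> (LINT z|\<mu>1. \<phi> z :: real) = (LINT z|\<mu>2. \<phi> z)"
    and \<psi>: "continuous_on UNIV (\<psi> :: real \<times> real \<Rightarrow> real)" "\<And>z. \<bar>\<psi> z\<bar> \<le> 1"
  shows "(LINT z|\<mu>1. indicator V3 z * \<psi> z) = (LINT z|\<mu>2. indicator V3 z * \<psi> z)"
proof -
  interpret m1: prob_space \<mu>1 by fact
  interpret m2: prob_space \<mu>2 by fact
  note [measurable_cong] = p(3,4)
  have [measurable]: "\<psi> \<in> borel_measurable borel" using \<psi>(1) by (rule borel_measurable_continuous_onI)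
  have V3: "closed V3" "V3 \<noteq> {}" by (auto simp: V3_def)
  have [measurable]: "V3 \<in> sets borel" using V3 by (simp add: borel_closed)
  define \<phi> where "\<phi> k z = max 0 (1 - real k * infdist z V3) * \<psi> z" for k z
  have cont: "continuous_on UNIV (\<phi> k)" for k unfolding \<phi>_def by (intro continuous_intros \<psi>)
  have [measurable]: "\<phi> k \<in> borel_measurable borel" for k using cont by (rule borel_measurable_continuous_onI)
  have bnd: "norm (\<phi> k z) \<le> 1" for k z
  proof -
    have "\<bar>max 0 (1 - real k * infdist z V3)\<bar> * \<bar>\<psi> z\<bar> \<le> 1 * 1"
      using infdist_nonneg[of z V3] by (intro mult_mono \<psi>(2)) auto
    then show ?thesis by (simp add: \<phi>_def abs_mult)
  qed
  have lim: "(\<lambda>k. \<phi> k z) \<longlonglongrightarrow> indicator V3 z * \<psi> z" for z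
  proof (cases "z \<in> V3")
    case False
    then have d: "infdist z V3 > 0" using V3 by (intro infdist_pos_not_in_closed)
    obtain k0 :: nat where k0: "1 < real k0 * infdist z V3" using d reals_Archimedean3 by blast
    have "\<phi> k z = 0" if "k \<ge> k0" for k
    proof -
      have "real k0 * infdist z V3 \<le> real k * infdist z V3" using that d by (intro mult_right_mono) auto
      then show ?thesis using k0 by (simp add: \<phi>_def max_def)
    qed
    then have "eventually (\<lambda>k. \<phi> k z = 0) sequentially" by (rule eventually_sequentiallyI)
    then show ?thesis using False by (simp add: tendsto_eventually)
  qed (simp add: \<phi>_def)
  have "(\<lambda>k. LINT z|\<mu>. \<phi> k z) \<longlonglongrightarrow> (LINT z|\<mu>. indicator V3 z * \<psi> z)" if "\<mu> = \<mu>1 \<or> \<mu> = \<mu>2" for \<mu>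
    by (rule integral_dominated_convergence[where w = "\<lambda>_. 1"]) (use that bnd lim in auto)
  from this[of \<mu>1] this[of \<mu>2] show ?thesis
    using eq[OF cont] by (auto intro: LIMSEQ_unique)
qed

lemma init_capitals_simps: "init_capitals A B C 1 = A" "init_capitals A B C 2 = B" "init_capitals A B C 3 = C"
  by (simp_all add: init_capitals_def)

section \<open>Convergence of the exit laws of the walk\<close>

context brownian_triangle
begin

text \<open>\<open>q\<close> stands for either probability of the main statement: it is invariant
  under the walk and known on the frontier, so \<open>q (c n)\<close> is nearly an integral against
  the exit law.\<close>

lemma walk_limit:
  fixes c :: "nat \<Rightarrow> capitals" and N :: "nat \<Rightarrow> nat" and q :: "capitals \<Rightarrow> real"
  assumes valid: "\<And>n. valid (N n) (c n)" and emb: "\<And>n. emb (N n) (c n) = x" and N: "\<And>n. n < N n"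
    and q: "\<And>n k. measure_pmf.expectation (walk (c n) k) q = q (c n)"
    and q_frontier: "\<And>n d. valid n d \<Longrightarrow> \<not> all_alive d \<Longrightarrow> q d = indicator V3 (emb n d) * \<psi> (emb n d)"
    and q2: "\<And>d. \<bar>q d\<bar> \<le> 2"
    and \<psi>: "continuous_on UNIV \<psi>" "\<And>z. \<bar>\<psi> z\<bar> \<le> 1"
  shows "(\<lambda>n. q (c n)) \<longlonglongrightarrow> expectation (\<lambda>\<omega>. indicator V3 (Z \<omega>) * \<psi> (Z \<omega>))"
proof -
  have "\<exists>k. measure_pmf.prob (walk (c n) k) {d. all_alive d} \<le> 1 / real (Suc n)" for n
    by (rule walk_absorbed[OF valid[of n], of "1 / real (Suc n)"]) auto
  \<comment> \<open>\<open>k n\<close> may be as large as necessary, since the bound of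
    \<open>walk_expectation\<close> does not depend on the number of rounds.\<close>
  then obtain k where k: "\<And>n. measure_pmf.prob (walk (c n) (k n)) {d. all_alive d} \<le> 1 / real (Suc n)" by metis
  define P where "P n = walk (c n) (k n)" for n
  define \<nu> where "\<nu> n = distr (measure_pmf (P n)) borel (\<lambda>d. unloop (emb (N n) d))" for n
  have ivl: "integral\<^sup>L (\<nu> n) g = measure_pmf.expectation (P n) (\<lambda>d. g (unloop (emb (N n) d)))"
    if "g \<in> borel_measurable borel" for n and g :: "real \<Rightarrow> real"
    unfolding \<nu>_def by (rule integral_distr) (use that in auto)
  have real_d: "real_distribution (\<nu> n)" for n
  proof -
    interpret p: prob_space "\<nu> n" unfolding \<nu>_def by (rule measure_pmf.prob_space_distr) simp
    show ?thesis by standard (simp add: \<nu>_def)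
  qed
  have tight: "tight \<nu>" unfolding tight_def
  proof (intro conjI allI impI)
    fix \<epsilon> :: real assume "\<epsilon> > 0"
    have "measure (\<nu> n) {-1<..7} = 1" for n
    proof -
      have "unloop z \<in> {-1<..7}" for z using unloop(1,2)[of z] by simp
      then have "(\<lambda>d. unloop (emb (N n) d)) -` {-1<..7} = UNIV" by blast
      then show ?thesis unfolding \<nu>_def by (subst measure_distr) auto
    qed
    then show "\<exists>a b. a < b \<and> (\<forall>n. 1 - \<epsilon> < measure (\<nu> n) {a<..b})"
      using \<open>\<epsilon> > 0\<close> by (intro exI[of _ "-1"] exI[of _ 7]) auto
  qed (rule real_d)
  \<comment> \<open>Functions that agree on eliminated states have expectations that differ only by
    the mass still alive, at most \<open>1 / (n + 1)\<close>.\<close>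
  have close: "\<bar>measure_pmf.expectation (P n) F - measure_pmf.expectation (P n) H\<bar> \<le> B / real (Suc n)"
    if "\<And>d. valid (N n) d \<Longrightarrow> \<bar>F d - H d\<bar> \<le> B * indicator {d. all_alive d} d" and B: "B \<ge> 0" for F H :: "capitals \<Rightarrow> real" and B n
  proof -
    have "\<bar>measure_pmf.expectation (P n) F - measure_pmf.expectation (P n) H\<bar> = \<bar>measure_pmf.expectation (P n) (\<lambda>d. F d - H d)\<bar>"
      by (simp add: P_def)
    also have "\<dots> \<le> measure_pmf.expectation (P n) (\<lambda>d. \<bar>F d - H d\<bar>)"
      using integral_norm_bound[of "measure_pmf (P n)" "\<lambda>d. F d - H d"] by simp
    also have "\<dots> \<le> measure_pmf.expectation (P n) (\<lambda>d. B * indicator {d. all_alive d} d)"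
    proof (rule integral_mono_AE)
      show "AE d in measure_pmf (P n). \<bar>F d - H d\<bar> \<le> B * indicator {d. all_alive d} d"
        unfolding AE_measure_pmf_iff P_def by (intro ballI that valid_walk[OF valid])
    qed (simp_all add: P_def)
    also have "\<dots> = B * measure_pmf.prob (P n) {d. all_alive d}" by simp
    also have "\<dots> \<le> B * (1 / real (Suc n))" unfolding P_def by (intro mult_left_mono k B)
    finally show ?thesis by simp
  qed
  have loop_emb: "loop (unloop (emb (N n) d)) = emb (N n) d" if "valid (N n) d" "\<not> all_alive d" for n d
    using emb_frontier[OF that(1)] that(2) by (intro unloop(3)) simp
  have [measurable]: "loop \<in> borel_measurable borel"
    by (intro borel_measurable_continuous_onI continuous_at_imp_continuous_on ballI isCont_loop)
  have [measurable]: "V3 \<in> sets borel" by (simp add: V3_def borel_closed)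
  have [measurable]: "\<psi> \<in> borel_measurable borel" using \<psi>(1) by (rule borel_measurable_continuous_onI)
  define g where "g s = indicator V3 (loop s) * \<psi> (loop s)" for s
  have g_meas [measurable]: "g \<in> borel_measurable borel" unfolding g_def by measurable
  have g1: "\<bar>g s\<bar> \<le> 1" for s using \<psi>(2) by (auto simp: g_def split: split_indicator)
  define L where "L = expectation (\<lambda>\<omega>. indicator V3 (Z \<omega>) * \<psi> (Z \<omega>))"
  define \<mu> where "\<mu> = distr M borel Z"
  have p\<mu>: "prob_space \<mu>" "sets \<mu> = sets borel" unfolding \<mu>_def by (auto intro: prob_space_distr)
  have K\<mu>: "AE z in \<mu>. z \<in> frontier triangle"
    unfolding \<mu>_def using AE_Z_frontier by (subst AE_distr_iff) (auto intro: borel_closed)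
  have test: "\<exists>f. iso_taylor triangle f \<and> (\<forall>z\<in>triangle. f z = ln (dist z w))" if "w \<notin> triangle" for w
  proof (rule iso_taylor_ln_dist[OF compact_triangle _ that])
    show "triangle \<noteq> {}" using x_interior interior_subset by auto
  qed blast
  have fb: "f \<in> borel_measurable borel" if "iso_taylor triangle f" for f
    using that by (auto simp: iso_taylor_def intro: borel_measurable_continuous_onI)
  have xT: "x \<in> triangle" using x_interior interior_subset by auto
  have pot\<mu>: "(LINT z|\<mu>. ln (dist z w)) = ln (dist x w)" if w: "w \<notin> triangle" for w
  proof -
    obtain f where f: "iso_taylor triangle f" "\<forall>z\<in>triangle. f z = ln (dist z w)" using test[OF w] by blast
    note [measurable] = fb[OF f(1)]
    have "(LINT z|\<mu>. ln (dist z w)) = (LINT \<omega>|M. ln (dist (Z \<omega>) w))" unfolding \<mu>_def by (rule integral_distr) auto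
    also have "\<dots> = expectation (\<lambda>\<omega>. f (Z \<omega>))"
    proof (rule integral_cong_AE)
      show "AE \<omega> in M. ln (dist (Z \<omega>) w) = f (Z \<omega>)"
        using AE_Z_frontier by eventually_elim (use f(2) frontier_triangle_subset in auto)
    qed measurable
    also have "\<dots> = ln (dist x w)" using expectation_exit[OF f(1)] f(2) xT by simp
    finally show ?thesis .
  qed
  have L\<mu>: "L = (LINT z|\<mu>. indicator V3 z * \<psi> z)"
    unfolding L_def \<mu>_def by (rule integral_distr[symmetric]) auto
  have gemb: "g (unloop (emb (N n) d)) = indicator V3 (emb (N n) d) * \<psi> (emb (N n) d)"
    if "valid (N n) d" "\<not> all_alive d" for n d
    using loop_emb[OF that] by (simp add: g_def)
  \<comment> \<open>A subsequential limit, carried back to the frontier by \<open>loop\<close>, has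
    the logarithmic potentials of the Brownian exit law and is identified by
    \<open>potential_unique\<close>.\<close>
  have limit: "(\<lambda>n. integral\<^sup>L (\<nu> (r n)) g) \<longlonglongrightarrow> L"
    if r: "strict_mono r" and \<rho>: "real_distribution \<rho>" and wc: "weak_conv_m (\<nu> \<circ> r) \<rho>" for r \<rho>
  proof -
    interpret \<rho>: real_distribution \<rho> by fact
    have rd: "real_distribution ((\<nu> \<circ> r) n)" for n using real_d by simp
    define \<mu>' where "\<mu>' = distr \<rho> borel loop"
    have p\<mu>': "prob_space \<mu>'" "sets \<mu>' = sets borel" unfolding \<mu>'_def by (auto intro: \<rho>.prob_space_distr)
    have K\<mu>': "AE z in \<mu>'. z \<in> frontier triangle"
      unfolding \<mu>'_def by (subst AE_distr_iff) (auto intro: borel_closed loop_frontier)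
    have pot\<mu>': "(LINT z|\<mu>'. ln (dist z w)) = ln (dist x w)" if w: "w \<notin> triangle" for w
    proof -
      obtain f where f: "iso_taylor triangle f" "\<forall>z\<in>triangle. f z = ln (dist z w)" using test[OF w] by blast
      note [measurable] = fb[OF f(1)]
      obtain B where B: "\<And>z. \<bar>f z\<bar> \<le> B" using f(1) by (auto simp: iso_taylor_def bounded_iff)
      obtain C where C: "C \<ge> 0" "\<And>N c k. valid N c \<Longrightarrow>
          \<bar>measure_pmf.expectation (walk c k) (\<lambda>d. f (emb N d)) - f (emb N c)\<bar> \<le> C / real N"
        using walk_expectation[OF f(1)] by blast
      have B0: "B \<ge> 0" by (rule order_trans[OF abs_ge_zero B[of x]])
      have hm: "(\<lambda>s. f (loop s)) \<in> borel_measurable borel" by measurable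
      have est: "\<bar>integral\<^sup>L (\<nu> n) (\<lambda>s. f (loop s)) - f x\<bar> \<le> (2 * B + C) / real (Suc n)" for n
      proof -
        have "\<bar>measure_pmf.expectation (P n) (\<lambda>d. f (loop (unloop (emb (N n) d)))) - measure_pmf.expectation (P n) (\<lambda>d. f (emb (N n) d))\<bar>
          \<le> 2 * B / real (Suc n)"
        proof (rule close)
          show "\<bar>f (loop (unloop (emb (N n) d))) - f (emb (N n) d)\<bar> \<le> 2 * B * indicator {d. all_alive d} d"
            if "valid (N n) d" for d
          proof (cases "all_alive d")
            case True
            then show ?thesis
              using B[of "loop (unloop (emb (N n) d))"] B[of "emb (N n) d"] by (simp add: abs_le_iff)
          qed (use loop_emb[OF that] in simp)
        qed (use B0 in simp)
        moreover have "\<bar>measure_pmf.expectation (P n) (\<lambda>d. f (emb (N n) d)) - f x\<bar> \<le> C / real (N n)"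
          using C(2)[OF valid[of n], of "k n"] unfolding P_def emb .
        moreover have "C / real (N n) \<le> C / real (Suc n)"
          using C(1) N[of n] by (intro divide_left_mono) auto
        ultimately show ?thesis unfolding ivl[OF hm] add_divide_distrib by linarith
      qed
      have "(\<lambda>n. (2 * B + C) / real (Suc n)) \<longlonglongrightarrow> 0" by real_asymp
      then have "(\<lambda>n. integral\<^sup>L (\<nu> n) (\<lambda>s. f (loop s)) - f x) \<longlonglongrightarrow> 0"
        by (rule Lim_null_comparison[rotated]) (simp add: est del: of_nat_Suc)
      then have "(\<lambda>n. integral\<^sup>L (\<nu> n) (\<lambda>s. f (loop s))) \<longlonglongrightarrow> f x" by (simp add: LIM_zero_iff)
      from LIMSEQ_subseq_LIMSEQ[OF this r]
      have 1: "(\<lambda>n. integral\<^sup>L ((\<nu> \<circ> r) n) (\<lambda>s. f (loop s))) \<longlonglongrightarrow> f x" by (simp add: comp_def)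
      have "continuous_on UNIV f" using f(1) by (simp add: iso_taylor_def)
      then have fc: "isCont (\<lambda>s. f (loop s)) s" for s
        unfolding continuous_on_eq_continuous_at[OF open_UNIV] by (intro isCont_o2[OF isCont_loop]) blast
      have 2: "(\<lambda>n. integral\<^sup>L ((\<nu> \<circ> r) n) (\<lambda>s. f (loop s))) \<longlonglongrightarrow> integral\<^sup>L \<rho> (\<lambda>s. f (loop s))"
        by (rule weak_conv_imp_integral_bdd_continuous_conv[OF rd \<rho> wc fc, of B]) (simp add: B)
      have "(LINT z|\<mu>'. ln (dist z w)) = (LINT s|\<rho>. ln (dist (loop s) w))" unfolding \<mu>'_def by (rule integral_distr) auto
      also have "\<dots> = (LINT s|\<rho>. f (loop s))"
      proof (intro Bochner_Integration.integral_cong refl)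
        fix s
        have "loop s \<in> triangle" using loop_frontier frontier_triangle_subset by (rule subsetD[rotated])
        then show "ln (dist (loop s) w) = f (loop s)" using f(2) by simp
      qed
      also have "\<dots> = f x" by (rule LIMSEQ_unique[OF 2 1])
      finally show ?thesis using f(2) xT by simp
    qed
    have "(LINT z|\<mu>'. indicator V3 z * \<psi> z) = (LINT z|\<mu>. indicator V3 z * \<psi> z)"
      by (rule integral_indicator_V3_eq[OF p\<mu>'(1) p\<mu>(1) p\<mu>'(2) p\<mu>(2) _ \<psi>])
         (rule potential_unique[OF p\<mu>'(1) p\<mu>(1) p\<mu>'(2) p\<mu>(2) K\<mu>' K\<mu> x_interior pot\<mu>' pot\<mu>])
    moreover have "(LINT z|\<mu>'. indicator V3 z * \<psi> z) = integral\<^sup>L \<rho> g"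
      unfolding \<mu>'_def g_def by (rule integral_distr) auto
    ultimately have g\<rho>: "integral\<^sup>L \<rho> g = L" unfolding L\<mu> by simp
    have corner: "(-1, 0) \<in> frontier triangle" "(1, 0) \<in> frontier triangle"
      by (simp_all add: frontier_triangle bary_defs)
    \<comment> \<open>The absence of atoms is applied to the subsequential limit itself, whose
      potentials have just been computed.\<close>
    have "emeasure \<rho> {s. \<not> isCont g s} \<le> emeasure \<rho> (loop -` {(-1, 0), (1, 0)} \<inter> space \<rho>)"
    proof (rule emeasure_mono)
      show "{s. \<not> isCont g s} \<subseteq> loop -` {(-1, 0), (1, 0)} \<inter> space \<rho>"
        using isCont_indicator_V3_loop[OF \<psi>(1)] unfolding g_def by auto
      have "loop \<in> borel_measurable \<rho>" by measurable
      then show "loop -` {(-1, 0), (1, 0)} \<inter> space \<rho> \<in> sets \<rho>" by (rule measurable_sets) simp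
    qed
    also have "\<dots> = emeasure \<mu>' {(-1, 0), (1, 0)}" unfolding \<mu>'_def by (subst emeasure_distr) auto
    also have "\<dots> \<le> emeasure \<mu>' {(-1, 0)} + emeasure \<mu>' {(1, 0)}"
      using emeasure_subadditive[of "{(-1, 0)}" \<mu>' "{(1, 0)}"] p\<mu>'(2) by (simp add: insert_commute)
    also have "\<dots> = 0"
      using potential_no_atom[OF p\<mu>' K\<mu>' x_interior pot\<mu>' corner(1)]
        potential_no_atom[OF p\<mu>' K\<mu>' x_interior pot\<mu>' corner(2)] by simp
    finally have disc: "emeasure \<rho> {s. \<not> isCont g s} = 0" by simp
    have "(\<lambda>n. integral\<^sup>L ((\<nu> \<circ> r) n) g) \<longlonglongrightarrow> integral\<^sup>L \<rho> g"
      by (rule weak_conv_imp_bdd_ae_continuous_conv[OF rd \<rho> wc disc _ g_meas, of 1]) (simp add: g1)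
    then show ?thesis by (simp add: g\<rho>)
  qed
  \<comment> \<open>If convergence failed, some subsequence would stay away from \<open>L\<close>;
    by tightness it has a weakly convergent further subsequence, contradicting
    \<open>limit\<close>.\<close>
  have g_lim: "(\<lambda>n. integral\<^sup>L (\<nu> n) g) \<longlonglongrightarrow> L"
  proof (rule ccontr)
    assume "\<not> ?thesis"
    from not_tendsto_subseq[OF this]
    obtain \<epsilon> and s :: "nat \<Rightarrow> nat" where s: "\<epsilon> > 0" "strict_mono s" "\<forall>n. \<epsilon> \<le> dist (integral\<^sup>L (\<nu> (s n)) g) L"
      by blast
    obtain r \<rho> where r: "strict_mono r" "real_distribution \<rho>" "weak_conv_m (\<nu> \<circ> s \<circ> r) \<rho>"
      using tight_imp_convergent_subsubsequence[OF tight s(2)] by blast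
    have "(\<lambda>n. integral\<^sup>L (\<nu> ((s \<circ> r) n)) g) \<longlonglongrightarrow> L"
      by (rule limit[OF strict_mono_o[OF s(2) r(1)] r(2)]) (use r(3) in \<open>simp add: comp_assoc\<close>)
    then have "eventually (\<lambda>n. dist (integral\<^sup>L (\<nu> ((s \<circ> r) n)) g) L < \<epsilon>) sequentially" using s(1) by (rule tendstoD)
    then obtain n where "dist (integral\<^sup>L (\<nu> ((s \<circ> r) n)) g) L < \<epsilon>"
      by (auto simp: eventually_sequentially)
    then show False using s(3)[rule_format, of "r n"] by simp
  qed
  have est: "\<bar>q (c n) - integral\<^sup>L (\<nu> n) g\<bar> \<le> 3 / real (Suc n)" for n
  proof -
    \<comment> \<open>The constant 3 adds the bounds 2 for \<open>q\<close> and 1 for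
      \<open>g\<close> on live states.\<close>
    have "\<bar>measure_pmf.expectation (P n) q - measure_pmf.expectation (P n) (\<lambda>d. g (unloop (emb (N n) d)))\<bar> \<le> 3 / real (Suc n)"
    proof (rule close)
      show "\<bar>q d - g (unloop (emb (N n) d))\<bar> \<le> 3 * indicator {d. all_alive d} d" if "valid (N n) d" for d
      proof (cases "all_alive d")
        case True
        then show ?thesis using q2[of d] g1[of "unloop (emb (N n) d)"] by (simp add: abs_le_iff)
      qed (use gemb[OF that] q_frontier[OF that] in simp)
    qed simp
    then show ?thesis unfolding ivl[OF g_meas] P_def q .
  qed
  have "(\<lambda>n. 3 / real (Suc n)) \<longlonglongrightarrow> 0" by real_asymp
  then have "(\<lambda>n. q (c n) - integral\<^sup>L (\<nu> n) g) \<longlonglongrightarrow> 0"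
    by (rule Lim_null_comparison[rotated]) (simp add: est del: of_nat_Suc)
  from tendsto_add[OF this g_lim] show ?thesis unfolding L_def by simp
qed

end

theorem theorem4p1:
  fixes A B C N :: nat
    and x :: "real \<times> real"
    and M :: "'w measure"
    and W :: "real \<Rightarrow> 'w \<Rightarrow> real \<times> real"
    and T1 :: "'w \<Rightarrow> ereal"
    and G :: "'w set"
  assumes "A > 0" and "B > 0" and "C > 0"
    and "N = A + B + C"
    and "x = ((real B - real A) / real N, sqrt 3 * real C / real N)"
    and "standard_brownian_motion_2d M W"
    and "T1 = (\<lambda>\<omega>. exit_time (\<lambda>t. x + W t \<omega>) triangle)"
    and "G = {\<omega> \<in> space M. T1 \<omega> < \<infinity> \<and> x + W (real_of_ereal (T1 \<omega>)) \<omega> \<in> V3}"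
  shows "((\<lambda>n. elimination_prob (n * A) (n * B) (n * C) [3, 2, 1]
             + elimination_prob (n * A) (n * B) (n * C) [3, 1, 2])
            \<longlonglongrightarrow> measure M G)
       \<and> ((\<lambda>n. elimination_prob (n * A) (n * B) (n * C) [3, 2, 1])
            \<longlonglongrightarrow> (LINT \<omega>:G|M. norm (x + W (real_of_ereal (T1 \<omega>)) \<omega> - (1, 0)) / 2))"
proof -
  \<comment> \<open>Indexed by \<open>Suc n\<close>, because for \<open>n = 0\<close> all capitals
    vanish and the state is not valid; the shift does not affect the limit.\<close>
  define cap where "cap n = init_capitals (Suc n * A) (Suc n * B) (Suc n * C)" for n
  have emb: "emb (Suc n * N) (cap n) = x" for n
  proof -
    have "(real (Suc n) * real B - real (Suc n) * real A) / (real (Suc n) * real N) = (real B - real A) / real N"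
      unfolding right_diff_distrib[symmetric] by (rule mult_divide_mult_cancel_left) simp
    moreover have "sqrt 3 * (real (Suc n) * real C) / (real (Suc n) * real N) = sqrt 3 * real C / real N"
      unfolding mult.left_commute[of "sqrt 3"] by (rule mult_divide_mult_cancel_left) simp
    ultimately show ?thesis
      unfolding emb_def cap_def init_capitals_simps of_nat_mult assms(5) by simp
  qed
  have valid: "valid (Suc n * N) (cap n)" for n
    unfolding valid_def cap_def init_capitals_simps assms(4) using assms(1-3) by (auto simp: distrib_left)
  have Nn: "n < Suc n * N" for n
  proof -
    have "Suc n * 1 \<le> Suc n * N" using assms(1,4) by (intro mult_le_mono) auto
    then show ?thesis by simp
  qed
  have alive: "all_alive (cap 0)" unfolding all_alive_def cap_def init_capitals_simps using assms(1-3) by simp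
  have "x \<in> interior triangle"
    using emb_frontier[OF valid[of 0]] emb_triangle[OF valid[of 0]] alive unfolding emb frontier_def
    by (simp add: closure_closed closed_triangle)
  then interpret brownian_triangle M W x
    using assms(6) by (simp add: brownian_triangle_def brownian_triangle_axioms_def)
  have T1: "T1 \<omega> = T \<omega>" for \<omega> by (simp add: assms(7) T_def)
  have Zeq: "x + W (real_of_ereal (T1 \<omega>)) \<omega> = Z \<omega>" for \<omega> by (simp add: T1 Z_def)
  have xV3: "x \<notin> V3" using x_interior by (auto simp: V3_eq interior_triangle)
  \<comment> \<open>On paths that never exit, \<open>Z\<close> is the interior point
    \<open>x\<close>, which is not in \<open>V3\<close>; the finiteness clause of \<open>G\<close>
    is thus implied.\<close>
  have Geq: "G = {\<omega> \<in> space M. Z \<omega> \<in> V3}"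
    unfolding assms(8) Zeq using Z_infinite xV3 by (auto simp: T1)
  have [measurable]: "V3 \<in> sets borel" by (simp add: V3_def borel_closed)
  have Gm: "G \<in> sets M" unfolding Geq by measurable
  have "(\<lambda>n. order_prob (cap n) [3, 2, 1] + order_prob (cap n) [3, 1, 2])
    \<longlonglongrightarrow> expectation (\<lambda>\<omega>. indicator V3 (Z \<omega>) * (1::real))"
  proof (rule walk_limit[OF valid emb Nn])
    show "measure_pmf.expectation (walk (cap n) k) (\<lambda>d. order_prob d [3, 2, 1] + order_prob d [3, 1, 2])
      = order_prob (cap n) [3, 2, 1] + order_prob (cap n) [3, 1, 2]" for n k
      by (simp add: order_prob_walk)
    show "\<bar>order_prob d [3, 2, 1] + order_prob d [3, 1, 2]\<bar> \<le> 2" for d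
      using order_prob_01[of d "[3, 2, 1]"] order_prob_01[of d "[3, 1, 2]"] by simp
  qed (simp_all add: order_prob_frontier(2) del: One_nat_def)
  also have "expectation (\<lambda>\<omega>. indicator V3 (Z \<omega>) * (1::real)) = (LINT \<omega>|M. indicator G \<omega>)"
    by (rule Bochner_Integration.integral_cong) (auto simp: Geq split: split_indicator)
  also have "\<dots> = measure M G" using Gm by simp
  finally have 1: "(\<lambda>n. order_prob (cap n) [3, 2, 1] + order_prob (cap n) [3, 1, 2]) \<longlonglongrightarrow> measure M G" .
  \<comment> \<open>Capping at 1 makes the function bounded on the plane, as
    \<open>walk_limit\<close> requires, and changes nothing on \<open>V3\<close>.\<close>
  define \<psi> :: "real \<times> real \<Rightarrow> real" where "\<psi> z = min 1 (norm (z - (1, 0)) / 2)" for z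
  have \<psi>V3: "\<psi> z = norm (z - (1, 0)) / 2" if "z \<in> V3" for z
  proof -
    have "snd z = 0" "-1 \<le> fst z" "fst z \<le> 1" using that by (auto simp: V3_eq bary_defs)
    then have "norm (z - (1, 0)) \<le> 2" by (simp add: norm_prod_def)
    then show ?thesis by (simp add: \<psi>_def)
  qed
  have "(\<lambda>n. order_prob (cap n) [3, 2, 1]) \<longlonglongrightarrow> expectation (\<lambda>\<omega>. indicator V3 (Z \<omega>) * \<psi> (Z \<omega>))"
  proof (rule walk_limit[OF valid emb Nn])
    show "\<bar>order_prob d [3, 2, 1]\<bar> \<le> 2" for d using order_prob_01[of d "[3, 2, 1]"] by simp
    show "continuous_on UNIV \<psi>" unfolding \<psi>_def by (intro continuous_intros) auto
    show "\<bar>\<psi> z\<bar> \<le> 1" for z by (simp add: \<psi>_def)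
  qed (simp_all add: order_prob_walk order_prob_frontier(1) \<psi>V3 del: One_nat_def)
  also have "expectation (\<lambda>\<omega>. indicator V3 (Z \<omega>) * \<psi> (Z \<omega>)) = (LINT \<omega>:G|M. norm (x + W (real_of_ereal (T1 \<omega>)) \<omega> - (1, 0)) / 2)"
    unfolding set_lebesgue_integral_def Zeq
    by (rule Bochner_Integration.integral_cong) (auto simp: Geq \<psi>V3 split: split_indicator)
  finally have 2: "(\<lambda>n. order_prob (cap n) [3, 2, 1]) \<longlonglongrightarrow> (LINT \<omega>:G|M. norm (x + W (real_of_ereal (T1 \<omega>)) \<omega> - (1, 0)) / 2)" .
  show ?thesis
  proof
    show "(\<lambda>n. elimination_prob (n * A) (n * B) (n * C) [3, 2, 1] + elimination_prob (n * A) (n * B) (n * C) [3, 1, 2])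
        \<longlonglongrightarrow> measure M G"
      by (rule LIMSEQ_imp_Suc) (use 1 in \<open>simp only: elimination_prob_eq cap_def\<close>)
    show "(\<lambda>n. elimination_prob (n * A) (n * B) (n * C) [3, 2, 1])
        \<longlonglongrightarrow> (LINT \<omega>:G|M. norm (x + W (real_of_ereal (T1 \<omega>)) \<omega> - (1, 0)) / 2)"
      by (rule LIMSEQ_imp_Suc) (use 2 in \<open>simp only: elimination_prob_eq cap_def\<close>)
  qed
qed

end
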